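(* For every integer $k\ge 2$ and every $k$-tuple $(m_1,\dots,m_k)$ of positive integers, taking alphabets $X_1,\dots,X_k$ with $|X_i|=m_i$, neither of the groups $\mathscr{G}(C_u)$ and $\mathscr{G}(C_m)$ associated with the $k$-graphs $C_u$ (uniform labelling) and $C_m$ (mixed labelling) is isomorphic to a Brin--Thompson group $nV$ for any $n\ge 2$.
   Context: Categories and higher rank graphs. $\mathbb{N}=\{0,1,2,\dots\}$. A category $C$ is regarded as a set of arrows with set of identities $C_o\subseteq C$; each arrow $a$ has domain $\mathbf{d}(a)\in C_o$ and codomain $\mathbf{r}(a)\in C_o$, and $ab$ is defined exactly when $\mathbf{d}(a)=\mathbf{r}(b)$. Put $XC=\{xc: x\in X, c\in C, xc\text{ defined}\}$. A $k$-graph is a countable category $C$ with a functor $d\colon C\to\mathbb{N}^k$ (the degree) such that whenever $d(a)=\mathbf{m}+\mathbf{n}$ there are unique $a_1,a_2$ with $a=a_1a_2$, $d(a_1)=\mathbf{m}$, $d(a_2)=\mathbf{n}$. The $k$-graphs $C_u$, $C_m$. Let $X_1,\dots,X_k$ be pairwise disjoint finite alphabets with $|X_i|=m_i$, let $X=\bigcup_i X_i$, and let $\ell\colon X\to\mathbb{Z}_2=\mathbb{Z}/2$ be a labelling. Let $\overline{X}_i=\{\overline{x}:x\in X_i\}$ be a disjoint copy of $X_i$. Let $E_\ell$ be the directed graph with vertex set $\{(v,0),(v,1)\}$ (identified with $\mathbb{Z}_2$) and, for each $1\le i\le k$, edges of colour $i$: $(x,j)$ and $(\overline{x},j)$ for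 $x\in X_i$, $j\in\mathbb{Z}_2$, where $\mathbf{r}(x,j)=j$, $\mathbf{d}(x,j)=j+\ell(x)$, $\mathbf{r}(\overline{x},j)=j+\ell(x)$, $\mathbf{d}(\overline{x},j)=j$. The $k$-graph $C_\ell$ is the quotient of the free category (paths) on $E_\ell$ by the congruence generated by the following relations, for all $i\ne i'$, $a\in X_i$, $b\in X_{i'}$, $t\in\mathbb{Z}_2$: $(a,t)(b,t+\ell(a))=(b,t)(a,t+\ell(b))$, $(a,t+\ell(b))(\overline{b},t+\ell(a))=(\overline{b},t)(a,t)$, $(\overline{a},t)(b,t)=(b,t+\ell(a))(\overline{a},t+\ell(b))$, $(\overline{b},t+\ell(a))(\overline{a},t)=(\overline{a},t+\ell(b))(\overline{b},t)$; the degree of a path has $i$th coordinate the number of its edges of colour $i$. $C_u=C_{\ell_u}$ with $\ell_u\equiv 1$ on $X$, and $C_m=C_{\ell_m}$ with $\ell_m\equiv0$ on $X_1$ and $\ell_m\equiv1$ on $X\setminus X_1$ (the subscript $m$ stands for "mixed" and is not a number). These $k$-graphs have two identities, no sources (for every identity $e$ and every $\mathbf{m}\in\mathbb{N}^k$ there is an arrow with codomain $e$ and degree $\mathbf{m}$), and only finitely many elements of each degree. The group $\mathscr{G}(C)$. A right ideal of $C$ is a (possibly empty) subset $R$ with $RC\subseteq R$; it is finitely generated if $R=XC$ with $X$ finite. A bijective morphism $\theta\colon R_1\to R_2$ of right ideals is a bijection with $\mathbf{d}(\theta(r))=\mathbf{d}(r)$ and $\theta(rc)=\theta(r)c$ whenever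 $rc$ is defined. $\mathsf{R}(C)$ is the inverse monoid of bijective morphisms between finitely generated right ideals under composition of partial bijections (zero: the empty function). In an inverse semigroup $S$ with zero, $a\le b$ means $a=ba^{-1}a$; a non-zero idempotent $e$ is essential if $ef\ne0$ for all non-zero idempotents $f$; $S^e$ is the inverse subsemigroup of $s\in S$ with $s^{-1}s$, $ss^{-1}$ essential; on $S^e$, $s\,\sigma\,t$ iff some $z\in S^e$ satisfies $z\le s,t$. Then $\mathscr{G}(C)=\mathsf{R}(C)^e/\sigma$. The group $nV$. Let $K=\{0,1\}^{\omega}$ be the Cantor space of infinite binary words. For an $n$-tuple $u=(u_1,\dots,u_n)$ of finite binary words let $[u]=\{(u_1z_1,\dots,u_nz_n): z_i\in K\}\subseteq K^n$. $nV$ is the group of homeomorphisms $h$ of $K^n$ for which there are finite partitions $\{[u^{1}],\dots,[u^{p}]\}$ and $\{[v^{1}],\dots,[v^{p}]\}$ of $K^n$ with $h(u^{i}_1z_1,\dots,u^{i}_nz_n)=(v^{i}_1z_1,\dots,v^{i}_nz_n)$ for all $i$ and all $z\in K^n$. *)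

theory Defs
  imports
    "HOL-Analysis.Function_Topology"
    "HOL-Algebra.Bij"
    "HOL-Library.Z2"
    "HOL-Library.Omega_Words_Fun"
begin

section \<open>Categories as sets of arrows\<close>

text \<open>An identity is identified with the object it belongs to, so \<open>Dom\<close> and \<open>Cod\<close> are
  arrow-valued. \<open>Comp a b\<close> is the product \<open>ab\<close>; it is meaningful only for arrows with
  \<open>Dom a = Cod b\<close>.\<close>

record 'a cat =
  Arr :: "'a set"
  Dom :: "'a \<Rightarrow> 'a"
  Cod :: "'a \<Rightarrow> 'a"
  Comp :: "'a \<Rightarrow> 'a \<Rightarrow> 'a"

text \<open>The degree of an arrow of a \<open>k\<close>-graph is an element of \<open>\<nat>\<^sup>k\<close>, encoded as a function that is
  extensional on \<open>{1..k}\<close>.\<close>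

record 'a kgraph = "'a cat" +
  deg :: "'a \<Rightarrow> nat \<Rightarrow> nat"

inductive_set cat_congruence ::
    "('a, 'z) cat_scheme \<Rightarrow> ('a \<times> 'a) set \<Rightarrow> ('a \<times> 'a) set"
  for C :: "('a, 'z) cat_scheme" and R :: "('a \<times> 'a) set" where
  base: "(a, b) \<in> R \<Longrightarrow> (a, b) \<in> cat_congruence C R"
| refl: "a \<in> Arr C \<Longrightarrow> (a, a) \<in> cat_congruence C R"
| sym: "(a, b) \<in> cat_congruence C R \<Longrightarrow> (b, a) \<in> cat_congruence C R"
| trans: "(a, b) \<in> cat_congruence C R \<Longrightarrow> (b, c) \<in> cat_congruence C R \<Longrightarrow>
    (a, c) \<in> cat_congruence C R"
| comp: "(a, b) \<in> cat_congruence C R \<Longrightarrow> (c, d) \<in> cat_congruence C R \<Longrightarrow>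
    Dom C a = Cod C c \<Longrightarrow> Dom C b = Cod C d \<Longrightarrow>
    (Comp C a c, Comp C b d) \<in> cat_congruence C R"

text \<open>The quotient by a congruence \<open>Q\<close>. The unions are the usual way to lift operations to
  classes: all the classes in the union coincide.\<close>

definition quotient_cat :: "('a, 'z) cat_scheme \<Rightarrow> ('a \<times> 'a) set \<Rightarrow> 'a set cat" where
  "quotient_cat C Q =
    \<lparr>Arr = Arr C // Q,
     Dom = (\<lambda>A. \<Union>a\<in>A. Q `` {Dom C a}),
     Cod = (\<lambda>A. \<Union>a\<in>A. Q `` {Cod C a}),
     Comp = (\<lambda>A B. \<Union>a\<in>A. \<Union>b\<in>B. Q `` {Comp C a b})\<rparr>"


section \<open>Free categories on directed graphs\<close>

record ('v, 'e) dgraph =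
  verts :: "'v set"
  edges :: "'e set"
  rng :: "'e \<Rightarrow> 'v"
  src :: "'e \<Rightarrow> 'v"

text \<open>A path is a pair of its codomain and the list of its edges; the edge list alone does not
  determine an empty path. As in a category, consecutive edges \<open>e f\<close> satisfy
  \<open>src e = rng f\<close>.\<close>

fun is_path :: "('v, 'e) dgraph \<Rightarrow> 'v \<Rightarrow> 'e list \<Rightarrow> bool" where
  "is_path E v [] \<longleftrightarrow> v \<in> verts E"
| "is_path E v (e # es) \<longleftrightarrow> v \<in> verts E \<and> e \<in> edges E \<and> rng E e = v \<and> is_path E (src E e) es"

fun path_src :: "('v, 'e) dgraph \<Rightarrow> 'v \<Rightarrow> 'e list \<Rightarrow> 'v" where
  "path_src E v [] = v"
| "path_src E v (e # es) = path_src E (src E e) es"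

definition free_cat :: "('v, 'e) dgraph \<Rightarrow> ('v \<times> 'e list) cat" where
  "free_cat E =
    \<lparr>Arr = {(v, es). is_path E v es},
     Dom = (\<lambda>(v, es). (path_src E v es, [])),
     Cod = (\<lambda>(v, es). (v, [])),
     Comp = (\<lambda>(v, es) (w, fs). (v, es @ fs))\<rparr>"


section \<open>The \<open>k\<close>-graphs of a labelling\<close>

datatype 'x letter = Pos 'x | Bar 'x

fun letter_base :: "'x letter \<Rightarrow> 'x" where
  "letter_base (Pos x) = x"
| "letter_base (Bar x) = x"

type_synonym 'x edge = "'x letter \<times> bit"
type_synonym 'x path = "bit \<times> 'x edge list"

definition edges_of_colour :: "(nat \<Rightarrow> 'x set) \<Rightarrow> nat \<Rightarrow> 'x edge set" where
  "edges_of_colour X i = {(y, j). letter_base y \<in> X i}"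

fun edge_rng :: "('x \<Rightarrow> bit) \<Rightarrow> 'x edge \<Rightarrow> bit" where
  "edge_rng l (Pos x, j) = j"
| "edge_rng l (Bar x, j) = j + l x"

fun edge_src :: "('x \<Rightarrow> bit) \<Rightarrow> 'x edge \<Rightarrow> bit" where
  "edge_src l (Pos x, j) = j + l x"
| "edge_src l (Bar x, j) = j"

definition label_graph ::
    "nat \<Rightarrow> (nat \<Rightarrow> 'x set) \<Rightarrow> ('x \<Rightarrow> bit) \<Rightarrow> (bit, 'x edge) dgraph" where
  "label_graph k X l =
    \<lparr>verts = UNIV,
     edges = (\<Union>i\<in>{1..k}. edges_of_colour X i),
     rng = edge_rng l,
     src = edge_src l\<rparr>"

definition path2 :: "('x \<Rightarrow> bit) \<Rightarrow> 'x edge \<Rightarrow> 'x edge \<Rightarrow> 'x path" where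
  "path2 l e f = (edge_rng l e, [e, f])"

inductive_set label_rel ::
    "nat \<Rightarrow> (nat \<Rightarrow> 'x set) \<Rightarrow> ('x \<Rightarrow> bit) \<Rightarrow> ('x path \<times> 'x path) set"
  for k :: nat and X :: "nat \<Rightarrow> 'x set" and l :: "'x \<Rightarrow> bit" where
  pos_pos: "i \<in> {1..k} \<Longrightarrow> i' \<in> {1..k} \<Longrightarrow> i \<noteq> i' \<Longrightarrow> a \<in> X i \<Longrightarrow> b \<in> X i' \<Longrightarrow>
    (path2 l (Pos a, t) (Pos b, t + l a), path2 l (Pos b, t) (Pos a, t + l b))
      \<in> label_rel k X l"
| pos_bar: "i \<in> {1..k} \<Longrightarrow> i' \<in> {1..k} \<Longrightarrow> i \<noteq> i' \<Longrightarrow> a \<in> X i \<Longrightarrow> b \<in> X i' \<Longrightarrow>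
    (path2 l (Pos a, t + l b) (Bar b, t + l a), path2 l (Bar b, t) (Pos a, t))
      \<in> label_rel k X l"
| bar_pos: "i \<in> {1..k} \<Longrightarrow> i' \<in> {1..k} \<Longrightarrow> i \<noteq> i' \<Longrightarrow> a \<in> X i \<Longrightarrow> b \<in> X i' \<Longrightarrow>
    (path2 l (Bar a, t) (Pos b, t), path2 l (Pos b, t + l a) (Bar a, t + l b))
      \<in> label_rel k X l"
| bar_bar: "i \<in> {1..k} \<Longrightarrow> i' \<in> {1..k} \<Longrightarrow> i \<noteq> i' \<Longrightarrow> a \<in> X i \<Longrightarrow> b \<in> X i' \<Longrightarrow>
    (path2 l (Bar b, t + l a) (Bar a, t), path2 l (Bar a, t + l b) (Bar b, t))
      \<in> label_rel k X l"

definition path_deg :: "nat \<Rightarrow> (nat \<Rightarrow> 'x set) \<Rightarrow> 'x path \<Rightarrow> nat \<Rightarrow> nat" where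
  "path_deg k X p = (\<lambda>i\<in>{1..k}. length (filter (\<lambda>e. e \<in> edges_of_colour X i) (snd p)))"

text \<open>The defining relations preserve degrees, so the degree of a class is the common degree of
  its members.\<close>

definition C_label :: "nat \<Rightarrow> (nat \<Rightarrow> 'x set) \<Rightarrow> ('x \<Rightarrow> bit) \<Rightarrow> 'x path set kgraph" where
  "C_label k X l =
    (let F = free_cat (label_graph k X l)
     in cat.extend (quotient_cat F (cat_congruence F (label_rel k X l)))
          (kgraph.fields (\<lambda>A. the_elem (path_deg k X ` A))))"

definition C_u :: "nat \<Rightarrow> (nat \<Rightarrow> 'x set) \<Rightarrow> 'x path set kgraph" where
  "C_u k X = C_label k X (\<lambda>x. 1)"

definition C_m :: "nat \<Rightarrow> (nat \<Rightarrow> 'x set) \<Rightarrow> 'x path set kgraph" where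
  "C_m k X = C_label k X (\<lambda>x. if x \<in> X 1 then 0 else 1)"


section \<open>Inverse semigroups with zero\<close>

record 'a zmonoid = "'a monoid" +
  mzero :: 'a

definition sinv :: "('a, 'z) monoid_scheme \<Rightarrow> 'a \<Rightarrow> 'a" where
  "sinv S a = (THE b. b \<in> carrier S \<and>
      a \<otimes>\<^bsub>S\<^esub> b \<otimes>\<^bsub>S\<^esub> a = a \<and> b \<otimes>\<^bsub>S\<^esub> a \<otimes>\<^bsub>S\<^esub> b = b)"

definition nat_le :: "('a, 'z) monoid_scheme \<Rightarrow> 'a \<Rightarrow> 'a \<Rightarrow> bool" where
  "nat_le S a b \<longleftrightarrow> a = b \<otimes>\<^bsub>S\<^esub> sinv S a \<otimes>\<^bsub>S\<^esub> a"

definition nonzero_idempotents :: "('a, 'z) zmonoid_scheme \<Rightarrow> 'a set" where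
  "nonzero_idempotents S = {e \<in> carrier S. e \<otimes>\<^bsub>S\<^esub> e = e \<and> e \<noteq> mzero S}"

definition essential :: "('a, 'z) zmonoid_scheme \<Rightarrow> 'a \<Rightarrow> bool" where
  "essential S e \<longleftrightarrow> e \<in> nonzero_idempotents S \<and>
    (\<forall>f \<in> nonzero_idempotents S. e \<otimes>\<^bsub>S\<^esub> f \<noteq> mzero S)"

definition ess_part :: "('a, 'z) zmonoid_scheme \<Rightarrow> 'a set" where
  "ess_part S = {s \<in> carrier S.
    essential S (sinv S s \<otimes>\<^bsub>S\<^esub> s) \<and> essential S (s \<otimes>\<^bsub>S\<^esub> sinv S s)}"

definition sigma_ess :: "('a, 'z) zmonoid_scheme \<Rightarrow> ('a \<times> 'a) set" where
  "sigma_ess S = {(s, t). s \<in> ess_part S \<and> t \<in> ess_part S \<and>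
    (\<exists>z \<in> ess_part S. nat_le S z s \<and> nat_le S z t)}"

definition ess_quotient :: "('a, 'z) zmonoid_scheme \<Rightarrow> 'a set monoid" where
  "ess_quotient S =
    \<lparr>carrier = ess_part S // sigma_ess S,
     mult = (\<lambda>A B. \<Union>a\<in>A. \<Union>b\<in>B. sigma_ess S `` {a \<otimes>\<^bsub>S\<^esub> b}),
     one = sigma_ess S `` {\<one>\<^bsub>S\<^esub>}\<rparr>"


section \<open>The group of a category\<close>

definition set_mult :: "('a, 'z) cat_scheme \<Rightarrow> 'a set \<Rightarrow> 'a set \<Rightarrow> 'a set" where
  "set_mult C A B = {Comp C a b | a b. a \<in> A \<and> b \<in> B \<and> Dom C a = Cod C b}"

definition right_ideal :: "('a, 'z) cat_scheme \<Rightarrow> 'a set \<Rightarrow> bool" where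
  "right_ideal C R \<longleftrightarrow> R \<subseteq> Arr C \<and> set_mult C R (Arr C) \<subseteq> R"

definition fg_right_ideal :: "('a, 'z) cat_scheme \<Rightarrow> 'a set \<Rightarrow> bool" where
  "fg_right_ideal C R \<longleftrightarrow> right_ideal C R \<and>
    (\<exists>X. finite X \<and> X \<subseteq> Arr C \<and> R = set_mult C X (Arr C))"

text \<open>Partial bijections are partial maps; \<open>dom\<close> and \<open>ran\<close> are those of maps, \<open>Dom\<close> is that of
  arrows.\<close>

definition bij_morphism ::
    "('a, 'z) cat_scheme \<Rightarrow> 'a set \<Rightarrow> 'a set \<Rightarrow> ('a \<rightharpoonup> 'a) \<Rightarrow> bool" where
  "bij_morphism C R1 R2 \<theta> \<longleftrightarrow>
    dom \<theta> = R1 \<and> bij_betw (\<lambda>r. the (\<theta> r)) R1 R2 \<and>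
    (\<forall>r \<in> R1. Dom C (the (\<theta> r)) = Dom C r) \<and>
    (\<forall>r \<in> R1. \<forall>c \<in> Arr C. Dom C r = Cod C c \<longrightarrow>
      \<theta> (Comp C r c) = Some (Comp C (the (\<theta> r)) c))"

definition R_monoid :: "('a, 'z) cat_scheme \<Rightarrow> ('a \<rightharpoonup> 'a) zmonoid" where
  "R_monoid C =
    \<lparr>carrier = {\<theta>. \<exists>R1 R2. fg_right_ideal C R1 \<and> fg_right_ideal C R2 \<and> bij_morphism C R1 R2 \<theta>},
     mult = (\<lambda>\<theta> \<phi>. \<theta> \<circ>\<^sub>m \<phi>),
     one = (\<lambda>a. if a \<in> Arr C then Some a else None),
     mzero = Map.empty\<rparr>"

definition G_group :: "('a, 'z) cat_scheme \<Rightarrow> ('a \<rightharpoonup> 'a) set monoid" where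
  "G_group C = ess_quotient (R_monoid C)"


section \<open>Brin--Thompson groups\<close>

text \<open>Bits of words in the Cantor space are encoded as truth values, since \<open>bool\<close> carries the
  discrete topology. Points of the \<open>n\<close>-th power are extensional functions on \<open>{..<n}\<close>.\<close>

definition cantor_power :: "nat \<Rightarrow> (nat \<Rightarrow> bool word) topology" where
  "cantor_power n = product_topology (\<lambda>_. euclidean) {..<n}"

definition prepend ::
    "nat \<Rightarrow> (nat \<Rightarrow> bool list) \<Rightarrow> (nat \<Rightarrow> bool word) \<Rightarrow> nat \<Rightarrow> bool word" where
  "prepend n u z = (\<lambda>j\<in>{..<n}. u j \<frown> z j)"

definition cone :: "nat \<Rightarrow> (nat \<Rightarrow> bool list) \<Rightarrow> (nat \<Rightarrow> bool word) set" where
  "cone n u = prepend n u ` topspace (cantor_power n)"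

definition cone_partition :: "nat \<Rightarrow> nat \<Rightarrow> (nat \<Rightarrow> nat \<Rightarrow> bool list) \<Rightarrow> bool" where
  "cone_partition n p u \<longleftrightarrow>
    disjoint_family_on (\<lambda>i. cone n (u i)) {..<p} \<and>
    (\<Union>i<p. cone n (u i)) = topspace (cantor_power n)"

definition brin_thompson ::
    "nat \<Rightarrow> ((nat \<Rightarrow> bool word) \<Rightarrow> (nat \<Rightarrow> bool word)) monoid" where
  "brin_thompson n = (BijGroup (topspace (cantor_power n)))
    \<lparr>carrier := {h \<in> Bij (topspace (cantor_power n)).
       homeomorphic_map (cantor_power n) (cantor_power n) h \<and>
       (\<exists>p u v. cone_partition n p u \<and> cone_partition n p v \<and>
          (\<forall>i<p. \<forall>z \<in> topspace (cantor_power n).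
             h (prepend n (u i) z) = prepend n (v i) z))}\<rparr>"

end

theory Submission
  imports Defs "HOL-Number_Theory.Cong"
begin

text \<open>In the category of the \<open>k\<close>-graph of a labelling, letters of different colours commute, so an arrow
  is a vertex together with one finite word in each of the \<open>k\<close> alphabets, and the vertex at the
  far end is the near one plus the labels of all the letters. Consequently the group of that
  category is a group of bijections of a space of tuples of infinite words: those which, at some depth, replace
  prefixes by prefixes with the same far end (\<open>germs_iso\<close>). A Brin--Thompson group has the same
  shape, with one vertex and binary alphabets (\<open>brin_thompson_iso\<close>).

  An isomorphism of two such groups is induced by a map of the spaces. Following Fremlin, for an
  involution \<open>\<pi>\<close> the elements supported in the support of \<open>\<pi>\<close> are described by a formula in
  the language of groups (\<open>supported_iff\<close>); as every cone is the support of an involution, an isomorphism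
  sees inclusion and disjointness of cones, and nested cones give an equivariant injection \<open>\<Phi>\<close>
  (\<open>\<Phi>_equivariant\<close>, \<open>\<Phi>_inj\<close>).

  Now let \<open>i\<close> be a colour all of whose letters have label \<open>1\<close>, with \<open>m\<close> letters \<open>x\<close>. Fix the vertex
  and fix alternating words in all other coordinates. On this slice a cone given by a word \<open>u\<close> in coordinate
  \<open>i\<close> gets weight \<open>(-1) ^ length u\<close> modulo \<open>2 * m + 1\<close>. This is additive, since a
  cone splits into \<open>2 * m\<close> cones of the next depth and \<open>2 * m\<close> is \<open>-1\<close>. It is invariant under the group, since
  the labels record the parity of the length (\<open>weight_invariant\<close>). The whole slice has weight
  \<open>1\<close>. The slice is also cut out inside a cone by the equation \<open>g x = x\<close> for an element \<open>g\<close> of the group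
  (\<open>slice_as_fixed_set\<close>). Hence \<open>\<Phi>\<close> carries it into the fixed points of an element of the Brin--Thompson group,
  and these form, in small cones, products in which some coordinate is free. Splitting such a
  product along a free coordinate gives two halves that the group identifies with the whole, so its
  weight is twice itself and vanishes (\<open>weight_halving\<close>). Adding up finitely many pieces, the slice has
  weight \<open>0\<close>, while \<open>1\<close> is not \<open>0\<close> modulo \<open>2 * m + 1\<close> (\<open>no_iso\<close>).

  Since \<open>k \<ge> 2\<close>, the colour \<open>2\<close> serves as \<open>i\<close> both for the uniform and for the mixed labelling.\<close>

section \<open>Spaces of tuples of infinite words\<close>

text \<open>The simplifier would turn sums of vertices and labels into exclusive disjunctions.\<close>

declare add_bit_eq_xor [simp del]

text \<open>The involution \<open>flip\<close> of the alphabets respects labels, so flipping a letter of a point does not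
  affect the vertices along it. It is the source of involutions with prescribed support.\<close>

locale word_space =
  fixes J :: "nat set" and A :: "nat \<Rightarrow> 'a set" and V :: "bit set"
    and lab :: "'a \<Rightarrow> bit" and flip :: "'a \<Rightarrow> 'a"
  assumes finite_J: "finite J" and J_nonempty: "J \<noteq> {}"
    and finite_A: "j \<in> J \<Longrightarrow> finite (A j)" and A_nonempty: "j \<in> J \<Longrightarrow> A j \<noteq> {}"
    and V_nonempty: "V \<noteq> {}"
    and V_closed: "v \<in> V \<Longrightarrow> j \<in> J \<Longrightarrow> a \<in> A j \<Longrightarrow> v + lab a \<in> V"
    and flip_closed: "j \<in> J \<Longrightarrow> a \<in> A j \<Longrightarrow> flip a \<in> A j"
    and flip_neq: "flip a \<noteq> a" and flip_flip: "flip (flip a) = a"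
    and lab_flip: "lab (flip a) = lab a"
begin

definition words :: "(nat \<Rightarrow> 'a list) set" where
  "words = (\<Pi>\<^sub>E j\<in>J. lists (A j))"

definition streams :: "(nat \<Rightarrow> 'a word) set" where
  "streams = (\<Pi>\<^sub>E j\<in>J. UNIV \<rightarrow> A j)"

definition arrows :: "(bit \<times> (nat \<Rightarrow> 'a list)) set" where
  "arrows = V \<times> words"

definition points :: "(bit \<times> (nat \<Rightarrow> 'a word)) set" where
  "points = V \<times> streams"

definition wconc :: "(nat \<Rightarrow> 'a list) \<Rightarrow> (nat \<Rightarrow> 'a word) \<Rightarrow> nat \<Rightarrow> 'a word" where
  "wconc r w = (\<lambda>j\<in>J. r j \<frown> w j)"

definition app :: "bit \<times> (nat \<Rightarrow> 'a list) \<Rightarrow> (nat \<Rightarrow> 'a word) \<Rightarrow> bit \<times> (nat \<Rightarrow> 'a word)"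
    (infixr \<open>\<cdot>\<close> 70) where
  "p \<cdot> w = (fst p, wconc (snd p) w)"

definition ext :: "bit \<times> (nat \<Rightarrow> 'a list) \<Rightarrow> (nat \<Rightarrow> 'a list) \<Rightarrow> bit \<times> (nat \<Rightarrow> 'a list)"
    (infixl \<open>\<star>\<close> 75) where
  "p \<star> r = (fst p, \<lambda>j\<in>J. snd p j @ r j)"

definition labs :: "(nat \<Rightarrow> 'a list) \<Rightarrow> bit" where
  "labs r = (\<Sum>j\<in>J. sum_list (map lab (r j)))"

text \<open>The vertex from which the stream prefixed by an arrow starts; in the category it is the domain of
  the arrow.\<close>

definition target :: "bit \<times> (nat \<Rightarrow> 'a list) \<Rightarrow> bit" where
  "target p = fst p + labs (snd p)"

definition cut :: "nat \<Rightarrow> bit \<times> (nat \<Rightarrow> 'a word) \<Rightarrow> bit \<times> (nat \<Rightarrow> 'a list)" where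
  "cut N x = (fst x, \<lambda>j\<in>J. prefix N (snd x j))"

definition rest :: "nat \<Rightarrow> bit \<times> (nat \<Rightarrow> 'a word) \<Rightarrow> nat \<Rightarrow> 'a word" where
  "rest N x = (\<lambda>j\<in>J. suffix N (snd x j))"

abbreviation len :: "bit \<times> (nat \<Rightarrow> 'a list) \<Rightarrow> nat \<Rightarrow> nat" where
  "len p j \<equiv> length (snd p j)"

text \<open>Depth is taken equal in all coordinates, so that the arrows of one depth are finitely many and
  their cones partition the space.\<close>

definition depth :: "nat \<Rightarrow> bit \<times> (nat \<Rightarrow> 'a list) \<Rightarrow> bool" where
  "depth N p \<longleftrightarrow> (\<forall>j\<in>J. len p j = N)"

lemma app_nth: "j \<in> J \<Longrightarrow> snd (p \<cdot> w) j t = (if t < len p j then snd p j ! t else w j (t - len p j))"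
  by (simp add: app_def wconc_def conc_def)

lemma fst_app [simp]: "fst (p \<cdot> w) = fst p" by (simp add: app_def)
lemma fst_ext [simp]: "fst (p \<star> r) = fst p" by (simp add: ext_def)
lemma fst_cut [simp]: "fst (cut N x) = fst x" by (simp add: cut_def)

lemma len_ext [simp]: "j \<in> J \<Longrightarrow> len (p \<star> r) j = len p j + length (r j)"
  by (simp add: ext_def)

lemma len_cut [simp]: "j \<in> J \<Longrightarrow> len (cut N x) j = N"
  by (simp add: cut_def subsequence_def)

lemma depth_cut [simp]: "depth N (cut N x)"
  by (simp add: depth_def)

lemma wordsD: "r \<in> words \<Longrightarrow> j \<in> J \<Longrightarrow> set (r j) \<subseteq> A j"
  by (auto simp: words_def)

lemma streamsD: "w \<in> streams \<Longrightarrow> j \<in> J \<Longrightarrow> w j t \<in> A j"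
  by (auto simp: streams_def PiE_def Pi_def)

lemma streamsI: "(\<And>j t. j \<in> J \<Longrightarrow> w j t \<in> A j) \<Longrightarrow> w \<in> extensional J \<Longrightarrow> w \<in> streams"
  by (auto simp: streams_def PiE_def Pi_def)

lemma streams_eqI:
  "w \<in> streams \<Longrightarrow> w' \<in> streams \<Longrightarrow> (\<And>j t. j \<in> J \<Longrightarrow> w j t = w' j t) \<Longrightarrow> w = w'"
  unfolding streams_def by (rule PiE_ext) auto

lemma words_eqI:
  "r \<in> words \<Longrightarrow> r' \<in> words \<Longrightarrow> (\<And>j. j \<in> J \<Longrightarrow> r j = r' j) \<Longrightarrow> r = r'"
  unfolding words_def by (rule PiE_ext)

lemma wconc_streams: "r \<in> words \<Longrightarrow> w \<in> streams \<Longrightarrow> wconc r w \<in> streams"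
  by (rule streamsI) (auto simp: wconc_def conc_def dest: wordsD streamsD nth_mem)

lemma app_points: "p \<in> arrows \<Longrightarrow> w \<in> streams \<Longrightarrow> p \<cdot> w \<in> points"
  by (auto simp: arrows_def points_def app_def intro: wconc_streams)

lemma append_words: "r \<in> words \<Longrightarrow> r' \<in> words \<Longrightarrow> (\<lambda>j\<in>J. r j @ r' j) \<in> words"
  by (auto simp: words_def PiE_iff)

lemma ext_arrows: "p \<in> arrows \<Longrightarrow> r \<in> words \<Longrightarrow> p \<star> r \<in> arrows"
  by (auto simp: arrows_def ext_def intro: append_words)

lemma ext_app: "(p \<star> r) \<cdot> w = p \<cdot> wconc r w"
  by (auto simp: ext_def app_def wconc_def)

lemma cut_arrows: "x \<in> points \<Longrightarrow> cut N x \<in> arrows"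
  by (auto simp: points_def arrows_def cut_def words_def subsequence_def dest: streamsD)

lemma rest_streams: "x \<in> points \<Longrightarrow> rest N x \<in> streams"
  by (rule streamsI) (auto simp: rest_def points_def dest: streamsD)

lemma cut_rest: "x \<in> points \<Longrightarrow> cut N x \<cdot> rest N x = x"
  by (auto simp: points_def cut_def rest_def app_def wconc_def streams_def PiE_def
      extensional_def subsequence_def fun_eq_iff conc_def)

lemma labs_append: "labs (\<lambda>j\<in>J. r j @ r' j) = labs r + labs r'"
  by (simp add: labs_def sum.distrib)

lemma target_ext: "target (p \<star> r) = target p + labs r"
  by (simp add: target_def ext_def labs_append add.assoc)

lemma sum_list_V: "v \<in> V \<Longrightarrow> j \<in> J \<Longrightarrow> set u \<subseteq> A j \<Longrightarrow> v + sum_list (map lab u) \<in> V"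
  by (induction u arbitrary: v) (auto simp: add.assoc[symmetric] V_closed)

lemma target_V: assumes "p \<in> arrows" shows "target p \<in> V"
proof -
  have r: "snd p \<in> words" and v: "fst p \<in> V" using assms by (auto simp: arrows_def)
  have "finite I \<Longrightarrow> I \<subseteq> J \<Longrightarrow> fst p + (\<Sum>j\<in>I. sum_list (map lab (snd p j))) \<in> V" for I
  proof (induction I rule: finite_induct)
    case (insert i I)
    then have "fst p + (\<Sum>j\<in>I. sum_list (map lab (snd p j))) + sum_list (map lab (snd p i)) \<in> V"
      using wordsD[OF r] by (intro sum_list_V[where j=i]) auto
    then show ?case using insert by (simp add: ac_simps)
  qed (simp add: v)
  then show ?thesis using finite_J by (simp add: target_def labs_def)
qed

lemma streams_nonempty: obtains w where "w \<in> streams"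
proof -
  have "(\<lambda>j\<in>J. \<lambda>_. SOME a. a \<in> A j) \<in> streams"
    by (rule streamsI) (auto simp: some_in_eq A_nonempty)
  then show ?thesis using that by blast
qed

text \<open>Two arrows that are prefixes of one point are comparable in each coordinate.\<close>

lemma app_split:
  assumes p: "p \<in> arrows" and q: "q \<in> arrows" and w: "w \<in> streams" "w' \<in> streams"
    and eq: "p \<cdot> w = q \<cdot> w'" and le: "\<And>j. j \<in> J \<Longrightarrow> len q j \<le> len p j"
  obtains r where "r \<in> words" "p = q \<star> r" "w' = wconc r w"
proof
  define r where "r = (\<lambda>j\<in>J. drop (len q j) (snd p j))"
  have nth: "(if t < len p j then snd p j ! t else w j (t - len p j)) =
      (if t < len q j then snd q j ! t else w' j (t - len q j))" if "j \<in> J" for j t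
    using eq app_nth[OF that, of p w t] app_nth[OF that, of q w' t] by simp
  show r: "r \<in> words"
    using p set_drop_subset[of "len q _" "snd p _"]
    by (simp add: r_def words_def arrows_def PiE_iff lists_eq_set mem_Times_iff) (blast dest: in_set_dropD)
  have "snd p j = snd q j @ r j" if "j \<in> J" for j
  proof (rule nth_equalityI)
    show "length (snd p j) = length (snd q j @ r j)" using le[OF that] that by (simp add: r_def)
    fix t assume "t < len p j"
    then show "snd p j ! t = (snd q j @ r j) ! t"
      using nth[OF that, of t] le[OF that] that by (auto simp: r_def nth_append)
  qed
  then have "snd p = (\<lambda>j\<in>J. snd q j @ r j)"
    using p q r by (intro words_eqI append_words) (auto simp: arrows_def)
  moreover have "fst p = fst q" using eq by (metis fst_app)
  ultimately show pq: "p = q \<star> r" by (simp add: ext_def prod_eq_iff)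
  show "w' = wconc r w"
  proof (rule streams_eqI)
    fix j t assume j: "j \<in> J"
    have "w' j t = (if len q j + t < len p j then snd p j ! (len q j + t) else w j (len q j + t - len p j))"
      using nth[OF j, of "len q j + t"] by simp
    moreover have "len q j + t - len p j = t - (len p j - len q j)" using le[OF j] by simp
    moreover have "len q j + t < len p j \<longleftrightarrow> t < len p j - len q j" using le[OF j] by auto
    ultimately show "w' j t = wconc r w j t"
      using j le[OF j] by (simp add: wconc_def conc_def r_def)
  qed (use r w wconc_streams in auto)
qed

lemma app_eq_depth:
  assumes p: "p \<in> arrows" and q: "q \<in> arrows" and w: "w \<in> streams" "w' \<in> streams"
    and eq: "p \<cdot> w = q \<cdot> w'" and le: "\<And>j. j \<in> J \<Longrightarrow> len q j = len p j"
  shows "p = q" "w' = w"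
proof -
  obtain r where r: "r \<in> words" "p = q \<star> r" "w' = wconc r w"
    using app_split[OF p q w eq] le by auto
  have "r j = []" if "j \<in> J" for j
    using arg_cong[OF r(2), of "\<lambda>p. len p j"] le[OF that] that by simp
  then have "(\<lambda>j\<in>J. snd q j @ r j) = snd q" "wconc r w = w"
    using r q w words_eqI[OF append_words[of "snd q" r], of "snd q"]
      streams_eqI[OF wconc_streams[of r w] w(1)]
    by (auto simp: arrows_def wconc_def)
  then show "p = q" "w' = w" using r by (auto simp: ext_def prod_eq_iff)
qed

lemma cut_app: assumes "p \<in> arrows" "w \<in> streams" "depth N p"
  shows "cut N (p \<cdot> w) = p" "rest N (p \<cdot> w) = w"
proof -
  have x: "p \<cdot> w \<in> points" using assms app_points by blast
  show "cut N (p \<cdot> w) = p" "rest N (p \<cdot> w) = w"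
    using app_eq_depth[OF cut_arrows[OF x] assms(1) rest_streams[OF x] assms(2) cut_rest[OF x]] assms(3)
    by (auto simp: depth_def)
qed

lemma arrows_split:
  assumes p: "p \<in> arrows" and N: "\<And>j. j \<in> J \<Longrightarrow> N \<le> len p j"
  obtains q r where "q \<in> arrows" "depth N q" "r \<in> words" "p = q \<star> r"
proof -
  obtain w where w: "w \<in> streams" by (rule streams_nonempty)
  have x: "p \<cdot> w \<in> points" using assms w app_points by blast
  show ?thesis
    using app_split[OF p cut_arrows[OF x] w rest_streams[OF x] cut_rest[OF x, symmetric]] N that
      cut_arrows[OF x] by (metis depth_cut len_cut)
qed

lemma cut_extend:
  assumes p: "p \<in> arrows" and w: "w \<in> streams" and N: "\<And>j. j \<in> J \<Longrightarrow> len p j \<le> N"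
  obtains r where "r \<in> words" "cut N (p \<cdot> w) = p \<star> r" "w = wconc r (rest N (p \<cdot> w))"
proof -
  have x: "p \<cdot> w \<in> points" using assms w app_points by blast
  show ?thesis
    using app_split[OF cut_arrows[OF x] p rest_streams[OF x] w cut_rest[OF x]] N that
    by (metis len_cut)
qed

lemma app_inj:
  assumes "p \<in> arrows" "w \<in> streams" "w' \<in> streams" "p \<cdot> w = p \<cdot> w'"
  shows "w = w'"
  using app_eq_depth(2)[OF assms(1,1,2,3,4)] by simp

text \<open>An arrow is recovered from its action on streams: if the lengths differed in a coordinate \<open>j\<close>, the words in
  that coordinate would be periodic, which the two letters \<open>a\<close> and \<open>flip a\<close> prevent.\<close>

lemma arrow_eqI:
  assumes p: "p \<in> arrows" and q: "q \<in> arrows" and eq: "\<And>w. w \<in> streams \<Longrightarrow> p \<cdot> w = q \<cdot> w"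
  shows "p = q"
proof -
  have *: False if pq: "\<And>w. w \<in> streams \<Longrightarrow> p \<cdot> w = q \<cdot> w" and j: "j \<in> J" and lt: "len p j < len q j" for p q j
  proof -
    obtain a where a: "a \<in> A j" using A_nonempty[OF j] by blast
    obtain w0 where w0: "w0 \<in> streams" by (rule streams_nonempty)
    define w where "w = w0(j := \<lambda>t. if t = 0 then flip a else a)"
    have w: "w \<in> streams"
      using w0 a j flip_closed[OF j a]
      by (intro streamsI) (auto simp: w_def streams_def PiE_def extensional_def Pi_def)
    have "w j (len q j - len p j) = w j 0"
      using pq[OF w] app_nth[OF j, of p w "len q j"] app_nth[OF j, of q w "len q j"] lt by simp
    then show False using lt flip_neq[of a] by (auto simp: w_def)
  qed
  have "len q j = len p j" if "j \<in> J" for j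
    using *[of p q j] *[of q p j] eq that by (metis linorder_neqE_nat)
  then show ?thesis using app_eq_depth(1)[OF p q] streams_nonempty eq by metis
qed

lemma finite_depth: "finite {p \<in> arrows. depth N p}"
proof (rule finite_subset)
  have "V \<subseteq> {0, 1}" by (auto intro: bit.exhaust)
  then have "finite V" using finite_subset by blast
  moreover have "finite (\<Pi>\<^sub>E j\<in>J. {u. set u \<subseteq> A j \<and> length u = N})"
    using finite_J finite_A by (intro finite_PiE finite_lists_length_eq)
  ultimately show "finite (V \<times> (\<Pi>\<^sub>E j\<in>J. {u. set u \<subseteq> A j \<and> length u = N}))" by blast
qed (auto simp: arrows_def depth_def words_def PiE_def Pi_def)

end

section \<open>Prefix replacements\<close>

context word_space begin

definition replaces where
  "replaces h p q \<longleftrightarrow> q \<in> arrows \<and> target q = target p \<and> (\<forall>w\<in>streams. h (p \<cdot> w) = q \<cdot> w)"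

definition table where
  "table h N \<longleftrightarrow> (\<forall>p\<in>arrows. depth N p \<longrightarrow> (\<exists>q. replaces h p q))"

text \<open>This is a topological full group. The prefixes in a table have equal targets but possibly different
  lengths; \<open>G\<close> below is the group with this carrier.\<close>

definition Pref where
  "Pref = {h \<in> Bij points. \<exists>N. table h N}"

definition G where
  "G = BijGroup points\<lparr>carrier := Pref\<rparr>"

lemma replacesD: "replaces h p q \<Longrightarrow> w \<in> streams \<Longrightarrow> h (p \<cdot> w) = q \<cdot> w"
  by (simp add: replaces_def)

lemma replaces_ext: "replaces h p q \<Longrightarrow> r \<in> words \<Longrightarrow> replaces h (p \<star> r) (q \<star> r)"
  by (auto simp: replaces_def ext_arrows target_ext ext_app wconc_streams)

lemma table_long:
  assumes "table h N" "p \<in> arrows" "\<And>j. j \<in> J \<Longrightarrow> N \<le> len p j"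
  obtains q where "replaces h p q"
  using arrows_split[OF assms(2,3)] assms(1) replaces_ext unfolding table_def by metis

lemma table_mono: "table h N \<Longrightarrow> N \<le> M \<Longrightarrow> table h M"
  unfolding table_def[of h M] depth_def by (metis table_long)

lemma table_comp:
  assumes h: "table h N" and g: "table g M"
  shows "table (compose points h g) (M + N)"
  unfolding table_def
proof (intro ballI impI)
  fix p assume p: "p \<in> arrows" "depth (M + N) p"
  then have "M \<le> len p j" if "j \<in> J" for j using that by (simp add: depth_def)
  then obtain p0 r where p0: "p0 \<in> arrows" "depth M p0" "r \<in> words" "p = p0 \<star> r"
    using arrows_split[OF p(1)] by blast
  obtain q where q: "replaces g p0 q" using g p0 by (auto simp: table_def)
  have "N \<le> len (q \<star> r) j" if "j \<in> J" for j
    using p p0 that by (auto simp: depth_def)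
  then obtain q' where q': "replaces h (q \<star> r) q'"
    using table_long[OF h] ext_arrows q p0 unfolding replaces_def by metis
  have "replaces g p (q \<star> r)" using replaces_ext[OF q] p0 by simp
  then have "replaces (compose points h g) p q'"
    using q' p by (auto simp: replaces_def compose_def app_points)
  then show "\<exists>q. replaces (compose points h g) p q" ..
qed

lemma Pref_Bij: "h \<in> Pref \<Longrightarrow> h \<in> Bij points" by (simp add: Pref_def)

lemma Pref_points: "h \<in> Pref \<Longrightarrow> x \<in> points \<Longrightarrow> h x \<in> points"
  using Bij_imp_funcset[OF Pref_Bij] by blast

lemma Pref_inj: "h \<in> Pref \<Longrightarrow> x \<in> points \<Longrightarrow> y \<in> points \<Longrightarrow> h x = h y \<Longrightarrow> x = y"
  by (auto simp: Pref_def Bij_def bij_betw_def inj_on_def)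

lemma Pref_surj: "h \<in> Pref \<Longrightarrow> y \<in> points \<Longrightarrow> \<exists>x\<in>points. h x = y"
proof -
  assume "h \<in> Pref" "y \<in> points"
  then have "y \<in> h ` points" by (auto simp: Pref_def Bij_def bij_betw_def)
  then show ?thesis by blast
qed

lemma Pref_eqI: "h \<in> Pref \<Longrightarrow> g \<in> Pref \<Longrightarrow> (\<And>x. x \<in> points \<Longrightarrow> h x = g x) \<Longrightarrow> h = g"
  using extensionalityI[of h points g] by (auto simp: Pref_def Bij_def)

text \<open>Only finitely many cones occur in a table. At a depth that exceeds the lengths of all the new prefixes,
  each cone lies in the image of a cone of the table, which inverts the replacement.\<close>

lemma table_inv:
  assumes "h \<in> Pref"
  shows "\<exists>N. table (\<lambda>x\<in>points. inv_into points h x) N"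
proof -
  obtain N where N: "table h N" using assms by (auto simp: Pref_def)
  define D where "D = {p \<in> arrows. depth N p}"
  have "\<forall>p\<in>D. \<exists>q. replaces h p q" using N by (simp add: table_def D_def)
  then obtain f where f: "\<And>p. p \<in> D \<Longrightarrow> replaces h p (f p)" by metis
  define M where "M = Max ((\<lambda>(p, j). len (f p) j) ` (D \<times> J))"
  have M: "len (f p) j \<le> M" if "p \<in> D" "j \<in> J" for p j
    unfolding M_def using that finite_J finite_depth[of N] D_def by (intro Max_ge) force+
  have "table (\<lambda>x\<in>points. inv_into points h x) M"
    unfolding table_def
  proof (intro ballI impI)
    fix p assume p: "p \<in> arrows" "depth M p"
    obtain w where w: "w \<in> streams" by (rule streams_nonempty)
    then obtain x where x: "x \<in> points" "h x = p \<cdot> w"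
      using Pref_surj[OF assms] p app_points by metis
    define p1 where "p1 = cut N x"
    have p1: "p1 \<in> D" using x cut_arrows by (simp add: D_def p1_def)
    have "h x = f p1 \<cdot> rest N x"
      using replacesD[OF f[OF p1] rest_streams[OF x(1), of N]] cut_rest[OF x(1), of N] by (simp add: p1_def)
    then obtain r where r: "r \<in> words" "p = f p1 \<star> r"
      using app_split[OF p(1) _ w rest_streams[OF x(1), of N], of "f p1"] x(2) f[OF p1] M[OF p1] p(2)
      unfolding replaces_def depth_def by metis
    have 1: "replaces h (p1 \<star> r) p" using replaces_ext[OF f[OF p1] r(1)] r by simp
    have 2: "p1 \<star> r \<in> arrows" using p1 r ext_arrows by (simp add: D_def)
    have inj: "inj_on h points" using assms Pref_inj by (auto simp: inj_on_def)
    have "replaces (\<lambda>x\<in>points. inv_into points h x) p (p1 \<star> r)"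
      using 1 2 inj app_points[OF p(1)] app_points[OF 2]
      unfolding replaces_def by (metis inv_into_f_f restrict_apply')
    then show "\<exists>q. replaces (\<lambda>x\<in>points. inv_into points h x) p q" ..
  qed
  then show ?thesis ..
qed

lemma replaces_id: "p \<in> arrows \<Longrightarrow> replaces (\<lambda>x\<in>points. x) p p"
  by (simp add: replaces_def app_points)

lemma subgroup_Pref: "subgroup Pref (BijGroup points)"
proof -
  interpret B: group "BijGroup points" by (rule group_BijGroup)
  show ?thesis
  proof (rule B.subgroupI)
    show "Pref \<subseteq> carrier (BijGroup points)" by (auto simp: BijGroup_def Pref_def)
    have "table (\<lambda>x\<in>points. x) 0" using replaces_id by (auto simp: table_def)
    then show "Pref \<noteq> {}" using id_Bij unfolding Pref_def by blast
    fix h assume h: "h \<in> Pref"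
    then show "inv\<^bsub>BijGroup points\<^esub> h \<in> Pref"
      using table_inv[OF h] by (simp add: inv_BijGroup Pref_Bij) (simp add: Pref_def restrict_inv_into_Bij)
    fix g assume "g \<in> Pref"
    then show "h \<otimes>\<^bsub>BijGroup points\<^esub> g \<in> Pref"
      using h compose_Bij[of h points g]
      by (auto simp: BijGroup_def Pref_def dest: table_comp)
  qed
qed

lemma group_G: "group G"
  unfolding G_def using subgroup.subgroup_is_group[OF subgroup_Pref group_BijGroup] .

lemma carrier_G [simp]: "carrier G = Pref" by (simp add: G_def)

lemma G_mult: "h \<in> Pref \<Longrightarrow> g \<in> Pref \<Longrightarrow> h \<otimes>\<^bsub>G\<^esub> g = compose points h g"
  by (simp add: G_def BijGroup_def Pref_def)

lemma G_mult_apply: "h \<in> Pref \<Longrightarrow> g \<in> Pref \<Longrightarrow> x \<in> points \<Longrightarrow> (h \<otimes>\<^bsub>G\<^esub> g) x = h (g x)"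
  by (simp add: G_mult compose_def)

lemma G_one: "\<one>\<^bsub>G\<^esub> = (\<lambda>x\<in>points. x)"
  by (simp add: G_def BijGroup_def)

lemma G_mult_closed: "h \<in> Pref \<Longrightarrow> g \<in> Pref \<Longrightarrow> h \<otimes>\<^bsub>G\<^esub> g \<in> Pref"
  using monoid.m_closed[OF group.is_monoid[OF group_G]] by simp

lemma G_inv_closed: "h \<in> Pref \<Longrightarrow> inv\<^bsub>G\<^esub> h \<in> Pref"
  using group.inv_closed[OF group_G] by simp

lemma G_inv_left: "h \<in> Pref \<Longrightarrow> x \<in> points \<Longrightarrow> (inv\<^bsub>G\<^esub> h) (h x) = x"
  using G_mult_apply[OF G_inv_closed, of h h x] group.l_inv[OF group_G, of h] by (simp add: G_one)

lemma G_inv_right: "h \<in> Pref \<Longrightarrow> x \<in> points \<Longrightarrow> h ((inv\<^bsub>G\<^esub> h) x) = x"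
  using G_mult_apply[OF _ G_inv_closed, of h h x] group.r_inv[OF group_G, of h] by (simp add: G_one)

lemma Pref_involutionI:
  assumes "\<And>x. x \<in> points \<Longrightarrow> f x \<in> points" "\<And>x. x \<in> points \<Longrightarrow> f (f x) = x"
    and "f \<in> extensional points" "table f N"
  shows "f \<in> Pref"
proof -
  have "bij_betw f points points"
    by (rule bij_betw_byWitness[where f' = f]) (use assms in auto)
  then show ?thesis using assms by (auto simp: Pref_def Bij_def)
qed

text \<open>The sets determined at some depth are the clopen sets of the product topology.\<close>

definition determined where
  "determined N B \<longleftrightarrow> B \<subseteq> points \<and> (\<forall>x\<in>points. \<forall>y\<in>points. cut N x = cut N y \<longrightarrow> (x \<in> B \<longleftrightarrow> y \<in> B))"

definition cone where
  "cone p = app p ` streams"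

lemma cut_eq_iff:
  "cut N x = cut N y \<longleftrightarrow> fst x = fst y \<and> (\<forall>j\<in>J. \<forall>t<N. snd x j t = snd y j t)"
proof -
  have "(\<lambda>j\<in>J. f j) = (\<lambda>j\<in>J. g j) \<longleftrightarrow> (\<forall>j\<in>J. f j = g j)" for f g :: "nat \<Rightarrow> 'a list"
    by (metis restrict_apply' restrict_ext)
  then show ?thesis by (auto simp: cut_def subsequence_def)
qed

lemma cut_le: "cut M x = cut M y \<Longrightarrow> N \<le> M \<Longrightarrow> cut N x = cut N y"
  by (auto simp: cut_eq_iff)

lemma determined_mono: "determined N B \<Longrightarrow> N \<le> M \<Longrightarrow> determined M B"
  unfolding determined_def using cut_le by metis

lemma determinedD: "determined N B \<Longrightarrow> x \<in> points \<Longrightarrow> y \<in> points \<Longrightarrow> cut N x = cut N y \<Longrightarrow> x \<in> B \<Longrightarrow> y \<in> B"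
  unfolding determined_def by blast

lemma points_separate:
  assumes "x \<in> points" "y \<in> points" "x \<noteq> y"
  obtains N where "\<And>M. N \<le> M \<Longrightarrow> cut M x \<noteq> cut M y"
proof (cases "fst x = fst y")
  case True
  then have "snd x \<noteq> snd y" using assms by (simp add: prod_eq_iff)
  then obtain j t where "j \<in> J" "snd x j t \<noteq> snd y j t"
    using assms(1,2) streams_eqI[of "snd x" "snd y"] by (force simp: points_def mem_Times_iff)
  then show ?thesis by (intro that[of "Suc t"]) (meson Suc_le_lessD cut_eq_iff)
qed (auto simp: cut_eq_iff intro: that)

lemma cut_long:
  assumes "\<And>j. j \<in> J \<Longrightarrow> N \<le> len q j"
  shows "cut N (q \<cdot> w) = cut N (q \<cdot> w')"
  using assms by (force simp: cut_eq_iff app_nth)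

lemma Pref_uniformly_continuous:
  assumes h: "h \<in> Pref"
  shows "\<exists>M0. \<forall>M\<ge>M0. \<forall>x\<in>points. \<forall>y\<in>points. cut M x = cut M y \<longrightarrow> cut N (h x) = cut N (h y)"
proof -
  obtain N0 where N0: "table h N0" using h by (auto simp: Pref_def)
  show ?thesis
  proof (intro exI[of _ "N0 + N"] allI impI ballI)
    fix M x y assume M: "N0 + N \<le> M" and xy: "x \<in> points" "y \<in> points" "cut M x = cut M y"
    have p: "cut M x \<in> arrows" using xy cut_arrows by blast
    obtain q r where q: "q \<in> arrows" "depth N0 q" "r \<in> words" "cut M x = q \<star> r"
      using arrows_split[OF p, of N0] M by (metis add_leD1 len_cut)
    obtain q' where q': "replaces h q q'" using N0 q by (auto simp: table_def)
    have rp: "replaces h (cut M x) (q' \<star> r)" using replaces_ext[OF q' q(3)] q by simp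
    have "length (r j) \<ge> N" if "j \<in> J" for j
      using arg_cong[OF q(4), of "\<lambda>p. len p j"] q(2) M that by (simp add: depth_def)
    then have "N \<le> len (q' \<star> r) j" if "j \<in> J" for j using that by (simp add: trans_le_add2)
    then have "cut N ((q' \<star> r) \<cdot> w) = cut N ((q' \<star> r) \<cdot> w')" for w w' by (rule cut_long)
    moreover have "h x = (q' \<star> r) \<cdot> rest M x" "h y = (q' \<star> r) \<cdot> rest M y"
      using replacesD[OF rp rest_streams[OF xy(1), of M]] replacesD[OF rp rest_streams[OF xy(2), of M]]
        cut_rest[OF xy(1), of M] cut_rest[OF xy(2), of M] xy(3) by simp_all
    ultimately show "cut N (h x) = cut N (h y)" by simp
  qed
qed

lemma determined_vimage:
  assumes "h \<in> Pref" "determined N B"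
  shows "\<exists>M. determined M {x \<in> points. h x \<in> B}"
proof -
  obtain M where "\<forall>x\<in>points. \<forall>y\<in>points. cut M x = cut M y \<longrightarrow> cut N (h x) = cut N (h y)"
    using Pref_uniformly_continuous[OF assms(1)] by (meson order_refl)
  then have "determined M {x \<in> points. h x \<in> B}"
    using assms(2) Pref_points[OF assms(1)] unfolding determined_def by blast
  then show ?thesis ..
qed

lemma determined_Un: "determined N B \<Longrightarrow> determined N C \<Longrightarrow> determined N (B \<union> C)" unfolding determined_def by blast

lemma cone_points: "p \<in> arrows \<Longrightarrow> cone p \<subseteq> points"
  by (auto simp: cone_def app_points)

lemma cone_ext: "p \<in> arrows \<Longrightarrow> r \<in> words \<Longrightarrow> cone (p \<star> r) \<subseteq> cone p"
  by (auto simp: cone_def ext_app wconc_streams)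

lemma in_cone_cut: "x \<in> points \<Longrightarrow> x \<in> cone (cut N x)"
  unfolding cone_def using cut_rest rest_streams by (metis image_eqI)

lemma cut_in_cone:
  assumes "p \<in> arrows" "\<And>j. j \<in> J \<Longrightarrow> len p j \<le> N" "x \<in> cone p"
  obtains r where "r \<in> words" "cut N x = p \<star> r"
proof -
  obtain w where w: "w \<in> streams" "x = p \<cdot> w" using assms(3) by (auto simp: cone_def)
  show ?thesis
    by (rule cut_extend[OF assms(1) w(1) assms(2)]) (use that w(2) in auto)
qed

lemma determined_cone:
  assumes "p \<in> arrows" "\<And>j. j \<in> J \<Longrightarrow> len p j \<le> N"
  shows "determined N (cone p)"
  unfolding determined_def
proof (intro conjI ballI impI cone_points[OF assms(1)])
  have *: "y \<in> cone p" if xy: "y \<in> points" "cut N x = cut N y" "x \<in> cone p" for x y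
  proof -
    obtain r where "r \<in> words" "cut N x = p \<star> r" using cut_in_cone[OF assms xy(3)] by blast
    then show ?thesis using cone_ext[OF assms(1)] in_cone_cut[OF xy(1), of N] xy(2) by auto
  qed
  fix x y assume "x \<in> points" "y \<in> points" "cut N x = cut N y"
  then show "x \<in> cone p \<longleftrightarrow> y \<in> cone p" using *[of x y] *[of y x] by auto
qed

lemma cone_depth: "p \<in> arrows \<Longrightarrow> depth N p \<Longrightarrow> x \<in> cone p \<longleftrightarrow> x \<in> points \<and> cut N x = p"
  using cut_app in_cone_cut app_points unfolding cone_def by blast

definition max_len where "max_len p = Max (len p ` J)"

lemma len_le_max_len: "j \<in> J \<Longrightarrow> len p j \<le> max_len p"
  unfolding max_len_def using finite_J by simp

lemma table_determined:
  assumes "determined N B"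
    and "\<And>p. p \<in> arrows \<Longrightarrow> depth N p \<Longrightarrow> cone p \<subseteq> B \<Longrightarrow> \<exists>q. replaces h p q"
    and "\<And>p. p \<in> arrows \<Longrightarrow> depth N p \<Longrightarrow> cone p \<inter> B = {} \<Longrightarrow> \<exists>q. replaces h p q"
  shows "table h N"
  unfolding table_def
proof (intro ballI impI)
  fix p assume p: "p \<in> arrows" "depth N p"
  then have *: "y \<in> B" if "x \<in> cone p" "y \<in> cone p" "x \<in> B" for x y
    using determinedD[OF assms(1), of x y] cone_depth[OF p] that by simp
  show "\<exists>q. replaces h p q"
  proof (cases "cone p \<inter> B = {}")
    case False
    then have "cone p \<subseteq> B" using * by blast
    then show ?thesis using assms(2) p by simp
  qed (use assms(3) p in simp)
qed

text \<open>The group is full: an element may be cut off outside of an invariant clopen set.\<close>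

lemma Pref_restrict:
  assumes h: "h \<in> Pref" and B: "determined N B" and inv: "\<And>x. x \<in> points \<Longrightarrow> h x \<in> B \<longleftrightarrow> x \<in> B"
  shows "(\<lambda>x\<in>points. if x \<in> B then h x else x) \<in> Pref"
proof -
  obtain M where M: "table h M" using h by (auto simp: Pref_def)
  let ?f = "\<lambda>x\<in>points. if x \<in> B then h x else x"
  have "table ?f (max M N)"
  proof (rule table_determined[OF determined_mono[OF B]])
    fix p assume p: "p \<in> arrows" "depth (max M N) p"
    { assume "cone p \<subseteq> B"
      then have "\<And>w. w \<in> streams \<Longrightarrow> p \<cdot> w \<in> B" by (auto simp: cone_def)
      moreover obtain q where "replaces h p q" using table_mono[OF M, of "max M N"] p by (auto simp: table_def)
      ultimately have "replaces ?f p q" using p by (auto simp: replaces_def app_points)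
      then show "\<exists>q. replaces ?f p q" .. }
    { assume "cone p \<inter> B = {}"
      then have "\<And>w. w \<in> streams \<Longrightarrow> p \<cdot> w \<notin> B" by (auto simp: cone_def)
      then have "replaces ?f p p" using p by (auto simp: replaces_def app_points)
      then show "\<exists>q. replaces ?f p q" .. }
  qed simp
  moreover have "?f \<in> Bij points"
    unfolding bij_betw_def Bij_def Int_iff mem_Collect_eq
  proof (intro conjI restrict_extensional)
    show "inj_on ?f points"
    proof (rule inj_onI)
      fix x y assume "x \<in> points" "y \<in> points" "?f x = ?f y"
      then show "x = y" using inv[of x] inv[of y] Pref_inj[OF h] by (auto split: if_splits)
    qed
    show "?f ` points = points"
    proof
      show "?f ` points \<subseteq> points" using Pref_points[OF h] by auto
      show "points \<subseteq> ?f ` points"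
      proof
        fix y assume y: "y \<in> points"
        show "y \<in> ?f ` points"
        proof (cases "y \<in> B")
          case True
          then obtain x where "x \<in> points" "h x = y" using Pref_surj[OF h y] by blast
          then show ?thesis using True inv[of x] by (intro image_eqI[of _ _ x]) auto
        qed (use y in \<open>intro image_eqI[of _ _ y], auto\<close>)
      qed
    qed
  qed
  ultimately show ?thesis unfolding Pref_def mem_Collect_eq by blast
qed

end

section \<open>Involutions with prescribed support\<close>

context word_space begin

lemma cone_iff:
  assumes "p \<in> arrows"
  shows "x \<in> cone p \<longleftrightarrow> x \<in> points \<and> fst x = fst p \<and> (\<forall>j\<in>J. \<forall>t<len p j. snd x j t = snd p j ! t)"
    (is "_ \<longleftrightarrow> ?R")
proof
  assume "x \<in> cone p"
  then show ?R using assms by (auto simp: cone_def app_points app_nth)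
next
  assume R: ?R
  define w where "w = (\<lambda>j\<in>J. suffix (len p j) (snd x j))"
  have w: "w \<in> streams" using R by (intro streamsI) (auto simp: w_def points_def dest: streamsD)
  have "snd (p \<cdot> w) = snd x"
  proof (rule streams_eqI)
    show "snd (p \<cdot> w) \<in> streams" "snd x \<in> streams"
      using R app_points[OF assms w] by (auto simp: points_def)
    fix j t assume "j \<in> J"
    then show "snd (p \<cdot> w) j t = snd x j t" using R by (simp add: app_nth) (simp add: w_def)
  qed
  then have "x = p \<cdot> w" using R by (simp add: prod_eq_iff)
  then show "x \<in> cone p" using w by (simp add: cone_def)
qed

text \<open>Any coordinate would do for the flips.\<close>

definition j0 where "j0 = (SOME j. j \<in> J)"

lemma j0: "j0 \<in> J" unfolding j0_def using J_nonempty by (auto intro: someI)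

definition flip_at where
  "flip_at n x = (fst x, (snd x)(j0 := (snd x j0)(n := flip (snd x j0 n))))"

lemma flip_at_points: "x \<in> points \<Longrightarrow> flip_at n x \<in> points"
  using j0 flip_closed[OF j0]
  by (auto simp: points_def flip_at_def streams_def PiE_iff extensional_def Pi_iff)

lemma flip_at_flip_at: "flip_at n (flip_at n x) = x"
  by (simp add: flip_at_def flip_flip prod_eq_iff)

lemma flip_at_neq: "flip_at n x \<noteq> x"
  by (simp add: flip_at_def prod_eq_iff fun_eq_iff flip_neq)

lemma flip_at_Pref: "(\<lambda>x\<in>points. flip_at n x) \<in> Pref"
proof (rule Pref_involutionI)
  show "table (\<lambda>x\<in>points. flip_at n x) (Suc n)"
    unfolding table_def
  proof (intro ballI impI)
    fix p assume p: "p \<in> arrows" "depth (Suc n) p"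
    define q where "q = (fst p, (snd p)(j0 := (snd p j0)[n := flip (snd p j0 ! n)]))"
    have n: "n < len p j0" using p j0 by (simp add: depth_def)
    have "set (snd p j0) \<subseteq> A j0" using p(1) j0 wordsD[of "snd p" j0] by (simp add: arrows_def mem_Times_iff)
    then have s: "snd p j0 ! n \<in> A j0" using nth_mem[OF n] by blast
    have "set ((snd p j0)[n := flip (snd p j0 ! n)]) \<subseteq> A j0"
      using p j0 wordsD[of "snd p" j0] flip_closed[OF j0 s] set_update_subset_insert[of "snd p j0"]
      by (fastforce simp: arrows_def)
    then have q: "q \<in> arrows" using p j0
      by (auto simp: q_def arrows_def words_def PiE_iff extensional_def lists_eq_set subset_iff)
    have "map lab (snd q j) = map lab (snd p j)" for j
      using n by (simp add: q_def map_update lab_flip) (metis length_map list_update_id nth_map)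
    then have t: "target q = target p" by (simp add: target_def labs_def) (simp add: q_def)
    have "flip_at n (p \<cdot> w) = q \<cdot> w" if w: "w \<in> streams" for w
    proof -
      have "snd (flip_at n (p \<cdot> w)) = snd (q \<cdot> w)"
      proof (rule streams_eqI)
        show "snd (flip_at n (p \<cdot> w)) \<in> streams" "snd (q \<cdot> w) \<in> streams"
          using flip_at_points[OF app_points[OF p(1) w]] app_points[OF q w] by (simp_all add: points_def mem_Times_iff)
        fix j t assume "j \<in> J"
        then show "snd (flip_at n (p \<cdot> w)) j t = snd (q \<cdot> w) j t"
          using n by (auto simp: flip_at_def app_nth q_def nth_list_update)
      qed
      then show ?thesis by (simp add: prod_eq_iff) (simp add: flip_at_def q_def)
    qed
    then have "replaces (\<lambda>x\<in>points. flip_at n x) p q"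
      using q t app_points[OF p(1)] by (simp add: replaces_def)
    then show "\<exists>q. replaces (\<lambda>x\<in>points. flip_at n x) p q" ..
  qed
qed (auto simp: flip_at_points flip_at_flip_at)

text \<open>The support of \<open>twist p\<close> is exactly the cone of \<open>p\<close>; this makes cones visible to the group.\<close>

definition twist where
  "twist p = (\<lambda>x\<in>points. if x \<in> cone p then flip_at (len p j0) x else x)"

lemma flip_at_cone: "p \<in> arrows \<Longrightarrow> x \<in> points \<Longrightarrow> flip_at (len p j0) x \<in> cone p \<longleftrightarrow> x \<in> cone p"
  using flip_at_points[of x] by (auto simp: cone_iff flip_at_def)

lemma twist_Pref: assumes "p \<in> arrows" shows "twist p \<in> Pref"
proof -
  have "(\<lambda>x\<in>points. if x \<in> cone p then (\<lambda>x\<in>points. flip_at (len p j0) x) x else x) \<in> Pref"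
    by (rule Pref_restrict[OF flip_at_Pref determined_cone[OF assms len_le_max_len]])
      (use flip_at_cone[OF assms] in auto)
  also have "(\<lambda>x\<in>points. if x \<in> cone p then (\<lambda>x\<in>points. flip_at (len p j0) x) x else x) = twist p"
    by (auto simp: twist_def)
  finally show ?thesis .
qed

lemma twist_twist: "p \<in> arrows \<Longrightarrow> x \<in> points \<Longrightarrow> twist p (twist p x) = x"
  by (simp add: twist_def flip_at_points flip_at_cone flip_at_flip_at)

lemma twist_moves: "p \<in> arrows \<Longrightarrow> x \<in> points \<Longrightarrow> twist p x \<noteq> x \<longleftrightarrow> x \<in> cone p"
  by (simp add: twist_def flip_at_neq)

definition strip where
  "strip p x = (THE w. w \<in> streams \<and> p \<cdot> w = x)"

lemma strip_app: "p \<in> arrows \<Longrightarrow> w \<in> streams \<Longrightarrow> strip p (p \<cdot> w) = w"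
  unfolding strip_def by (rule the_equality) (auto dest: app_inj)

definition swap where
  "swap p q = (\<lambda>x\<in>points. if x \<in> cone p then q \<cdot> strip p x
     else if x \<in> cone q then p \<cdot> strip q x else x)"

lemma swap_apply:
  assumes "p \<in> arrows" "q \<in> arrows" "cone p \<inter> cone q = {}"
  shows "w \<in> streams \<Longrightarrow> swap p q (p \<cdot> w) = q \<cdot> w"
    and "w \<in> streams \<Longrightarrow> swap p q (q \<cdot> w) = p \<cdot> w"
    and "x \<in> points \<Longrightarrow> x \<notin> cone p \<Longrightarrow> x \<notin> cone q \<Longrightarrow> swap p q x = x"
proof -
  show "swap p q (p \<cdot> w) = q \<cdot> w" if "w \<in> streams"
    using assms that by (auto simp: swap_def app_points strip_app cone_def)
  have "q \<cdot> w \<in> cone q" if "w \<in> streams" using that by (simp add: cone_def)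
  then show "swap p q (q \<cdot> w) = p \<cdot> w" if "w \<in> streams"
    using assms that by (auto simp: swap_def app_points strip_app)
qed (simp add: swap_def)

lemma swap_Pref:
  assumes p: "p \<in> arrows" and q: "q \<in> arrows" and disj: "cone p \<inter> cone q = {}"
    and t: "target p = target q"
  shows "swap p q \<in> Pref"
proof (rule Pref_involutionI)
  note sw = swap_apply[OF p q disj]
  fix x assume x: "x \<in> points"
  consider (p) w where "w \<in> streams" "x = p \<cdot> w" | (q) w where "w \<in> streams" "x = q \<cdot> w"
    | (n) "x \<notin> cone p" "x \<notin> cone q" by (auto simp: cone_def)
  then show "swap p q x \<in> points" "swap p q (swap p q x) = x"
    by (cases; use p q x in \<open>simp add: sw app_points\<close>)+
next
  note sw = swap_apply[OF p q disj]
  show "swap p q \<in> extensional points" by (simp add: swap_def)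
  define N where "N = max (max_len p) (max_len q)"
  have len: "len p j \<le> N" "len q j \<le> N" if "j \<in> J" for j
    using len_le_max_len[OF that, of p] len_le_max_len[OF that, of q] by (auto simp: N_def)
  have *: "\<exists>c'. replaces (swap p q) c c'" if c: "c \<in> arrows" "depth N c" "x \<in> cone c" "x \<in> cone a"
    and ab: "a \<in> arrows" "b \<in> arrows" "\<And>j. j \<in> J \<Longrightarrow> len a j \<le> N"
      "\<And>w. w \<in> streams \<Longrightarrow> swap p q (a \<cdot> w) = b \<cdot> w" "target b = target a" for c x a b
  proof -
    obtain r where r: "r \<in> words" "cut N x = a \<star> r" using cut_in_cone[OF ab(1,3) c(4)] by blast
    then have "c = a \<star> r" using cone_depth[OF c(1,2)] c(3) by auto
    moreover have "replaces (swap p q) a b" using ab by (simp add: replaces_def)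
    ultimately have "replaces (swap p q) c (b \<star> r)" using replaces_ext r by blast
    then show ?thesis ..
  qed
  show "table (swap p q) N"
  proof (rule table_determined[OF determined_Un[OF determined_cone[OF p len(1)] determined_cone[OF q len(2)]]])
    fix c assume c: "c \<in> arrows" "depth N c"
    obtain w0 where w0: "w0 \<in> streams" by (rule streams_nonempty)
    then have x0: "c \<cdot> w0 \<in> cone c" by (simp add: cone_def)
    { assume "cone c \<subseteq> cone p \<union> cone q"
      then consider "c \<cdot> w0 \<in> cone p" | "c \<cdot> w0 \<in> cone q" using x0 by blast
      then show "\<exists>c'. replaces (swap p q) c c'"
        by (cases; use *[OF c x0 _ p q len(1) sw(1)] *[OF c x0 _ q p len(2) sw(2)] t in auto) }
    { assume "cone c \<inter> (cone p \<union> cone q) = {}"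
      moreover have "c \<cdot> w \<in> cone c" if "w \<in> streams" for w using that by (simp add: cone_def)
      ultimately have "c \<cdot> w \<notin> cone p" "c \<cdot> w \<notin> cone q" if "w \<in> streams" for w
        using that by blast+
      then have "replaces (swap p q) c c" using c app_points[OF c(1)] sw(3) by (simp add: replaces_def)
      then show "\<exists>c'. replaces (swap p q) c c'" .. }
  qed
qed

text \<open>Passing through a third cone allows \<open>p\<close> and \<open>p'\<close> to overlap, in particular to be nested, which a single
  swap does not.\<close>

lemma Pref_shift:
  assumes "p \<in> arrows" "p' \<in> arrows" "q \<in> arrows"
    and "target p = target q" "target p' = target q"
    and "cone p \<inter> cone q = {}" "cone p' \<inter> cone q = {}"
  obtains h where "h \<in> Pref" "\<And>w. w \<in> streams \<Longrightarrow> h (p \<cdot> w) = p' \<cdot> w"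
proof
  show "swap p' q \<otimes>\<^bsub>G\<^esub> swap p q \<in> Pref"
    using swap_Pref assms by (intro G_mult_closed) auto
  show "(swap p' q \<otimes>\<^bsub>G\<^esub> swap p q) (p \<cdot> w) = p' \<cdot> w" if "w \<in> streams" for w
    using assms that by (subst G_mult_apply) (auto simp: swap_Pref swap_apply app_points)
qed

text \<open>Let a table of depth \<open>N\<close> replace a prefix by one of length \<open>b \<noteq> N\<close> in some coordinate. Near a fixed point
  \<open>h\<close> can be applied twice, and the letter at a late place \<open>t\<close> is then taken from the place \<open>t + 2 * (N - b)\<close>. As
  \<open>h\<close> is an involution these letters agree at all nearby points, yet one of them can be changed alone.
  So a cone that contains a fixed point is fixed pointwise.\<close>

lemma determined_involution:
  assumes h: "h \<in> Pref" and inv: "\<And>x. x \<in> points \<Longrightarrow> h (h x) = x"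
  shows "\<exists>N. determined N {x \<in> points. h x \<noteq> x}"
proof -
  obtain N where N: "table h N" using h by (auto simp: Pref_def)
  have *: "h y = y" if xy: "x \<in> points" "y \<in> points" "cut N x = cut N y" and fix_x: "h x = x" for x y
  proof -
    define p where "p = cut N x"
    have p: "p \<in> arrows" "depth N p" using cut_arrows[OF xy(1)] by (auto simp: p_def)
    then obtain q where q: "replaces h p q" using N by (auto simp: table_def)
    then have qa: "q \<in> arrows" by (simp add: replaces_def)
    have hz: "h z = q \<cdot> rest N z" if "z \<in> points" "cut N z = p" for z
      using replacesD[OF q rest_streams[OF that(1)]] cut_rest[OF that(1)] that(2) by metis
    have nth: "snd (h z) j t = (if t < len q j then snd q j ! t else snd z j (N + (t - len q j)))"
      if "z \<in> points" "cut N z = p" "j \<in> J" for z j t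
      using that by (simp add: hz app_nth) (simp add: rest_def)
    have "len q j = N" if j: "j \<in> J" for j
    proof (rule ccontr)
      assume ne: "len q j \<noteq> N"
      define b where "b = len q j"
      define t where "t = 2 * N + 2 * b"
      \<comment> \<open>so late that the first \<open>N\<close> letters of \<open>z\<close> and of \<open>h z\<close> are those of \<open>x\<close>\<close>
      define z where "z = (fst x, (snd x)(j := (snd x j)(t := flip (snd x j t))))"
      have z: "z \<in> points" using xy(1) j flip_closed[OF j]
        by (auto simp: z_def points_def streams_def PiE_iff extensional_def Pi_iff)
      have cz: "cut N z = p" by (auto simp: z_def p_def cut_eq_iff t_def)
      have "cut N (h z) = cut N (h x)"
        unfolding cut_eq_iff
      proof (intro conjI ballI allI impI)
        show "fst (h z) = fst (h x)" using hz[OF z cz] hz[OF xy(1)] by (simp add: p_def)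
        fix i s assume "i \<in> J" "s < N"
        then show "snd (h z) i s = snd (h x) i s"
          using nth[OF z cz, of i s] nth[OF xy(1) p_def[symmetric], of i s]
          by (auto simp: z_def t_def)
      qed
      then have c2: "cut N (h z) = p" using fix_x by (simp add: p_def)
      have hzp: "h z \<in> points" using Pref_points[OF h z] .
      have 1: "snd z j t = snd z j (N + (N + (t - b) - b))"
        using nth[OF hzp c2 j, of t] nth[OF z cz j, of "N + (t - b)"] inv[OF z]
        by (simp add: b_def[symmetric] t_def)
      have 2: "snd x j t = snd x j (N + (N + (t - b) - b))"
        using nth[OF xy(1) p_def[symmetric] j, of t] nth[OF xy(1) p_def[symmetric] j, of "N + (t - b)"] fix_x
        by (simp add: b_def[symmetric] t_def)
      have "N + (N + (t - b) - b) \<noteq> t" using ne by (auto simp: t_def b_def[symmetric])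
      then show False using 1 2 flip_neq[of "snd x j t"] by (simp add: z_def)
    qed
    then have "p = q"
      using app_eq_depth(1)[OF p(1) qa rest_streams[OF xy(1)] rest_streams[OF xy(1)], of N N]
        hz[OF xy(1) p_def[symmetric]] fix_x cut_rest[OF xy(1), of N] p(2)
      by (simp add: p_def depth_def)
    then show ?thesis using hz[OF xy(2)] cut_rest[OF xy(2), of N] xy(3) by (simp add: p_def)
  qed
  have "determined N {x \<in> points. h x \<noteq> x}"
    unfolding determined_def
  proof (intro conjI ballI impI)
    fix x y assume "x \<in> points" "y \<in> points" "cut N x = cut N y"
    then show "x \<in> {x \<in> points. h x \<noteq> x} \<longleftrightarrow> y \<in> {x \<in> points. h x \<noteq> x}"
      using *[of x y] *[of y x] by auto
  qed auto
  then show ?thesis ..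
qed

end

section \<open>Supports from the group structure\<close>

definition centralizer :: "('g, 'z) monoid_scheme \<Rightarrow> 'g set \<Rightarrow> 'g set" where
  "centralizer G T = {\<phi> \<in> carrier G. \<forall>\<psi>\<in>T. \<phi> \<otimes>\<^bsub>G\<^esub> \<psi> = \<psi> \<otimes>\<^bsub>G\<^esub> \<phi>}"

text \<open>In a group of bijections with sufficiently many involutions, the twins of an involution \<open>\<pi>\<close> are the
  involutions commuting with \<open>\<pi>\<close> which agree at each point with \<open>\<pi>\<close> or with the identity.\<close>

definition twins :: "('g, 'z) monoid_scheme \<Rightarrow> 'g \<Rightarrow> 'g set" where
  "twins G \<pi> = {\<phi> \<in> centralizer G {\<pi>}. \<phi> \<otimes>\<^bsub>G\<^esub> \<phi> = \<one>\<^bsub>G\<^esub> \<and>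
     (\<forall>\<psi>\<in>centralizer G {\<pi>}. \<phi> \<otimes>\<^bsub>G\<^esub> (\<psi> \<otimes>\<^bsub>G\<^esub> \<phi> \<otimes>\<^bsub>G\<^esub> inv\<^bsub>G\<^esub> \<psi>) = (\<psi> \<otimes>\<^bsub>G\<^esub> \<phi> \<otimes>\<^bsub>G\<^esub> inv\<^bsub>G\<^esub> \<psi>) \<otimes>\<^bsub>G\<^esub> \<phi>)}"

text \<open>An element that commutes with all the twins moves each point of the support of \<open>\<pi>\<close> at most to its partner, so its
  square is supported off that of \<open>\<pi>\<close>. Commuting with these squares means being
  supported where \<open>\<pi>\<close> is.\<close>

definition supported :: "('g, 'z) monoid_scheme \<Rightarrow> 'g \<Rightarrow> 'g set" where
  "supported G \<pi> = centralizer G ((\<lambda>\<phi>. \<phi> \<otimes>\<^bsub>G\<^esub> \<phi>) ` centralizer G (twins G \<pi>))"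

lemma centralizer_carrier: "centralizer G T \<subseteq> carrier G"
  by (auto simp: centralizer_def)

lemma twins_carrier: "twins G \<pi> \<subseteq> carrier G"
  by (auto simp: centralizer_def twins_def)

lemma iso_centralizer:
  assumes G: "group G" and f: "f \<in> iso G H" and T: "T \<subseteq> carrier G"
  shows "f ` centralizer G T = centralizer H (f ` T)"
proof -
  interpret G: group G by fact
  have hom: "f (x \<otimes>\<^bsub>G\<^esub> y) = f x \<otimes>\<^bsub>H\<^esub> f y" if "x \<in> carrier G" "y \<in> carrier G" for x y
    using f that by (auto simp: iso_def hom_def)
  have inj: "inj_on f (carrier G)" and surj: "f ` carrier G = carrier H"
    using f by (auto simp: iso_def bij_betw_def)
  have "x \<otimes>\<^bsub>G\<^esub> y = y \<otimes>\<^bsub>G\<^esub> x \<longleftrightarrow> f x \<otimes>\<^bsub>H\<^esub> f y = f y \<otimes>\<^bsub>H\<^esub> f x"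
    if "x \<in> carrier G" "y \<in> carrier G" for x y
    using that inj_onD[OF inj, of "x \<otimes>\<^bsub>G\<^esub> y" "y \<otimes>\<^bsub>G\<^esub> x"] by (auto simp: hom[symmetric])
  then have *: "x \<in> centralizer G T \<longleftrightarrow> f x \<in> centralizer H (f ` T)" if "x \<in> carrier G" for x
    using that T surj unfolding centralizer_def by (auto simp: subset_iff)
  show ?thesis
  proof
    show "f ` centralizer G T \<subseteq> centralizer H (f ` T)"
      using * centralizer_carrier[of G T] by blast
    show "centralizer H (f ` T) \<subseteq> f ` centralizer G T"
    proof
      fix y assume y: "y \<in> centralizer H (f ` T)"
      then have "y \<in> carrier H" by (simp add: centralizer_def)
      then obtain x where "x \<in> carrier G" "y = f x" using surj by blast
      then show "y \<in> f ` centralizer G T" using * y by blast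
    qed
  qed
qed

lemma iso_twins:
  assumes G: "group G" and H: "group H" and f: "f \<in> iso G H" and \<pi>: "\<pi> \<in> carrier G"
  shows "f ` twins G \<pi> = twins H (f \<pi>)"
proof -
  interpret G: group G by fact
  interpret H: group H by fact
  interpret f: group_hom G H f using f by unfold_locales (auto simp: iso_def)
  have inj: "inj_on f (carrier G)" using f by (auto simp: iso_def bij_betw_def)
  have cent: "centralizer H {f \<pi>} = f ` centralizer G {\<pi>}"
    using iso_centralizer[OF G f, of "{\<pi>}"] \<pi> by simp
  have eq: "f x = f y \<longleftrightarrow> x = y" if "x \<in> carrier G" "y \<in> carrier G" for x y
    using inj that by (auto dest: inj_onD)
  have one: "f x = \<one>\<^bsub>H\<^esub> \<longleftrightarrow> x = \<one>\<^bsub>G\<^esub>" if "x \<in> carrier G" for x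
    using eq[OF that G.one_closed] by simp
  have conj: "f \<phi> \<otimes>\<^bsub>H\<^esub> (f \<psi> \<otimes>\<^bsub>H\<^esub> f \<phi> \<otimes>\<^bsub>H\<^esub> inv\<^bsub>H\<^esub> f \<psi>) = (f \<psi> \<otimes>\<^bsub>H\<^esub> f \<phi> \<otimes>\<^bsub>H\<^esub> inv\<^bsub>H\<^esub> f \<psi>) \<otimes>\<^bsub>H\<^esub> f \<phi> \<longleftrightarrow>
      \<phi> \<otimes>\<^bsub>G\<^esub> (\<psi> \<otimes>\<^bsub>G\<^esub> \<phi> \<otimes>\<^bsub>G\<^esub> inv\<^bsub>G\<^esub> \<psi>) = (\<psi> \<otimes>\<^bsub>G\<^esub> \<phi> \<otimes>\<^bsub>G\<^esub> inv\<^bsub>G\<^esub> \<psi>) \<otimes>\<^bsub>G\<^esub> \<phi>"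
    if "\<phi> \<in> carrier G" "\<psi> \<in> carrier G" for \<phi> \<psi>
    using eq[of "\<phi> \<otimes>\<^bsub>G\<^esub> (\<psi> \<otimes>\<^bsub>G\<^esub> \<phi> \<otimes>\<^bsub>G\<^esub> inv\<^bsub>G\<^esub> \<psi>)" "(\<psi> \<otimes>\<^bsub>G\<^esub> \<phi> \<otimes>\<^bsub>G\<^esub> inv\<^bsub>G\<^esub> \<psi>) \<otimes>\<^bsub>G\<^esub> \<phi>"] that by simp
  have "f \<phi> \<in> twins H (f \<pi>) \<longleftrightarrow> \<phi> \<in> twins G \<pi>" if "\<phi> \<in> centralizer G {\<pi>}" for \<phi>
  proof -
    have sub: "\<psi> \<in> carrier G" if "\<psi> \<in> centralizer G {\<pi>}" for \<psi> using that by (simp add: centralizer_def)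
    have "f \<phi> \<otimes>\<^bsub>H\<^esub> f \<phi> = \<one>\<^bsub>H\<^esub> \<longleftrightarrow> \<phi> \<otimes>\<^bsub>G\<^esub> \<phi> = \<one>\<^bsub>G\<^esub>"
      using one[of "\<phi> \<otimes>\<^bsub>G\<^esub> \<phi>"] sub[OF that] by simp
    moreover have "f \<phi> \<in> f ` centralizer G {\<pi>}" using that by blast
    ultimately show ?thesis
      using that sub[OF that] by (simp add: twins_def cent ball_simps conj sub cong: ball_cong)
  qed
  note mem = this
  show ?thesis
  proof
    show "f ` twins G \<pi> \<subseteq> twins H (f \<pi>)"
    proof (rule image_subsetI)
      fix \<phi> assume "\<phi> \<in> twins G \<pi>"
      moreover from this have "\<phi> \<in> centralizer G {\<pi>}" by (simp add: twins_def)
      ultimately show "f \<phi> \<in> twins H (f \<pi>)" using mem by blast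
    qed
    show "twins H (f \<pi>) \<subseteq> f ` twins G \<pi>"
    proof
      fix y assume y: "y \<in> twins H (f \<pi>)"
      then have "y \<in> f ` centralizer G {\<pi>}" using cent by (simp add: twins_def)
      then obtain \<phi> where "\<phi> \<in> centralizer G {\<pi>}" "y = f \<phi>" by blast
      then show "y \<in> f ` twins G \<pi>" using mem y by blast
    qed
  qed
qed

lemma iso_supported:
  assumes G: "group G" and H: "group H" and f: "f \<in> iso G H"
    and \<pi>: "\<pi> \<in> carrier G" and \<phi>: "\<phi> \<in> carrier G"
  shows "f \<phi> \<in> supported H (f \<pi>) \<longleftrightarrow> \<phi> \<in> supported G \<pi>"
proof -
  interpret G: group G by fact
  have hom: "f (x \<otimes>\<^bsub>G\<^esub> y) = f x \<otimes>\<^bsub>H\<^esub> f y" if "x \<in> carrier G" "y \<in> carrier G" for x y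
    using f that by (auto simp: iso_def hom_def)
  let ?S = "(\<lambda>\<phi>. \<phi> \<otimes>\<^bsub>G\<^esub> \<phi>) ` centralizer G (twins G \<pi>)"
  have sub: "?S \<subseteq> carrier G" using centralizer_carrier[of G "twins G \<pi>"] by auto
  have "f ` ?S = (\<lambda>\<phi>. \<phi> \<otimes>\<^bsub>H\<^esub> \<phi>) ` f ` centralizer G (twins G \<pi>)"
    unfolding image_image
    by (rule image_cong) (auto simp: hom subsetD[OF centralizer_carrier])
  also have "f ` centralizer G (twins G \<pi>) = centralizer H (twins H (f \<pi>))"
    using iso_centralizer[OF G f twins_carrier] iso_twins[OF G H f \<pi>] by simp
  finally have "supported H (f \<pi>) = f ` supported G \<pi>"
    unfolding supported_def using iso_centralizer[OF G f sub] by simp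
  moreover have "inj_on f (carrier G)" using f by (auto simp: iso_def bij_betw_def)
  moreover have "supported G \<pi> \<subseteq> carrier G" unfolding supported_def by (rule centralizer_carrier)
  ultimately show ?thesis using inj_on_image_mem_iff[of f "carrier G" \<phi> "supported G \<pi>"] \<phi> by simp
qed

context word_space begin

definition nearby where
  "nearby M x z \<longleftrightarrow> z \<in> points \<and> cut M z = cut M x"

lemma Pref_one: "(\<lambda>x\<in>points. x) \<in> Pref"
  using monoid.one_closed[OF group.is_monoid[OF group_G]] by (simp add: G_one)

text \<open>Continuity, in the form in which it lets one choose a cone with prescribed disjoint images.\<close>

lemma nearby_separate:
  assumes h: "h \<in> Pref" and g: "g \<in> Pref" and x: "x \<in> points" and ne: "h x \<noteq> g x"
  obtains N where "\<And>M z z'. N \<le> M \<Longrightarrow> nearby M x z \<Longrightarrow> nearby M x z' \<Longrightarrow> h z \<noteq> g z'"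
proof -
  obtain N where N: "\<And>M. N \<le> M \<Longrightarrow> cut M (h x) \<noteq> cut M (g x)"
    using points_separate[OF Pref_points[OF h x] Pref_points[OF g x] ne] by blast
  obtain A where A: "\<And>M y z. A \<le> M \<Longrightarrow> y \<in> points \<Longrightarrow> z \<in> points \<Longrightarrow> cut M y = cut M z \<Longrightarrow> cut N (h y) = cut N (h z)"
    using Pref_uniformly_continuous[OF h, of N] by auto
  obtain B where B: "\<And>M y z. B \<le> M \<Longrightarrow> y \<in> points \<Longrightarrow> z \<in> points \<Longrightarrow> cut M y = cut M z \<Longrightarrow> cut N (g y) = cut N (g z)"
    using Pref_uniformly_continuous[OF g, of N] by auto
  have "h z \<noteq> g z'" if "max A B \<le> M" "nearby M x z" "nearby M x z'" for M z z'
  proof -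
    have "cut N (h z) = cut N (h x)" "cut N (g z') = cut N (g x)"
      using A[of M z x] B[of M z' x] that x by (auto simp: nearby_def)
    then show ?thesis using N[of N] by auto
  qed
  then show ?thesis by (rule that)
qed

lemma nearby_moved:
  assumes h: "h \<in> Pref" and x: "x \<in> points" and ne: "h x \<noteq> x"
  obtains N where "\<And>M z z'. N \<le> M \<Longrightarrow> nearby M x z \<Longrightarrow> nearby M x z' \<Longrightarrow> h z \<noteq> z'"
proof -
  obtain N where N: "\<And>M z z'. N \<le> M \<Longrightarrow> nearby M x z \<Longrightarrow> nearby M x z' \<Longrightarrow> h z \<noteq> (\<lambda>x\<in>points. x) z'"
    using nearby_separate[OF h Pref_one x] ne x by auto
  show ?thesis by (rule that[of N]) (use N in \<open>auto simp: nearby_def\<close>)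
qed

lemma nearby_cone: "x \<in> points \<Longrightarrow> nearby M x z \<longleftrightarrow> z \<in> cone (cut M x)"
  using cone_depth[OF cut_arrows depth_cut] by (auto simp: nearby_def)

lemma nearby_refl: "x \<in> points \<Longrightarrow> nearby M x x" by (simp add: nearby_def)

text \<open>Conjugation arguments in a small cone must distinguish \<open>\<psi>\<close> from its inverse, so involutions do not
  suffice. Two involutions with nested supports have a product with non-trivial square.\<close>

lemma element_of_higher_order:
  assumes "p \<in> arrows"
  obtains \<psi> y where "\<psi> \<in> Pref" "\<And>z. z \<in> points \<Longrightarrow> z \<notin> cone p \<Longrightarrow> \<psi> z = z"
    "y \<in> cone p" "\<psi> (\<psi> y) \<noteq> y"
proof -
  obtain a where a: "a \<in> A j0" using A_nonempty[OF j0] by blast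
  define r where "r = (\<lambda>j\<in>J. if j = j0 then [a] else [])"
  have r: "r \<in> words" using a by (auto simp: r_def words_def)
  define p' where "p' = p \<star> r"
  have p': "p' \<in> arrows" unfolding p'_def using ext_arrows assms r by blast
  have sub: "cone p' \<subseteq> cone p" unfolding p'_def using cone_ext assms r by blast
  obtain w where w: "w \<in> streams" by (rule streams_nonempty)
  define y where "y = p' \<cdot> w"
  have y: "y \<in> cone p'" "y \<in> points" using w app_points[OF p' w] by (auto simp: y_def cone_def)
  let ?\<psi> = "twist p \<otimes>\<^bsub>G\<^esub> twist p'"
  have \<psi>: "?\<psi> \<in> Pref" using G_mult_closed twist_Pref assms p' by blast
  have ap: "?\<psi> z = twist p (twist p' z)" if "z \<in> points" for z
    using G_mult_apply twist_Pref assms p' that by blast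
  define y' where "y' = twist p' y"
  have y': "y' \<in> points" "y' \<in> cone p'" "y' \<noteq> y"
    using y flip_at_points[OF y(2)] flip_at_cone[OF p' y(2)]
    by (auto simp: y'_def twist_def flip_at_neq)
  define z where "z = twist p y'"
  have z_eq: "z = flip_at (len p j0) y'" using y' sub by (auto simp: z_def twist_def)
  have z: "z \<in> points" "z \<notin> cone p'"
  proof -
    have "len p j0 < len p' j0" "snd p' j0 ! len p j0 = a" using j0 by (simp_all add: p'_def ext_def r_def)
    moreover from this have "snd y' j0 (len p j0) = a"
      using y'(2) j0 by (simp add: cone_iff[OF p'])
    moreover have "snd z j0 (len p j0) = flip (snd y' j0 (len p j0))"
      using z_eq by (simp add: flip_at_def)
    ultimately show "z \<notin> cone p'" using j0 flip_neq[of a] cone_iff[OF p', of z] by metis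
    show "z \<in> points" using z_eq flip_at_points[OF y'(1)] by simp
  qed
  have "?\<psi> y = z" using y by (simp add: ap y'_def z_def)
  moreover have "?\<psi> z = y'" using z twist_moves[OF p' z(1)] twist_twist[OF assms y'(1)]
    by (simp add: ap) (simp add: z_def)
  ultimately have "?\<psi> (?\<psi> y) \<noteq> y" using y' by simp
  moreover have "?\<psi> z = z" if "z \<in> points" "z \<notin> cone p" for z
  proof -
    have "twist p z = z" "twist p' z = z" using that sub by (auto simp: twist_def)
    then show ?thesis using ap[OF that(1)] by simp
  qed
  ultimately show ?thesis using that \<psi> y sub by blast
qed

lemma commute_iff:
  assumes "h \<in> Pref" "g \<in> Pref"
  shows "h \<otimes>\<^bsub>G\<^esub> g = g \<otimes>\<^bsub>G\<^esub> h \<longleftrightarrow> (\<forall>x\<in>points. h (g x) = g (h x))"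
  using G_mult_apply[OF assms] G_mult_apply[OF assms(2,1)] Pref_eqI[OF G_mult_closed[OF assms] G_mult_closed[OF assms(2,1)]]
  by metis

definition involution where
  "involution \<pi> \<longleftrightarrow> \<pi> \<in> Pref \<and> \<pi> \<otimes>\<^bsub>G\<^esub> \<pi> = \<one>\<^bsub>G\<^esub>"

lemma involutionD:
  assumes "involution \<pi>"
  shows "\<pi> \<in> Pref" "x \<in> points \<Longrightarrow> \<pi> (\<pi> x) = x" "x \<in> points \<Longrightarrow> \<pi> x \<in> points"
  using assms G_mult_apply[of \<pi> \<pi> x] Pref_points by (auto simp: involution_def G_one)

lemma involutionI:
  assumes "\<pi> \<in> Pref" "\<And>x. x \<in> points \<Longrightarrow> \<pi> (\<pi> x) = x"
  shows "involution \<pi>"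
  using assms Pref_eqI[OF G_mult_closed[OF assms(1,1)] Pref_one]
  by (simp add: involution_def G_one G_mult_apply)

lemma involution_twist: "p \<in> arrows \<Longrightarrow> involution (twist p)"
  by (simp add: involutionI twist_Pref twist_twist)

text \<open>Involutions have open fixed point sets; general elements do not.\<close>

lemma fixed_nearby:
  assumes "involution \<pi>" "x \<in> points" "\<pi> x = x"
  obtains N where "\<And>M z. N \<le> M \<Longrightarrow> nearby M x z \<Longrightarrow> \<pi> z = z"
proof -
  obtain N where N: "determined N {x \<in> points. \<pi> x \<noteq> x}"
    using determined_involution involutionD[OF assms(1)] by blast
  have "\<pi> z = z" if "N \<le> M" "nearby M x z" for M z
    using determinedD[OF determined_mono[OF N that(1)], of z x] that(2) assms by (auto simp: nearby_def)
  then show ?thesis by (rule that)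
qed

lemma twins_iff:
  assumes "involution \<pi>"
  shows "\<phi> \<in> twins G \<pi> \<longleftrightarrow> involution \<phi> \<and> (\<forall>x\<in>points. \<phi> (\<pi> x) = \<pi> (\<phi> x)) \<and>
    (\<forall>\<psi>\<in>Pref. (\<forall>x\<in>points. \<psi> (\<pi> x) = \<pi> (\<psi> x)) \<longrightarrow>
      (\<forall>x\<in>points. \<phi> (\<psi> (\<phi> ((inv\<^bsub>G\<^esub> \<psi>) x))) = \<psi> (\<phi> ((inv\<^bsub>G\<^esub> \<psi>) (\<phi> x)))))"
proof (cases "\<phi> \<in> Pref")
  case True
  have pi: "\<pi> \<in> Pref" using involutionD[OF assms] by simp
  have cent: "\<psi> \<in> centralizer G {\<pi>} \<longleftrightarrow> \<psi> \<in> Pref \<and> (\<forall>x\<in>points. \<psi> (\<pi> x) = \<pi> (\<psi> x))" for \<psi>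
    using commute_iff[OF _ pi, of \<psi>] by (auto simp: centralizer_def)
  have conj: "\<phi> \<otimes>\<^bsub>G\<^esub> (\<psi> \<otimes>\<^bsub>G\<^esub> \<phi> \<otimes>\<^bsub>G\<^esub> inv\<^bsub>G\<^esub> \<psi>) = (\<psi> \<otimes>\<^bsub>G\<^esub> \<phi> \<otimes>\<^bsub>G\<^esub> inv\<^bsub>G\<^esub> \<psi>) \<otimes>\<^bsub>G\<^esub> \<phi> \<longleftrightarrow>
      (\<forall>x\<in>points. \<phi> (\<psi> (\<phi> ((inv\<^bsub>G\<^esub> \<psi>) x))) = \<psi> (\<phi> ((inv\<^bsub>G\<^esub> \<psi>) (\<phi> x))))" if "\<psi> \<in> Pref" for \<psi>
    using that True
    by (simp add: commute_iff G_mult_closed G_inv_closed G_mult_apply Pref_points)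
  show ?thesis
    by (simp add: twins_def involution_def Ball_def cent conj True) blast
qed (auto simp: twins_def centralizer_def involution_def)

text \<open>If \<open>\<phi> x\<close> is neither \<open>x\<close> nor \<open>\<pi> x\<close>, then \<open>\<phi>\<close> moves a small cone \<open>a\<close> at \<open>x\<close> off \<open>a\<close> and \<open>\<pi> a\<close>. An element \<open>\<psi>\<close> with
  support in \<open>a\<close> and \<open>\<pi> a\<close> that commutes with \<open>\<pi>\<close> is carried by \<open>\<phi>\<close> to one with disjoint support, and
  evaluating the commutation of \<open>\<phi>\<close> with its conjugate by \<open>\<psi>\<close> on \<open>a\<close> yields \<open>\<psi> (\<psi> y) = y\<close>.\<close>

lemma twins_values:
  assumes \<pi>: "involution \<pi>" and \<phi>: "\<phi> \<in> twins G \<pi>" and x: "x \<in> points"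
  shows "\<phi> x = x \<or> \<phi> x = \<pi> x"
proof (rule ccontr)
  assume "\<not> ?thesis"
  then have ne: "\<phi> x \<noteq> x" "\<phi> x \<noteq> \<pi> x" by auto
  note p = involutionD[OF \<pi>]
  have f: "involution \<phi>" "\<And>x. x \<in> points \<Longrightarrow> \<phi> (\<pi> x) = \<pi> (\<phi> x)"
    and conj: "\<And>\<psi> x. \<psi> \<in> Pref \<Longrightarrow> (\<And>x. x \<in> points \<Longrightarrow> \<psi> (\<pi> x) = \<pi> (\<psi> x)) \<Longrightarrow> x \<in> points \<Longrightarrow>
      \<phi> (\<psi> (\<phi> ((inv\<^bsub>G\<^esub> \<psi>) x))) = \<psi> (\<phi> ((inv\<^bsub>G\<^esub> \<psi>) (\<phi> x)))"
    using \<phi> twins_iff[OF \<pi>, of \<phi>] by auto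
  note fD = involutionD[OF f(1)]
  obtain N1 where N1: "\<And>M z z'. N1 \<le> M \<Longrightarrow> nearby M x z \<Longrightarrow> nearby M x z' \<Longrightarrow> \<phi> z \<noteq> z'"
    using nearby_moved[OF fD(1) x ne(1)] by blast
  obtain N2 where N2: "\<And>M z z'. N2 \<le> M \<Longrightarrow> nearby M x z \<Longrightarrow> nearby M x z' \<Longrightarrow> \<phi> z \<noteq> \<pi> z'"
    using nearby_separate[OF fD(1) p(1) x ne(2)] by blast
  obtain N3 where N3: "\<pi> x = x \<longrightarrow> (\<forall>M\<ge>N3. \<forall>z. nearby M x z \<longrightarrow> \<pi> z = z)"
    "\<pi> x \<noteq> x \<longrightarrow> (\<forall>M\<ge>N3. \<forall>z z'. nearby M x z \<longrightarrow> nearby M x z' \<longrightarrow> \<pi> z \<noteq> z')"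
    using fixed_nearby[OF \<pi> x] nearby_moved[OF p(1) x] by metis
  obtain M where M: "N1 \<le> M" "N2 \<le> M" "N3 \<le> M" by (meson max.cobounded1 max.coboundedI2 max.cobounded2)
  define a where "a = cone (cut M x)"
  have a: "z \<in> a \<Longrightarrow> z \<in> points" for z using cone_points[OF cut_arrows[OF x]] by (auto simp: a_def)
  have \<phi>1: "z \<in> a \<Longrightarrow> \<phi> z \<notin> a" for z
    using N1[OF M(1), of z "\<phi> z"] nearby_cone[OF x, of M] by (auto simp: a_def)
  have \<phi>2: "z \<in> a \<Longrightarrow> \<pi> (\<phi> z) \<notin> a" for z
    using N2[OF M(2), of z "\<pi> (\<phi> z)"] nearby_cone[OF x, of M] p(2)[of "\<phi> z"] fD(3)[of z] a[of z]
    by (auto simp: a_def)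
  obtain \<psi>0 y where \<psi>0: "\<psi>0 \<in> Pref" "\<And>z. z \<in> points \<Longrightarrow> z \<notin> a \<Longrightarrow> \<psi>0 z = z"
    and y: "y \<in> a" "\<psi>0 (\<psi>0 y) \<noteq> y"
    using element_of_higher_order[OF cut_arrows[OF x, of M]] unfolding a_def by metis
  have \<psi>0a: "\<psi>0 z \<in> a" if "z \<in> a" for z
    using \<psi>0(2)[of "\<psi>0 z"] Pref_inj[OF \<psi>0(1), of "\<psi>0 z" z] Pref_points[OF \<psi>0(1)] a[OF that] that by metis
  have "\<exists>\<psi>\<in>Pref. (\<forall>z\<in>points. \<psi> (\<pi> z) = \<pi> (\<psi> z)) \<and> (\<forall>z\<in>a. \<psi> z = \<psi>0 z) \<and>
      (\<forall>z\<in>points. z \<notin> a \<longrightarrow> \<pi> z \<notin> a \<longrightarrow> \<psi> z = z)"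
  proof (cases "\<pi> x = x")
    case True
    then have fixa: "\<pi> z = z" if "z \<in> a" for z
      using N3(1) M(3) nearby_cone[OF x, of M z] that unfolding a_def by metis
    have "\<psi>0 (\<pi> z) = \<pi> (\<psi>0 z)" if z: "z \<in> points" for z
    proof (cases "z \<in> a")
      case True
      then show ?thesis using fixa \<psi>0a by simp
    next
      case False
      then have "\<pi> z \<notin> a" using fixa[of "\<pi> z"] p(2)[OF z] by metis
      then show ?thesis using \<psi>0(2) False z p(3) by simp
    qed
    then show ?thesis using \<psi>0 by blast
  next
    case False
    then have dis: "\<pi> z \<notin> a" if "z \<in> a" for z
      using N3(2) M(3) nearby_cone[OF x, of M] that unfolding a_def by metis
    \<comment> \<open>\<open>\<psi>0\<close> on \<open>a\<close> and its mirror image on \<open>\<pi> a\<close>, to commute with \<open>\<pi>\<close>\<close>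
    let ?\<psi> = "\<psi>0 \<otimes>\<^bsub>G\<^esub> (\<pi> \<otimes>\<^bsub>G\<^esub> (\<psi>0 \<otimes>\<^bsub>G\<^esub> \<pi>))"
    have ap: "?\<psi> z = \<psi>0 (\<pi> (\<psi>0 (\<pi> z)))" if "z \<in> points" for z
      using that \<psi>0(1) p(1) by (simp add: G_mult_apply G_mult_closed)
    have 1: "?\<psi> z = \<psi>0 z" if "z \<in> a" for z
      using that dis a p \<psi>0(2) by (simp add: ap)
    have 2: "?\<psi> z = \<pi> (\<psi>0 (\<pi> z))" if "z \<in> points" "\<pi> z \<in> a" for z
      using that dis[OF \<psi>0a[OF that(2)]] \<psi>0(2) p(3) a[OF \<psi>0a[OF that(2)]] by (simp add: ap)
    have 3: "?\<psi> z = z" if "z \<in> points" "z \<notin> a" "\<pi> z \<notin> a" for z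
      using that p \<psi>0(2) by (simp add: ap)
    have "?\<psi> (\<pi> z) = \<pi> (?\<psi> z)" if z: "z \<in> points" for z
    proof -
      consider "z \<in> a" | "\<pi> z \<in> a" | "z \<notin> a" "\<pi> z \<notin> a" by blast
      then show ?thesis
      proof cases
        case 1
        then show ?thesis using \<open>\<And>z. z \<in> a \<Longrightarrow> ?\<psi> z = \<psi>0 z\<close>[OF 1] 2[of "\<pi> z"] z p by simp
      next
        case 2
        then show ?thesis using 1[OF 2] \<open>\<And>z. z \<in> points \<Longrightarrow> \<pi> z \<in> a \<Longrightarrow> ?\<psi> z = \<pi> (\<psi>0 (\<pi> z))\<close>[OF z 2]
            p(2)[OF a[OF \<psi>0a[OF 2]]] by simp
      next
        case 3
        then show ?thesis using \<open>\<And>z. z \<in> points \<Longrightarrow> z \<notin> a \<Longrightarrow> \<pi> z \<notin> a \<Longrightarrow> ?\<psi> z = z\<close>[of z]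
            \<open>\<And>z. z \<in> points \<Longrightarrow> z \<notin> a \<Longrightarrow> \<pi> z \<notin> a \<Longrightarrow> ?\<psi> z = z\<close>[of "\<pi> z"] z p by simp
      qed
    qed
    moreover have "?\<psi> \<in> Pref" using \<psi>0(1) p(1) by (simp add: G_mult_closed)
    ultimately show ?thesis using 1 3 by blast
  qed
  then obtain \<psi> where \<psi>: "\<psi> \<in> Pref" "\<And>z. z \<in> points \<Longrightarrow> \<psi> (\<pi> z) = \<pi> (\<psi> z)"
    "\<And>z. z \<in> a \<Longrightarrow> \<psi> z = \<psi>0 z" "\<And>z. z \<in> points \<Longrightarrow> z \<notin> a \<Longrightarrow> \<pi> z \<notin> a \<Longrightarrow> \<psi> z = z" by blast
  define z where "z = \<psi> y"
  have z: "z \<in> a" "z \<in> points" "y \<in> points" using y \<psi> \<psi>0a a by (auto simp: z_def)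
  have away: "\<psi> (\<phi> u) = \<phi> u" "(inv\<^bsub>G\<^esub> \<psi>) (\<phi> u) = \<phi> u" if "u \<in> a" for u
  proof -
    show 1: "\<psi> (\<phi> u) = \<phi> u" using \<psi>(4) \<phi>1 \<phi>2 fD(3) a that by blast
    show "(inv\<^bsub>G\<^esub> \<psi>) (\<phi> u) = \<phi> u" using G_inv_left[OF \<psi>(1) fD(3)[OF a[OF that]]] 1 by simp
  qed
  have "\<phi> (\<psi> (\<phi> ((inv\<^bsub>G\<^esub> \<psi>) z))) = y"
    using G_inv_left[OF \<psi>(1) z(3)] away(1)[OF y(1)] fD(2)[OF z(3)] by (simp add: z_def)
  moreover have "\<psi> (\<phi> ((inv\<^bsub>G\<^esub> \<psi>) (\<phi> z))) = \<psi> z"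
    using away(2)[OF z(1)] fD(2)[OF z(2)] by simp
  ultimately have "\<psi> z = y" using conj[OF \<psi>(1,2) z(2)] by simp
  then show False using y \<psi>(3)[OF z(1)] \<psi>(3)[OF y(1)] by (simp add: z_def)
qed

text \<open>Fullness provides a supply of twins: \<open>\<pi>\<close> cut off outside of a cone and its image.\<close>

lemma twin_of_cone:
  assumes \<pi>: "involution \<pi>" and p: "p \<in> arrows"
  defines "B \<equiv> {x \<in> points. x \<in> cone p \<or> \<pi> x \<in> cone p}"
  shows "(\<lambda>x\<in>points. if x \<in> B then \<pi> x else x) \<in> twins G \<pi>"
proof -
  note pD = involutionD[OF \<pi>]
  let ?f = "\<lambda>x\<in>points. if x \<in> B then \<pi> x else x"
  obtain M where M: "determined M {x \<in> points. \<pi> x \<in> cone p}"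
    using determined_vimage[OF pD(1) determined_cone[OF p len_le_max_len]] by blast
  have "B = cone p \<union> {x \<in> points. \<pi> x \<in> cone p}" using cone_points[OF p] by (auto simp: B_def)
  then have B: "determined (max M (max_len p)) B"
    using determined_Un[OF determined_mono[OF determined_cone[OF p len_le_max_len]] determined_mono[OF M]] by simp
  have inv: "\<pi> x \<in> B \<longleftrightarrow> x \<in> B" if "x \<in> points" for x
    using pD that by (auto simp: B_def)
  have f: "?f \<in> Pref" by (rule Pref_restrict[OF pD(1) B inv])
  have "involution ?f" by (rule involutionI[OF f]) (use pD inv in auto)
  moreover have "?f (\<pi> x) = \<pi> (?f x)" if "x \<in> points" for x using that pD inv by auto
  moreover have "?f (\<psi> (?f ((inv\<^bsub>G\<^esub> \<psi>) x))) = \<psi> (?f ((inv\<^bsub>G\<^esub> \<psi>) (?f x)))"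
    if \<psi>: "\<psi> \<in> Pref" "\<And>x. x \<in> points \<Longrightarrow> \<psi> (\<pi> x) = \<pi> (\<psi> x)" and x: "x \<in> points" for \<psi> x
  proof -
    define y where "y = (inv\<^bsub>G\<^esub> \<psi>) x"
    have y: "y \<in> points" "\<psi> y = x" "\<pi> y \<in> points"
      using Pref_points[OF G_inv_closed[OF \<psi>(1)] x] G_inv_right[OF \<psi>(1) x] pD(3) by (auto simp: y_def)
    have "(inv\<^bsub>G\<^esub> \<psi>) (\<pi> x) = \<pi> y"
      using G_inv_left[OF \<psi>(1) y(3)] \<psi>(2)[OF y(1)] y(2) by simp
    then show ?thesis
      using x y inv[OF y(1)] inv[OF x] \<psi>(2)[OF y(1)] pD(2)[OF x] pD(2)[OF y(1)] pD(3)[OF x] y_def[symmetric]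
      by auto
  qed
  ultimately show ?thesis using twins_iff[OF \<pi>, of ?f] by blast
qed

text \<open>The twin of a small cone at \<open>x\<close> moves \<open>x\<close>. If \<open>\<phi> x\<close> were neither \<open>x\<close> nor \<open>\<pi> x\<close>, the twin would fix \<open>\<phi> x\<close> and could
  not commute with \<open>\<phi>\<close>.\<close>

lemma square_trivial_on_support:
  assumes \<pi>: "involution \<pi>" and \<phi>: "\<phi> \<in> centralizer G (twins G \<pi>)" and x: "x \<in> points" "\<pi> x \<noteq> x"
  shows "\<phi> (\<phi> x) = x"
proof -
  note pD = involutionD[OF \<pi>]
  have f: "\<phi> \<in> Pref" using \<phi> by (simp add: centralizer_def)
  have comm: "\<phi> (\<tau> z) = \<tau> (\<phi> z)" if "\<tau> \<in> twins G \<pi>" "z \<in> points" for \<tau> z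
    using \<phi> that commute_iff[OF f, of \<tau>] subsetD[OF twins_carrier that(1)]
    by (auto simp: centralizer_def)
  define \<tau> where "\<tau> M = (\<lambda>z\<in>points. if z \<in> {z \<in> points. z \<in> cone (cut M x) \<or> \<pi> z \<in> cone (cut M x)} then \<pi> z else z)" for M
  have \<tau>: "\<tau> M \<in> twins G \<pi>" for M unfolding \<tau>_def by (rule twin_of_cone[OF \<pi> cut_arrows[OF x(1)]])
  have xc: "x \<in> cone (cut M x)" for M using in_cone_cut[OF x(1)] .
  have "\<phi> x = x \<or> \<phi> x = \<pi> x"
  proof (rule ccontr)
    assume "\<not> ?thesis"
    then have ne: "\<phi> x \<noteq> x" "\<phi> x \<noteq> \<pi> x" by auto
    obtain N1 where N1: "\<And>M z z'. N1 \<le> M \<Longrightarrow> nearby M x z \<Longrightarrow> nearby M x z' \<Longrightarrow> \<phi> z \<noteq> z'"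
      using nearby_moved[OF f x(1) ne(1)] by blast
    obtain N2 where N2: "\<And>M z z'. N2 \<le> M \<Longrightarrow> nearby M x z \<Longrightarrow> nearby M x z' \<Longrightarrow> \<phi> z \<noteq> \<pi> z'"
      using nearby_separate[OF f pD(1) x(1) ne(2)] by blast
    obtain M where M: "N1 \<le> M" "N2 \<le> M" by (meson max.cobounded1 max.cobounded2)
    have fx: "\<phi> x \<in> points" using Pref_points[OF f x(1)] .
    have "\<phi> x \<notin> cone (cut M x)"
      using N1[OF M(1), of x "\<phi> x"] nearby_cone[OF x(1), of M] nearby_refl[OF x(1), of M] by auto
    moreover have "\<pi> (\<phi> x) \<notin> cone (cut M x)"
      using N2[OF M(2), of x "\<pi> (\<phi> x)"] nearby_cone[OF x(1), of M] nearby_refl[OF x(1), of M] pD(2)[OF fx] by auto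
    ultimately have "\<tau> M (\<phi> x) = \<phi> x" using fx by (simp add: \<tau>_def)
    moreover have "\<tau> M x = \<pi> x" using x xc by (simp add: \<tau>_def)
    ultimately have "\<phi> (\<pi> x) = \<phi> x" using comm[OF \<tau> x(1), of M] by simp
    then show False using Pref_inj[OF f _ x(1)] pD(3)[OF x(1)] x(2) by blast
  qed
  then show ?thesis
  proof
    assume fx: "\<phi> x = \<pi> x"
    have "\<tau> 0 x = \<pi> x" "\<tau> 0 (\<pi> x) = x" using x xc pD by (auto simp: \<tau>_def)
    then show ?thesis using comm[OF \<tau> x(1), of 0] fx by simp
  qed simp
qed

text \<open>For the inclusion from left to right, a point \<open>x\<close> that \<open>\<phi>\<close> moves and \<open>\<pi>\<close> fixes has a small cone on which \<open>\<pi>\<close> is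
  the identity. An element \<open>\<psi>\<close> supported there commutes with all twins, but its square does not commute with \<open>\<phi>\<close>.\<close>

theorem supported_iff:
  assumes \<pi>: "involution \<pi>" and \<phi>: "\<phi> \<in> Pref"
  shows "\<phi> \<in> supported G \<pi> \<longleftrightarrow> (\<forall>x\<in>points. \<phi> x \<noteq> x \<longrightarrow> \<pi> x \<noteq> x)"
proof -
  note pD = involutionD[OF \<pi>]
  let ?V = "centralizer G (twins G \<pi>)"
  have V: "\<chi> \<in> Pref" if "\<chi> \<in> ?V" for \<chi> using that by (simp add: centralizer_def)
  have sup: "\<phi> \<in> supported G \<pi> \<longleftrightarrow> (\<forall>\<chi>\<in>?V. \<forall>x\<in>points. \<phi> (\<chi> (\<chi> x)) = \<chi> (\<chi> (\<phi> x)))"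
    using \<phi> V by (simp add: supported_def centralizer_def[of G "_ ` _"] commute_iff G_mult_closed G_mult_apply Pref_points)
  show ?thesis
  proof
    assume supp: "\<forall>x\<in>points. \<phi> x \<noteq> x \<longrightarrow> \<pi> x \<noteq> x"
    have "\<phi> (\<chi> (\<chi> x)) = \<chi> (\<chi> (\<phi> x))" if \<chi>: "\<chi> \<in> ?V" and x: "x \<in> points" for \<chi> x
    proof -
      note c = Pref_points[OF V[OF \<chi>]]
      have tr: "\<chi> (\<chi> z) = z" if "z \<in> points" "\<pi> z \<noteq> z" for z
        using square_trivial_on_support[OF \<pi> \<chi> that] .
      have fp: "\<phi> x \<in> points" using Pref_points[OF \<phi> x] .
      show ?thesis
      proof (cases "\<pi> x = x")
        case False
        have "\<pi> (\<phi> x) \<noteq> \<phi> x"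
        proof
          assume "\<pi> (\<phi> x) = \<phi> x"
          then have "\<phi> (\<phi> x) = \<phi> x" using supp fp by blast
          then show False using Pref_inj[OF \<phi> fp x] False \<open>\<pi> (\<phi> x) = \<phi> x\<close> by simp
        qed
        then show ?thesis using tr[OF x False] tr[OF fp] by simp
      next
        case True
        then have 1: "\<phi> x = x" using supp x by blast
        have "\<pi> (\<chi> (\<chi> x)) = \<chi> (\<chi> x)"
        proof (rule ccontr)
          assume n: "\<not> ?thesis"
          then have "\<chi> (\<chi> (\<chi> (\<chi> x))) = \<chi> (\<chi> x)" using tr[of "\<chi> (\<chi> x)"] c x by simp
          then have "\<chi> (\<chi> x) = x" using Pref_inj[OF V[OF \<chi>]] c x by blast
          then show False using n True by simp
        qed
        then have "\<phi> (\<chi> (\<chi> x)) = \<chi> (\<chi> x)" using supp c x by blast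
        then show ?thesis using 1 by simp
      qed
    qed
    then show "\<phi> \<in> supported G \<pi>" using sup by blast
  next
    assume "\<phi> \<in> supported G \<pi>"
    then have comm: "\<phi> (\<chi> (\<chi> x)) = \<chi> (\<chi> (\<phi> x))" if "\<chi> \<in> ?V" "x \<in> points" for \<chi> x
      using sup that by blast
    show "\<forall>x\<in>points. \<phi> x \<noteq> x \<longrightarrow> \<pi> x \<noteq> x"
    proof (intro ballI impI notI)
      fix x assume x: "x \<in> points" "\<phi> x \<noteq> x" "\<pi> x = x"
      obtain N1 where N1: "\<And>M z z'. N1 \<le> M \<Longrightarrow> nearby M x z \<Longrightarrow> nearby M x z' \<Longrightarrow> \<phi> z \<noteq> z'"
        using nearby_moved[OF \<phi> x(1,2)] by blast
      obtain N2 where N2: "\<And>M z. N2 \<le> M \<Longrightarrow> nearby M x z \<Longrightarrow> \<pi> z = z"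
        using fixed_nearby[OF \<pi> x(1,3)] by blast
      obtain M where M: "N1 \<le> M" "N2 \<le> M" by (meson max.cobounded1 max.cobounded2)
      define a where "a = cone (cut M x)"
      have a: "z \<in> a \<Longrightarrow> z \<in> points" for z using cone_points[OF cut_arrows[OF x(1)]] by (auto simp: a_def)
      have \<phi>1: "z \<in> a \<Longrightarrow> \<phi> z \<notin> a" for z
        using N1[OF M(1), of z "\<phi> z"] nearby_cone[OF x(1), of M] by (auto simp: a_def)
      have fixa: "z \<in> a \<Longrightarrow> \<pi> z = z" for z
        using N2[OF M(2), of z] nearby_cone[OF x(1), of M] by (auto simp: a_def)
      obtain \<psi> y where \<psi>: "\<psi> \<in> Pref" "\<And>z. z \<in> points \<Longrightarrow> z \<notin> a \<Longrightarrow> \<psi> z = z"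
        and y: "y \<in> a" "\<psi> (\<psi> y) \<noteq> y"
        using element_of_higher_order[OF cut_arrows[OF x(1), of M]] unfolding a_def by metis
      have \<psi>a: "\<psi> z \<in> a" if "z \<in> a" for z
        using \<psi>(2)[of "\<psi> z"] Pref_inj[OF \<psi>(1), of "\<psi> z" z] Pref_points[OF \<psi>(1)] a[OF that] that by metis
      have "\<psi> (\<tau> z) = \<tau> (\<psi> z)" if \<tau>: "\<tau> \<in> twins G \<pi>" and z: "z \<in> points" for \<tau> z
      proof -
        have t: "involution \<tau>" using \<tau> twins_iff[OF \<pi>] by blast
        note tD = involutionD[OF t]
        have ta: "\<tau> z = z" if "z \<in> a" for z using twins_values[OF \<pi> \<tau> a[OF that]] fixa[OF that] by auto
        show ?thesis
        proof (cases "z \<in> a")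
          case True
          then show ?thesis using ta \<psi>a by simp
        next
          case False
          have "\<tau> z \<notin> a" using ta[of "\<tau> z"] tD(2)[OF z] False by metis
          then show ?thesis using \<psi>(2) False z tD(3) by simp
        qed
      qed
      then have "\<psi> \<in> ?V"
        using \<psi>(1) twins_carrier[of G \<pi>] by (auto simp: centralizer_def commute_iff subset_iff)
      then have "\<phi> (\<psi> (\<psi> y)) = \<psi> (\<psi> (\<phi> y))" using comm a y by blast
      also have "\<dots> = \<phi> y" using \<psi>(2) \<phi>1[OF y(1)] Pref_points[OF \<phi> a[OF y(1)]] by simp
      finally show False using Pref_inj[OF \<phi>] a \<psi>a y by blast
    qed
  qed
qed

end

section \<open>The map of spaces induced by an isomorphism\<close>

context word_space begin

lemma moved_cone:
  assumes "involution \<pi>" "x \<in> points" "\<pi> x \<noteq> x"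
  obtains N where "\<And>M z. N \<le> M \<Longrightarrow> nearby M x z \<Longrightarrow> \<pi> z \<noteq> z"
proof -
  obtain N where N: "\<And>M z z'. N \<le> M \<Longrightarrow> nearby M x z \<Longrightarrow> nearby M x z' \<Longrightarrow> \<pi> z \<noteq> z'"
    using nearby_moved[OF involutionD(1)[OF assms(1)] assms(2,3)] by blast
  have "\<pi> z \<noteq> z" if "N \<le> M" "nearby M x z" for M z using N[OF that that(2)] .
  then show ?thesis by (rule that)
qed

lemma nested_cells:
  assumes c: "\<And>N. c N \<in> arrows" "\<And>N. depth N (c N)"
    and nest: "\<And>M N. M \<le> N \<Longrightarrow> cone (c N) \<subseteq> cone (c M)"
  obtains y where "y \<in> points" "\<And>N. cut N y = c N"
proof -
  define y where "y = (fst (c 0), \<lambda>j\<in>J. \<lambda>t. snd (c (Suc t)) j ! t)"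
  have len: "len (c N) j = N" if "j \<in> J" for N j using c(2)[of N] that by (simp add: depth_def)
  have agree: "fst (c N) = fst (c M) \<and> (\<forall>j\<in>J. \<forall>t<M. snd (c N) j ! t = snd (c M) j ! t)" if "M \<le> N" for M N
  proof -
    obtain w where w: "w \<in> streams" by (rule streams_nonempty)
    then have 1: "c N \<cdot> w \<in> cone (c N)" by (simp add: cone_def)
    then have "c N \<cdot> w \<in> cone (c M)" using nest[OF that] by blast
    then show ?thesis using that len by (simp add: cone_iff[OF c(1)] app_nth)
  qed
  have "snd y \<in> streams"
  proof (rule streamsI)
    fix j t assume j: "j \<in> J"
    have "set (snd (c (Suc t)) j) \<subseteq> A j" using c(1)[of "Suc t"] wordsD[of "snd (c (Suc t))" j] j by (simp add: arrows_def mem_Times_iff)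
    moreover have "snd (c (Suc t)) j ! t \<in> set (snd (c (Suc t)) j)" using len[OF j, of "Suc t"] by simp
    ultimately show "snd y j t \<in> A j" using j by (auto simp: y_def)
  qed (simp add: y_def)
  then have y: "y \<in> points" using c(1)[of 0] by (simp add: points_def arrows_def mem_Times_iff) (simp add: y_def)
  have "y \<in> cone (c N)" for N
  proof -
    have "snd y j t = snd (c N) j ! t" if "j \<in> J" "t < N" for j t
      using agree[of "Suc t" N] that by (simp add: y_def)
    moreover have "fst y = fst (c N)" using agree[of 0 N] by (simp add: y_def)
    ultimately show ?thesis using y len by (simp add: cone_iff[OF c(1)])
  qed
  then have "cut N y = c N" for N using cone_depth[OF c] by blast
  then show ?thesis using that y by blast
qed

lemma twist_nontrivial: "p \<in> arrows \<Longrightarrow> \<exists>x\<in>points. twist p x \<noteq> x"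
proof -
  assume p: "p \<in> arrows"
  obtain w where w: "w \<in> streams" by (rule streams_nonempty)
  then have "p \<cdot> w \<in> cone p" by (simp add: cone_def)
  then show ?thesis using twist_moves[OF p app_points[OF p w]] app_points[OF p w] by blast
qed

lemma cone_disjoint_depth:
  assumes "p \<in> arrows" "q \<in> arrows" "depth N p" "depth N q" "p \<noteq> q"
  shows "cone p \<inter> cone q = {}"
  using assms(5) by (auto simp: cone_depth[OF assms(1,3)] cone_depth[OF assms(2,4)])

end

locale word_space_iso = D: word_space J A V lab flip + R: word_space J' A' V' lab' flip'
  for J :: "nat set" and A :: "nat \<Rightarrow> 'a set" and V lab flip
    and J' :: "nat set" and A' :: "nat \<Rightarrow> 'b set" and V' lab' flip' +
  fixes f
  assumes f: "f \<in> iso D.G R.G"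
begin

lemma f_Pref: "\<phi> \<in> D.Pref \<Longrightarrow> f \<phi> \<in> R.Pref"
  using f by (auto simp: iso_def hom_def)

lemma f_mult: "\<phi> \<in> D.Pref \<Longrightarrow> \<psi> \<in> D.Pref \<Longrightarrow> f (\<phi> \<otimes>\<^bsub>D.G\<^esub> \<psi>) = f \<phi> \<otimes>\<^bsub>R.G\<^esub> f \<psi>"
  using f by (auto simp: iso_def hom_def)

lemma f_inj: "\<phi> \<in> D.Pref \<Longrightarrow> \<psi> \<in> D.Pref \<Longrightarrow> f \<phi> = f \<psi> \<Longrightarrow> \<phi> = \<psi>"
  using f by (auto simp: iso_def bij_betw_def dest: inj_onD)

lemma f_surj: "\<psi> \<in> R.Pref \<Longrightarrow> \<exists>\<phi>\<in>D.Pref. f \<phi> = \<psi>"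
proof -
  assume "\<psi> \<in> R.Pref"
  then have "\<psi> \<in> f ` D.Pref" using f by (simp add: iso_def bij_betw_def)
  then show ?thesis by blast
qed

lemma f_one: "f \<one>\<^bsub>D.G\<^esub> = \<one>\<^bsub>R.G\<^esub>"
proof -
  interpret group_hom D.G R.G f
    using f D.group_G R.group_G by (simp add: group_hom_def group_hom_axioms_def iso_def)
  show ?thesis by (rule hom_one)
qed

lemma involution_f: "\<pi> \<in> D.Pref \<Longrightarrow> R.involution (f \<pi>) \<longleftrightarrow> D.involution \<pi>"
  using f_mult[of \<pi> \<pi>] f_inj[OF D.G_mult_closed[of \<pi> \<pi>] D.Pref_one] f_Pref f_one
  by (auto simp: D.involution_def R.involution_def D.G_one)

lemma support_subset:
  assumes "D.involution \<pi>" "D.involution \<rho>"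
  shows "(\<forall>x\<in>D.points. \<rho> x \<noteq> x \<longrightarrow> \<pi> x \<noteq> x) \<longleftrightarrow> (\<forall>y\<in>R.points. f \<rho> y \<noteq> y \<longrightarrow> f \<pi> y \<noteq> y)"
proof -
  have Pref: "\<pi> \<in> D.Pref" "\<rho> \<in> D.Pref" using assms D.involutionD by auto
  have "R.involution (f \<pi>)" using involution_f Pref assms by blast
  then show ?thesis
    using D.supported_iff[OF assms(1) Pref(2)] R.supported_iff[OF _ f_Pref[OF Pref(2)]]
      iso_supported[OF D.group_G R.group_G f, of \<pi> \<rho>] Pref by simp
qed

lemma nontrivial:
  assumes "\<rho> \<in> D.Pref"
  shows "(\<exists>x\<in>D.points. \<rho> x \<noteq> x) \<longleftrightarrow> (\<exists>y\<in>R.points. f \<rho> y \<noteq> y)"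
proof -
  have "(\<forall>x\<in>D.points. \<rho> x = x) \<longleftrightarrow> \<rho> = \<one>\<^bsub>D.G\<^esub>"
    using D.Pref_eqI[OF assms D.Pref_one] by (auto simp: D.G_one)
  moreover have "(\<forall>y\<in>R.points. f \<rho> y = y) \<longleftrightarrow> f \<rho> = \<one>\<^bsub>R.G\<^esub>"
    using R.Pref_eqI[OF f_Pref[OF assms] R.Pref_one] by (auto simp: R.G_one)
  moreover have "f \<rho> = \<one>\<^bsub>R.G\<^esub> \<longleftrightarrow> \<rho> = \<one>\<^bsub>D.G\<^esub>"
    using f_inj[OF assms D.Pref_one] f_one by (auto simp: D.G_one)
  ultimately show ?thesis by blast
qed

definition pull where
  "pull c = inv_into D.Pref f (R.twist c)"

lemma pull:
  assumes "c \<in> R.arrows"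
  shows "D.involution (pull c)" "f (pull c) = R.twist c"
proof -
  have "R.twist c \<in> f ` D.Pref" using f_surj[OF R.twist_Pref[OF assms]] by force
  then have 1: "pull c \<in> D.Pref" "f (pull c) = R.twist c"
    using inv_into_into[of "R.twist c" f D.Pref] f_inv_into_f[of "R.twist c" f D.Pref]
    by (simp_all add: pull_def)
  then show "D.involution (pull c)" "f (pull c) = R.twist c"
    using involution_f[OF 1(1)] R.involution_twist[OF assms] by auto
qed

text \<open>Supports meet if and only if the support of a non-trivial involution lies in both.\<close>

lemma support_disjoint:
  assumes \<pi>: "D.involution \<pi>" and \<rho>: "D.involution \<rho>"
  shows "(\<exists>x\<in>D.points. \<rho> x \<noteq> x \<and> \<pi> x \<noteq> x) \<longleftrightarrow> (\<exists>y\<in>R.points. f \<rho> y \<noteq> y \<and> f \<pi> y \<noteq> y)"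
proof
  assume "\<exists>x\<in>D.points. \<rho> x \<noteq> x \<and> \<pi> x \<noteq> x"
  then obtain x where x: "x \<in> D.points" "\<rho> x \<noteq> x" "\<pi> x \<noteq> x" by blast
  obtain N1 where N1: "\<And>M z. N1 \<le> M \<Longrightarrow> D.nearby M x z \<Longrightarrow> \<rho> z \<noteq> z"
    using D.moved_cone[OF \<rho> x(1,2)] by blast
  obtain N2 where N2: "\<And>M z. N2 \<le> M \<Longrightarrow> D.nearby M x z \<Longrightarrow> \<pi> z \<noteq> z"
    using D.moved_cone[OF \<pi> x(1,3)] by blast
  define p where "p = D.cut (max N1 N2) x"
  have p: "p \<in> D.arrows" using D.cut_arrows[OF x(1)] by (simp add: p_def)
  have m: "\<rho> z \<noteq> z \<and> \<pi> z \<noteq> z" if "z \<in> D.points" "D.twist p z \<noteq> z" for z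
    using that D.twist_moves[OF p that(1)] D.nearby_cone[OF x(1), of "max N1 N2" z]
      N1[of "max N1 N2" z] N2[of "max N1 N2" z] by (simp add: p_def)
  note t = D.involution_twist[OF p]
  obtain y where y: "y \<in> R.points" "f (D.twist p) y \<noteq> y"
    using nontrivial[OF D.twist_Pref[OF p]] D.twist_nontrivial[OF p] by blast
  then have "f \<rho> y \<noteq> y" "f \<pi> y \<noteq> y"
    using support_subset[OF \<rho> t] support_subset[OF \<pi> t] m by auto
  then show "\<exists>y\<in>R.points. f \<rho> y \<noteq> y \<and> f \<pi> y \<noteq> y" using y by blast
next
  have iR: "R.involution (f \<pi>)" "R.involution (f \<rho>)"
    using involution_f \<pi> \<rho> D.involutionD(1) by blast+
  assume "\<exists>y\<in>R.points. f \<rho> y \<noteq> y \<and> f \<pi> y \<noteq> y"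
  then obtain x where x: "x \<in> R.points" "f \<rho> x \<noteq> x" "f \<pi> x \<noteq> x" by blast
  obtain N1 where N1: "\<And>M z. N1 \<le> M \<Longrightarrow> R.nearby M x z \<Longrightarrow> f \<rho> z \<noteq> z"
    using R.moved_cone[OF iR(2) x(1,2)] by blast
  obtain N2 where N2: "\<And>M z. N2 \<le> M \<Longrightarrow> R.nearby M x z \<Longrightarrow> f \<pi> z \<noteq> z"
    using R.moved_cone[OF iR(1) x(1,3)] by blast
  define p where "p = R.cut (max N1 N2) x"
  have p: "p \<in> R.arrows" using R.cut_arrows[OF x(1)] by (simp add: p_def)
  have m: "f \<rho> z \<noteq> z \<and> f \<pi> z \<noteq> z" if "z \<in> R.points" "f (pull p) z \<noteq> z" for z
    using that R.twist_moves[OF p that(1)] R.nearby_cone[OF x(1), of "max N1 N2" z]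
      N1[of "max N1 N2" z] N2[of "max N1 N2" z] pull[OF p] by (simp add: p_def)
  note t = pull(1)[OF p]
  obtain y where y: "y \<in> D.points" "pull p y \<noteq> y"
    using nontrivial[OF D.involutionD(1)[OF t]] R.twist_nontrivial[OF p] pull(2)[OF p] by auto
  then have "\<rho> y \<noteq> y" "\<pi> y \<noteq> y"
    using support_subset[OF \<rho> t] support_subset[OF \<pi> t] m by auto
  then show "\<exists>x\<in>D.points. \<rho> x \<noteq> x \<and> \<pi> x \<noteq> x" using y by blast
qed

lemma pull_subset:
  assumes "c \<in> R.arrows" "d \<in> R.arrows" "R.cone c \<subseteq> R.cone d" "x \<in> D.points" "pull c x \<noteq> x"
  shows "pull d x \<noteq> x"
proof -
  have "f (pull d) y \<noteq> y" if "y \<in> R.points" "f (pull c) y \<noteq> y" for y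
    using that pull(2) assms(1-3) R.twist_moves by auto
  then show ?thesis using support_subset[OF pull(1)[OF assms(2)] pull(1)[OF assms(1)]] assms(4,5) by blast
qed

text \<open>The supports of the pulled back twists of depth \<open>N\<close> are disjoint because the cones are. They cover: otherwise a
  small cone at \<open>x\<close> would avoid all of these finitely many supports, and the image of its twist would avoid all
  cones of depth \<open>N\<close>.\<close>

lemma ex1_cell:
  assumes x: "x \<in> D.points"
  shows "\<exists>!c. c \<in> R.arrows \<and> R.depth N c \<and> pull c x \<noteq> x"
proof (rule ex_ex1I)
  let ?C = "{c \<in> R.arrows. R.depth N c}"
  show "\<exists>c. c \<in> R.arrows \<and> R.depth N c \<and> pull c x \<noteq> x"
  proof (rule ccontr)
    assume "\<not> ?thesis"
    then have fixed: "pull c x = x" if "c \<in> ?C" for c using that by blast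
    have "\<exists>n. \<forall>M z. n \<le> M \<longrightarrow> D.nearby M x z \<longrightarrow> pull c z = z" if c: "c \<in> ?C" for c
    proof -
      have "D.involution (pull c)" using pull(1) c by simp
      from D.fixed_nearby[OF this x fixed[OF c]]
      obtain n where "\<And>M z. n \<le> M \<Longrightarrow> D.nearby M x z \<Longrightarrow> pull c z = z" by blast
      then show ?thesis by blast
    qed
    then have "\<forall>c\<in>?C. \<exists>n. \<forall>M z. n \<le> M \<longrightarrow> D.nearby M x z \<longrightarrow> pull c z = z" by blast
    from bchoice[OF this] obtain n where n: "\<And>c M z. c \<in> ?C \<Longrightarrow> n c \<le> M \<Longrightarrow> D.nearby M x z \<Longrightarrow> pull c z = z" by blast
    define M where "M = Max (n ` ?C)"
    have M: "n c \<le> M" if "c \<in> ?C" for c using R.finite_depth[of N] that by (simp add: M_def)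
    define p where "p = D.cut M x"
    have p: "p \<in> D.arrows" using D.cut_arrows[OF x] by (simp add: p_def)
    obtain y where y: "y \<in> R.points" "f (D.twist p) y \<noteq> y"
      using nontrivial[OF D.twist_Pref[OF p]] D.twist_nontrivial[OF p] by blast
    define c where "c = R.cut N y"
    have c: "c \<in> R.arrows" "c \<in> ?C" using R.cut_arrows[OF y(1)] by (auto simp: c_def)
    have "f (pull c) y \<noteq> y"
      using pull(2)[OF c(1)] R.twist_moves[OF c(1) y(1)] R.in_cone_cut[OF y(1)] by (simp add: c_def)
    then obtain z where z: "z \<in> D.points" "D.twist p z \<noteq> z" "pull c z \<noteq> z"
      using support_disjoint[OF pull(1)[OF c(1)] D.involution_twist[OF p]] y by blast
    then have "D.nearby M x z" using D.twist_moves[OF p z(1)] D.nearby_cone[OF x] by (simp add: p_def)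
    then show False using n[OF c(2) M[OF c(2)]] z by blast
  qed
  fix c d assume c: "c \<in> R.arrows \<and> R.depth N c \<and> pull c x \<noteq> x" and d: "d \<in> R.arrows \<and> R.depth N d \<and> pull d x \<noteq> x"
  then obtain y where "y \<in> R.points" "f (pull c) y \<noteq> y" "f (pull d) y \<noteq> y"
    using support_disjoint[OF pull(1) pull(1), of d c] x by blast
  then have "y \<in> R.cone c \<inter> R.cone d" using c d pull(2) R.twist_moves by auto
  then show "c = d" using R.cone_disjoint_depth[of c d N] c d by blast
qed

definition cell where
  "cell N x = (THE c. c \<in> R.arrows \<and> R.depth N c \<and> pull c x \<noteq> x)"

lemma cell:
  assumes "x \<in> D.points"
  shows "cell N x \<in> R.arrows" "R.depth N (cell N x)" "pull (cell N x) x \<noteq> x"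
  using theI'[OF ex1_cell[OF assms, of N]] by (auto simp: cell_def)

lemma cell_unique:
  assumes "x \<in> D.points" "c \<in> R.arrows" "R.depth N c" "pull c x \<noteq> x"
  shows "cell N x = c"
  using ex1_cell[OF assms(1), of N] assms cell[OF assms(1), of N] by blast

lemma cell_nested:
  assumes x: "x \<in> D.points" and "M \<le> N"
  shows "R.cone (cell N x) \<subseteq> R.cone (cell M x)"
proof -
  note c = cell[OF x, of N]
  have "\<And>j. j \<in> J' \<Longrightarrow> M \<le> R.len (cell N x) j" using c(2) assms(2) by (simp add: R.depth_def)
  then obtain d r where d: "d \<in> R.arrows" "R.depth M d" "r \<in> R.words" "cell N x = R.ext d r"
    using R.arrows_split[OF c(1)] by blast
  have sub: "R.cone (cell N x) \<subseteq> R.cone d" using R.cone_ext[OF d(1,3)] d(4) by simp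
  have "cell M x = d"
    using cell_unique[OF x d(1,2)] pull_subset[OF c(1) d(1) sub x c(3)] by blast
  then show ?thesis using sub by simp
qed

definition \<Phi> where
  "\<Phi> x = (SOME y. y \<in> R.points \<and> (\<forall>N. R.cut N y = cell N x))"

lemma \<Phi>:
  assumes x: "x \<in> D.points"
  shows "\<Phi> x \<in> R.points" "R.cut N (\<Phi> x) = cell N x"
proof -
  have "\<exists>y. y \<in> R.points \<and> (\<forall>N. R.cut N y = cell N x)"
  proof -
    obtain y where "y \<in> R.points" "\<And>N. R.cut N y = cell N x"
      using R.nested_cells[of "\<lambda>N. cell N x", OF cell(1,2)[OF x] cell_nested[OF x]] by blast
    then show ?thesis by blast
  qed
  then show "\<Phi> x \<in> R.points" "R.cut N (\<Phi> x) = cell N x"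
    unfolding \<Phi>_def using someI_ex[of "\<lambda>y. y \<in> R.points \<and> (\<forall>N. R.cut N y = cell N x)"] by simp_all
qed

lemma moves_iff:
  assumes \<pi>: "D.involution \<pi>" and x: "x \<in> D.points"
  shows "f \<pi> (\<Phi> x) \<noteq> \<Phi> x \<longleftrightarrow> \<pi> x \<noteq> x"
proof -
  have iR: "R.involution (f \<pi>)" using involution_f \<pi> D.involutionD(1) by blast
  note y = \<Phi>[OF x] and c = cell[OF x]
  have cone: "R.nearby M (\<Phi> x) z \<longleftrightarrow> z \<in> R.cone (cell M x)" for M z
    using R.nearby_cone[OF y(1)] y(2) by simp
  have tw: "z \<in> R.cone (cell M x)" if "z \<in> R.points" "f (pull (cell M x)) z \<noteq> z" for M z
    using that pull(2)[OF c(1)] R.twist_moves[OF c(1)] by simp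
  show ?thesis
  proof (cases "f \<pi> (\<Phi> x) = \<Phi> x")
    case False
    then obtain N where N: "\<And>M z. N \<le> M \<Longrightarrow> R.nearby M (\<Phi> x) z \<Longrightarrow> f \<pi> z \<noteq> z"
      using R.moved_cone[OF iR y(1)] by blast
    have "\<forall>z\<in>R.points. f (pull (cell N x)) z \<noteq> z \<longrightarrow> f \<pi> z \<noteq> z" using N[of N] cone tw by blast
    then have "\<pi> x \<noteq> x" using support_subset[OF \<pi> pull(1)[OF c(1)[of N]]] c(3)[of N] x by blast
    then show ?thesis using False by simp
  next
    case True
    then obtain N where N: "\<And>M z. N \<le> M \<Longrightarrow> R.nearby M (\<Phi> x) z \<Longrightarrow> f \<pi> z = z"
      using R.fixed_nearby[OF iR y(1)] by blast
    have "\<not> (\<exists>z\<in>R.points. f (pull (cell N x)) z \<noteq> z \<and> f \<pi> z \<noteq> z)" using N[of N] cone tw by blast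
    then have "\<pi> x = x" using support_disjoint[OF \<pi> pull(1)[OF c(1)[of N]]] c(3)[of N] x by blast
    then show ?thesis using True by simp
  qed
qed

text \<open>The conjugate of an involution whose support shrinks to \<open>g x\<close> has a support that shrinks to \<open>x\<close>.\<close>

lemma \<Phi>_equivariant:
  assumes g: "g \<in> D.Pref" and x: "x \<in> D.points"
  shows "\<Phi> (g x) = f g (\<Phi> x)"
proof (rule ccontr)
  assume ne: "\<not> ?thesis"
  have gx: "g x \<in> D.points" using D.Pref_points[OF g x] .
  have fg: "f g \<in> R.Pref" using f_Pref[OF g] .
  have y: "f g (\<Phi> x) \<in> R.points" using R.Pref_points[OF fg \<Phi>(1)[OF x]] .
  obtain N where N: "R.cut N (\<Phi> (g x)) \<noteq> R.cut N (f g (\<Phi> x))"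
    using R.points_separate[OF \<Phi>(1)[OF gx] y ne] by blast
  define \<pi> where "\<pi> = pull (cell N (g x))"
  have \<pi>: "D.involution \<pi>" "\<pi> (g x) \<noteq> g x" "f \<pi> = R.twist (cell N (g x))"
    using pull[OF cell(1)[OF gx]] cell(3)[OF gx] by (auto simp: \<pi>_def)
  note pD = D.involutionD[OF \<pi>(1)]
  have ig: "inv\<^bsub>D.G\<^esub> g \<in> D.Pref" using D.G_inv_closed[OF g] .
  define \<rho> where "\<rho> = inv\<^bsub>D.G\<^esub> g \<otimes>\<^bsub>D.G\<^esub> (\<pi> \<otimes>\<^bsub>D.G\<^esub> g)"
  have \<rho>Pref: "\<rho> \<in> D.Pref" using ig pD(1) g by (simp add: \<rho>_def D.G_mult_closed)
  have \<rho>z: "\<rho> z = (inv\<^bsub>D.G\<^esub> g) (\<pi> (g z))" if "z \<in> D.points" for z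
    using ig pD(1) g that by (simp add: \<rho>_def D.G_mult_closed D.G_mult_apply)
  have g\<rho>: "g (\<rho> z) = \<pi> (g z)" if "z \<in> D.points" for z
    using \<rho>z[OF that] D.G_inv_right[OF g] pD(3) D.Pref_points[OF g that] by simp
  have "\<rho> (\<rho> z) = z" if z: "z \<in> D.points" for z
    using \<rho>z[OF D.Pref_points[OF \<rho>Pref z]] g\<rho>[OF z] pD(2) D.Pref_points[OF g z] D.G_inv_left[OF g z] by simp
  then have \<rho>: "D.involution \<rho>" using D.involutionI \<rho>Pref by blast
  have "\<rho> x \<noteq> x" using g\<rho>[OF x] \<pi>(2) by auto
  then have "f \<rho> (\<Phi> x) \<noteq> \<Phi> x" using moves_iff[OF \<rho> x] by simp
  moreover have "g \<otimes>\<^bsub>D.G\<^esub> \<rho> = \<pi> \<otimes>\<^bsub>D.G\<^esub> g"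
    using g\<rho> g \<rho>Pref pD(1) by (intro D.Pref_eqI) (auto simp: D.G_mult_closed D.G_mult_apply)
  then have "f g \<otimes>\<^bsub>R.G\<^esub> f \<rho> = f \<pi> \<otimes>\<^bsub>R.G\<^esub> f g"
    using f_mult[OF g \<rho>Pref] f_mult[OF pD(1) g] by simp
  then have eq: "f g (f \<rho> (\<Phi> x)) = f \<pi> (f g (\<Phi> x))"
    using R.G_mult_apply[OF fg f_Pref[OF \<rho>Pref] \<Phi>(1)[OF x]] R.G_mult_apply[OF f_Pref[OF pD(1)] fg \<Phi>(1)[OF x]] by simp
  moreover have "f \<rho> (\<Phi> x) \<in> R.points" using R.Pref_points[OF f_Pref[OF \<rho>Pref] \<Phi>(1)[OF x]] .
  ultimately have "f \<pi> (f g (\<Phi> x)) \<noteq> f g (\<Phi> x)"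
    using R.Pref_inj[OF fg _ \<Phi>(1)[OF x]] by metis
  then have "f g (\<Phi> x) \<in> R.cone (cell N (g x))"
    using R.twist_moves[OF cell(1)[OF gx] y] \<pi>(3) by simp
  then have "R.cut N (f g (\<Phi> x)) = cell N (g x)" using R.cone_depth[OF cell(1,2)[OF gx]] by blast
  then show False using N \<Phi>(2)[OF gx] by simp
qed

lemma \<Phi>_inj:
  assumes x: "x \<in> D.points" "x' \<in> D.points" and eq: "\<Phi> x = \<Phi> x'"
  shows "x = x'"
proof (rule ccontr)
  assume "x \<noteq> x'"
  then obtain N where N: "D.cut N x \<noteq> D.cut N x'" using D.points_separate[OF x] by blast
  let ?t = "D.twist (D.cut N x)"
  have p: "D.cut N x \<in> D.arrows" using D.cut_arrows[OF x(1)] .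
  have "x' \<notin> D.cone (D.cut N x)" using D.cone_depth[OF p D.depth_cut] N by auto
  then have "?t x' = x'" using D.twist_moves[OF p x(2)] by blast
  moreover have "?t x \<noteq> x" using D.twist_moves[OF p x(1)] D.in_cone_cut[OF x(1)] by blast
  ultimately show False
    using moves_iff[OF D.involution_twist[OF p] x(1)] moves_iff[OF D.involution_twist[OF p] x(2)] eq by simp
qed

end

section \<open>An invariant weight on a slice\<close>

locale odd_word_space = word_space J A V lab flip
  for J :: "nat set" and A :: "nat \<Rightarrow> 'a set" and V lab flip +
  fixes i i' :: nat and m :: nat
  assumes i: "i \<in> J" and i': "i' \<in> J" "i' \<noteq> i" and zero_V: "0 \<in> V"
    and card_A: "card (A i) = 2 * m" and m: "m > 0"
    and lab_odd: "a \<in> A i \<Longrightarrow> lab a = 1"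
begin

definition base :: "nat \<Rightarrow> 'a" where "base j = (SOME a. a \<in> A j)"

text \<open>The words fixed in the coordinates other than \<open>i\<close>. Their period is two, and \<open>a\<close> and \<open>flip a\<close> have equal
  labels. So two prefixes that leave the same tail have lengths of equal parity and equal label sums, which may
  fail for a constant word.\<close>

definition alt :: "nat \<Rightarrow> 'a word" where
  "alt j = (\<lambda>t. if even t then base j else flip (base j))"

definition slice :: "'a word set" where "slice = {w. \<forall>t. w t \<in> A i}"

definition pt :: "'a word \<Rightarrow> bit \<times> (nat \<Rightarrow> 'a word)" where
  "pt w = (0, \<lambda>j\<in>J. if j = i then w else alt j)"

definition blocks :: "nat \<Rightarrow> 'a list set" where
  "blocks N = {u. set u \<subseteq> A i \<and> length u = N}"

text \<open>For \<open>B\<close> determined at depth \<open>N\<close>, these are the cones of depth \<open>N\<close> of the slice that lie in \<open>B\<close>, whatever the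
  tail \<open>alt i\<close>.\<close>

definition heads where
  "heads N B = {u \<in> blocks N. pt (u \<frown> alt i) \<in> B}"

lemma base: "j \<in> J \<Longrightarrow> base j \<in> A j"
  by (simp add: base_def some_in_eq A_nonempty)

lemma alt_A: "j \<in> J \<Longrightarrow> alt j t \<in> A j"
  by (simp add: alt_def base flip_closed)

lemma alt_slice: "alt i \<in> slice" using alt_A i by (simp add: slice_def)

lemma alt_parity: "alt j s = alt j t \<Longrightarrow> even s = even t"
  using flip_neq[of "base j"] by (auto simp: alt_def split: if_splits)

lemma pt_points: "w \<in> slice \<Longrightarrow> pt w \<in> points"
  by (auto simp: pt_def points_def zero_V slice_def alt_A intro!: streamsI)

lemma pt_inj: "pt w = pt w' \<Longrightarrow> w = w'"
proof -
  assume "pt w = pt w'"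
  then have "snd (pt w) i = snd (pt w') i" by simp
  then show ?thesis using i by (simp add: pt_def)
qed

lemma conc_slice: "set u \<subseteq> A i \<Longrightarrow> w \<in> slice \<Longrightarrow> u \<frown> w \<in> slice"
  by (auto simp: slice_def conc_def subset_iff)

lemma cut_pt: "cut N (pt w) = cut N (pt w') \<longleftrightarrow> (\<forall>t<N. w t = w' t)"
  using i by (auto simp: cut_eq_iff pt_def)

lemma finite_blocks: "finite (blocks N)"
  unfolding blocks_def using finite_lists_length_eq[OF finite_A[OF i]] by (simp add: conj_commute)

lemma finite_heads: "finite (heads N B)"
  unfolding heads_def using finite_blocks by simp

lemma slice_split:
  assumes "w \<in> slice"
  shows "prefix N w \<in> blocks N" "suffix N w \<in> slice" "prefix N w \<frown> suffix N w = w"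
  using assms by (auto simp: slice_def blocks_def subsequence_def conc_def fun_eq_iff)

lemma heads_iff:
  assumes "determined N B" "u \<in> blocks N" "w \<in> slice"
  shows "u \<in> heads N B \<longleftrightarrow> pt (u \<frown> w) \<in> B"
proof -
  have "cut N (pt (u \<frown> w)) = cut N (pt (u \<frown> alt i))"
    using assms(2) by (simp add: cut_pt blocks_def)
  moreover have "pt (u \<frown> w) \<in> points" "pt (u \<frown> alt i) \<in> points"
    using assms conc_slice alt_slice pt_points by (auto simp: blocks_def)
  ultimately show ?thesis using assms determinedD[OF assms(1)] by (metis (no_types, lifting) heads_def mem_Collect_eq)
qed

lemma card_heads_Suc:
  assumes "determined N B"
  shows "card (heads (Suc N) B) = 2 * m * card (heads N B)"
proof -
  have "bij_betw (\<lambda>(u, a). u @ [a]) (heads N B \<times> A i) (heads (Suc N) B)"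
  proof (rule bij_betw_imageI)
    show "inj_on (\<lambda>(u, a). u @ [a]) (heads N B \<times> A i)" by (auto simp: inj_on_def)
    have mem: "u @ [a] \<in> heads (Suc N) B \<longleftrightarrow> u \<in> heads N B" if "u \<in> blocks N" "a \<in> A i" for u a
    proof -
      have "u @ [a] \<in> blocks (Suc N)" using that by (simp add: blocks_def)
      moreover have "[a] \<frown> alt i \<in> slice" using conc_slice[of "[a]"] that alt_slice by simp
      ultimately show ?thesis
        using heads_iff[OF assms that(1)] by (simp add: heads_def)
    qed
    show "(\<lambda>(u, a). u @ [a]) ` (heads N B \<times> A i) = heads (Suc N) B"
    proof
      show "(\<lambda>(u, a). u @ [a]) ` (heads N B \<times> A i) \<subseteq> heads (Suc N) B"
      proof clarify
        fix u a assume "u \<in> heads N B" "a \<in> A i"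
        moreover from this have "u \<in> blocks N" by (simp add: heads_def)
        ultimately show "u @ [a] \<in> heads (Suc N) B" using mem by blast
      qed
      show "heads (Suc N) B \<subseteq> (\<lambda>(u, a). u @ [a]) ` (heads N B \<times> A i)"
      proof
        fix v assume v: "v \<in> heads (Suc N) B"
        then have "length v = Suc N" "set v \<subseteq> A i" by (auto simp: heads_def blocks_def)
        then obtain u a where ua: "v = u @ [a]" "u \<in> blocks N" "a \<in> A i"
          by (cases v rule: rev_cases) (auto simp: blocks_def)
        then have "u \<in> heads N B" using mem v by blast
        then show "v \<in> (\<lambda>(u, a). u @ [a]) ` (heads N B \<times> A i)" using ua by force
      qed
    qed
  qed
  then have "card (heads N B \<times> A i) = card (heads (Suc N) B)" by (rule bij_betw_same_card)
  then show ?thesis by (simp add: card_cartesian_product card_A mult.commute)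
qed

text \<open>Modulo \<open>2 * m + 1\<close> any depth that determines \<open>B\<close> gives the same value; the least one is just a choice.\<close>

definition weight where
  "weight B = (let N = (LEAST N. determined N B) in (-1) ^ N * int (card (heads N B)))"

abbreviation wmod :: "int \<Rightarrow> int \<Rightarrow> bool" (infix \<open>\<equiv>\<^sub>w\<close> 50) where
  "x \<equiv>\<^sub>w y \<equiv> [x = y] (mod (2 * int m + 1))"

lemma weight:
  assumes "determined N B"
  shows "weight B \<equiv>\<^sub>w (-1) ^ N * int (card (heads N B))"
proof -
  define L where "L = (LEAST N. determined N B)"
  have L: "determined L B" "L \<le> N" using assms by (auto simp: L_def intro: LeastI Least_le)
  have "(-1) ^ L * int (card (heads L B)) \<equiv>\<^sub>w (-1) ^ N * int (card (heads N B))"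
    using L(2) assms
  proof (induction N rule: dec_induct)
    case base
    show ?case by simp
  next
    case (step n)
    have n: "determined n B" using determined_mono[OF L(1) step(1)] .
    have "(-1) ^ Suc n * int (card (heads (Suc n) B)) = (-1) ^ n * int (card (heads n B)) * (- (2 * int m))"
      using card_heads_Suc[OF n] by simp
    moreover have "- (2 * int m) - 1 = - (2 * int m + 1)" by simp
    then have "2 * int m + 1 dvd - (2 * int m) - 1" by (metis dvd_minus_iff dvd_refl)
    then have "- (2 * int m) \<equiv>\<^sub>w 1" by (simp add: cong_iff_dvd_diff)
    ultimately have *: "(-1) ^ Suc n * int (card (heads (Suc n) B)) \<equiv>\<^sub>w (-1) ^ n * int (card (heads n B)) * 1"
      by (metis cong_scalar_left)
    have "(-1) ^ L * int (card (heads L B)) \<equiv>\<^sub>w (-1) ^ n * int (card (heads n B)) * 1"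
      using step.IH n by simp
    then show ?case using cong_sym[OF *] by (rule cong_trans)
  qed
  then show ?thesis by (simp add: weight_def L_def Let_def)
qed

lemma weight_points: "weight points \<equiv>\<^sub>w 1"
proof -
  have "determined 0 points" by (simp add: determined_def)
  moreover have "heads 0 points = {[]}" using alt_slice pt_points by (auto simp: heads_def blocks_def)
  ultimately show ?thesis using weight[of 0 points] by simp
qed

lemma weight_sum:
  assumes I: "finite I" and Bi: "\<And>e. e \<in> I \<Longrightarrow> \<exists>N. determined N (B e)" and C: "determined M C"
    and un: "\<And>w. w \<in> slice \<Longrightarrow> pt w \<in> C \<longleftrightarrow> (\<exists>e\<in>I. pt w \<in> B e)"
    and dis: "\<And>w e e'. w \<in> slice \<Longrightarrow> e \<in> I \<Longrightarrow> e' \<in> I \<Longrightarrow> pt w \<in> B e \<Longrightarrow> pt w \<in> B e' \<Longrightarrow> e = e'"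
  shows "weight C \<equiv>\<^sub>w (\<Sum>e\<in>I. weight (B e))"
proof -
  obtain n where n: "\<And>e. e \<in> I \<Longrightarrow> determined (n e) (B e)" using Bi by metis
  define N where "N = Max (insert M (n ` I))"
  have N: "determined N (B e)" if "e \<in> I" for e using n[OF that] I that by (intro determined_mono[OF n]) (auto simp: N_def)
  have NC: "determined N C" using I by (intro determined_mono[OF C]) (auto simp: N_def)
  have pts: "u \<frown> alt i \<in> slice" if "u \<in> blocks N" for u using that conc_slice alt_slice by (auto simp: blocks_def)
  have "heads N C = (\<Union>e\<in>I. heads N (B e))" using un pts by (auto simp: heads_def)
  moreover have "heads N (B e) \<inter> heads N (B e') = {}" if "e \<in> I" "e' \<in> I" "e \<noteq> e'" for e e'
    using dis[OF _ that(1,2)] pts that(3) by (auto simp: heads_def)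
  ultimately have "card (heads N C) = (\<Sum>e\<in>I. card (heads N (B e)))"
    using card_UN_disjoint[OF I, of "\<lambda>e. heads N (B e)"] finite_heads by simp
  then have "(-1) ^ N * int (card (heads N C)) = (\<Sum>e\<in>I. (-1) ^ N * int (card (heads N (B e))))"
    by (simp add: sum_distrib_left)
  moreover have "(\<Sum>e\<in>I. (-1) ^ N * int (card (heads N (B e)))) \<equiv>\<^sub>w (\<Sum>e\<in>I. weight (B e))"
    by (rule cong_sum) (rule cong_sym[OF weight[OF N]])
  ultimately have "(-1) ^ N * int (card (heads N C)) \<equiv>\<^sub>w (\<Sum>e\<in>I. weight (B e))" by simp
  with weight[OF NC] show ?thesis by (rule cong_trans)
qed

lemma weight_prefix:
  assumes u: "set u \<subseteq> A i"
  defines "B \<equiv> cone (cut (length u) (pt (u \<frown> alt i)))"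
  shows "determined (length u) B" "weight B \<equiv>\<^sub>w (-1) ^ length u"
    "w \<in> slice \<Longrightarrow> pt w \<in> B \<longleftrightarrow> (\<exists>w'\<in>slice. w = u \<frown> w')"
proof -
  have x: "pt (u \<frown> alt i) \<in> points" using u conc_slice alt_slice pt_points by blast
  have p: "cut (length u) (pt (u \<frown> alt i)) \<in> arrows" using cut_arrows[OF x] .
  show d: "determined (length u) B" unfolding B_def by (rule determined_cone[OF p]) simp
  have mem: "pt w \<in> B \<longleftrightarrow> (\<forall>t<length u. w t = u ! t)" if "w \<in> slice" for w
    unfolding B_def using cone_depth[OF p depth_cut] pt_points[OF that] by (simp add: cut_pt)
  show 3: "pt w \<in> B \<longleftrightarrow> (\<exists>w'\<in>slice. w = u \<frown> w')" if w: "w \<in> slice" for w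
  proof
    assume "pt w \<in> B"
    then have "prefix (length u) w = u" using mem[OF w] by (auto simp: subsequence_def intro: nth_equalityI)
    then show "\<exists>w'\<in>slice. w = u \<frown> w'" using slice_split[OF w, of "length u"] by metis
  next
    assume "\<exists>w'\<in>slice. w = u \<frown> w'"
    then show "pt w \<in> B" using mem[OF w] by auto
  qed
  have "heads (length u) B = {u}"
  proof (intro equalityI subsetI)
    fix v assume v: "v \<in> heads (length u) B"
    then have "length v = length u" "v \<frown> alt i \<in> slice" "pt (v \<frown> alt i) \<in> B"
      using conc_slice alt_slice by (auto simp: heads_def blocks_def)
    then have "v = u" using mem by (auto intro: nth_equalityI)
    then show "v \<in> {u}" by simp
  next
    fix v assume "v \<in> {u}"
    then show "v \<in> heads (length u) B" using u x in_cone_cut[OF x] by (simp add: heads_def blocks_def B_def)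
  qed
  then show "weight B \<equiv>\<^sub>w (-1) ^ length u" using weight[OF d] by simp
qed

lemma sum_list_replicate_bit: "sum_list (replicate n (b :: bit)) = (if even n then 0 else b)"
  by (induction n) (auto simp: add.commute)

lemma labs_slice:
  assumes q: "snd q = (\<lambda>j\<in>J. if j = i then u else prefix (n j) (alt j))" "set u \<subseteq> A i"
  shows "labs (snd q) = (if even (length u) then 0 else 1) + (\<Sum>j\<in>J - {i}. if even (n j) then 0 else lab (base j))"
proof -
  have "map lab u = replicate (length u) 1"
    using q(2) lab_odd by (intro replicate_eqI) auto
  moreover have "map lab (prefix n (alt j)) = replicate n (lab (base j))" for n j
    by (intro replicate_eqI) (auto simp: subsequence_def alt_def lab_flip)
  ultimately have *: "sum_list (map lab (snd q j)) =
      (if j = i then (if even (length u) then 0 else 1) else (if even (n j) then 0 else lab (base j)))"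
    if "j \<in> J" for j using that by (simp add: q(1) sum_list_replicate_bit)
  have "labs (snd q) = sum_list (map lab (snd q i)) + (\<Sum>j\<in>J - {i}. sum_list (map lab (snd q j)))"
    unfolding labs_def by (rule sum.remove[OF finite_J i])
  also have "(\<Sum>j\<in>J - {i}. sum_list (map lab (snd q j))) =
      (\<Sum>j\<in>J - {i}. if even (n j) then 0 else lab (base j))"
    by (rule sum.cong) (auto simp: *)
  finally show ?thesis using *[OF i] by simp
qed

text \<open>The lengths of the prefixes in a coordinate other than \<open>i\<close> have equal parity, hence equal label sums. Equality of the
  targets therefore forces equality of the label sums in coordinate \<open>i\<close>, where each letter counts \<open>1\<close>.\<close>

lemma slice_image:
  assumes h: "h \<in> Pref" and N: "table h N" and u: "u \<in> blocks N"
    and im: "\<And>w. w \<in> slice \<Longrightarrow> \<exists>w'\<in>slice. h (pt (u \<frown> w)) = pt w'"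
  shows "\<exists>v. set v \<subseteq> A i \<and> even (length v) = even N \<and> (\<forall>w\<in>slice. h (pt (u \<frown> w)) = pt (v \<frown> w))"
proof -
  define p where "p = cut N (pt (u \<frown> alt i))"
  have u': "set u \<subseteq> A i" "length u = N" using u by (auto simp: blocks_def)
  have uw: "u \<frown> w \<in> slice" if "w \<in> slice" for w using conc_slice u' that by blast
  have p: "p \<in> arrows" "depth N p" using cut_arrows pt_points uw alt_slice by (auto simp: p_def)
  then obtain q where q: "replaces h p q" using N by (auto simp: table_def)
  then have qa: "q \<in> arrows" "target q = target p" by (auto simp: replaces_def)
  define v where "v = snd q i"
  have v: "set v \<subseteq> A i" using qa(1) wordsD[of "snd q" i] i by (simp add: arrows_def v_def mem_Times_iff)
  have hp: "h (pt (u \<frown> w)) = q \<cdot> rest N (pt (u \<frown> w))" if "w \<in> slice" for w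
  proof -
    have x: "pt (u \<frown> w) \<in> points" using pt_points uw that by blast
    have "cut N (pt (u \<frown> w)) = p" using u' by (simp add: p_def cut_pt)
    then show ?thesis using cut_rest[OF x, of N] replacesD[OF q rest_streams[OF x, of N]] by simp
  qed
  have rest_i: "rest N (pt (u \<frown> w)) i = w" for w using i u' by (auto simp: rest_def pt_def fun_eq_iff)
  have rest_j: "rest N (pt (u \<frown> w)) j = suffix N (alt j)" if "j \<in> J" "j \<noteq> i" for w j
    using that by (simp add: rest_def pt_def)
  obtain w0 where w0: "w0 \<in> slice" "h (pt (u \<frown> alt i)) = pt w0" using im[OF alt_slice] by blast
  have fst_q: "fst q = 0" using hp[OF alt_slice] w0(2) by (simp add: app_def pt_def)
  have qj: "alt j t = (if t < len q j then snd q j ! t else alt j (N + (t - len q j)))"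
    if "j \<in> J" "j \<noteq> i" for j t
    using arg_cong[OF w0(2), of "\<lambda>x. snd x j t"] that hp[OF alt_slice] rest_j[OF that, of "alt i"]
    by (simp add: app_nth) (simp add: pt_def split: if_splits)
  have par: "even (len q j) = even N" if "j \<in> J" "j \<noteq> i" for j
  proof (rule alt_parity)
    show "alt j (len q j) = alt j N" using qj[OF that, of "len q j"] by simp
  qed
  have pre: "snd q j = prefix (len q j) (alt j)" if "j \<in> J" "j \<noteq> i" for j
  proof (rule nth_equalityI)
    fix t assume "t < len q j"
    then show "snd q j ! t = prefix (len q j) (alt j) ! t" using qj[OF that, of t] by (simp add: subsequence_def)
  qed (simp add: subsequence_def)
  have "snd q = (\<lambda>j\<in>J. if j = i then v else prefix (len q j) (alt j))"
    using pre qa(1) by (auto simp: v_def arrows_def words_def PiE_def extensional_def fun_eq_iff)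
  from labs_slice[OF this v]
  have "labs (snd q) = (if even (length v) then 0 else 1) + (\<Sum>j\<in>J - {i}. if even N then 0 else lab (base j))"
    using par by simp
  moreover have "snd p = (\<lambda>j\<in>J. if j = i then u else prefix N (alt j))"
    using u' by (auto simp: p_def cut_def pt_def fun_eq_iff subsequence_def intro: nth_equalityI)
  from labs_slice[OF this u'(1)]
  have "labs (snd p) = (if even N then 0 else 1) + (\<Sum>j\<in>J - {i}. if even N then 0 else lab (base j))"
    using u' by simp
  moreover have "labs (snd q) = labs (snd p)"
    using qa(2) fst_q by (simp add: target_def) (simp add: p_def pt_def)
  ultimately have "even (length v) = even N" by (auto split: if_splits)
  moreover have "h (pt (u \<frown> w)) = pt (v \<frown> w)" if w: "w \<in> slice" for w
  proof -
    have "snd (q \<cdot> rest N (pt (u \<frown> w))) = snd (pt (v \<frown> w))"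
    proof (rule streams_eqI)
      show "snd (q \<cdot> rest N (pt (u \<frown> w))) \<in> streams" "snd (pt (v \<frown> w)) \<in> streams"
        using app_points[OF qa(1) rest_streams[OF pt_points[OF uw[OF w]]]] pt_points[OF conc_slice[OF v w]]
        by (auto simp: points_def mem_Times_iff)
      fix j t assume j: "j \<in> J"
      show "snd (q \<cdot> rest N (pt (u \<frown> w))) j t = snd (pt (v \<frown> w)) j t"
      proof (cases "j = i")
        case True
        then show ?thesis using rest_i i by (simp add: app_nth) (simp add: pt_def conc_def v_def)
      next
        case False
        then show ?thesis using rest_j[OF j False] qj[OF j False, of t] j
          by (simp add: app_nth) (simp add: pt_def)
      qed
    qed
    then show ?thesis using hp[OF w] fst_q by (simp add: prod_eq_iff) (simp add: pt_def)
  qed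
  ultimately show ?thesis using v by blast
qed

text \<open>A prefix replacement maps cones of the slice to cones of the slice whose words have lengths of the same parity.\<close>

theorem weight_invariant:
  assumes h: "h \<in> Pref" and B: "determined N1 B" and E: "determined N2 E"
    and fwd: "\<And>w. w \<in> slice \<Longrightarrow> pt w \<in> B \<Longrightarrow> \<exists>w'\<in>slice. pt w' \<in> E \<and> h (pt w) = pt w'"
    and bwd: "\<And>w'. w' \<in> slice \<Longrightarrow> pt w' \<in> E \<Longrightarrow> \<exists>w\<in>slice. pt w \<in> B \<and> h (pt w) = pt w'"
  shows "weight B \<equiv>\<^sub>w weight E"
proof -
  obtain N0 where N0: "table h N0" using h by (auto simp: Pref_def)
  define N where "N = max N0 N1"
  have N: "table h N" "determined N B" using table_mono[OF N0] determined_mono[OF B] by (auto simp: N_def)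
  have U: "u \<in> blocks N" if "u \<in> heads N B" for u using that by (simp add: heads_def)
  have inB: "pt (u \<frown> w) \<in> B" "u \<frown> w \<in> slice" if "u \<in> heads N B" "w \<in> slice" for u w
    using heads_iff[OF N(2) U[OF that(1)] that(2)] that conc_slice U[OF that(1)] by (auto simp: blocks_def)
  have "\<exists>v. set v \<subseteq> A i \<and> even (length v) = even N \<and> (\<forall>w\<in>slice. h (pt (u \<frown> w)) = pt (v \<frown> w))"
    if "u \<in> heads N B" for u
    by (rule slice_image[OF h N(1) U[OF that]]) (use fwd inB[OF that] in blast)
  then obtain v where v: "\<And>u. u \<in> heads N B \<Longrightarrow> set (v u) \<subseteq> A i"
    "\<And>u. u \<in> heads N B \<Longrightarrow> even (length (v u)) = even N"
    "\<And>u w. u \<in> heads N B \<Longrightarrow> w \<in> slice \<Longrightarrow> h (pt (u \<frown> w)) = pt (v u \<frown> w)" by metis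
  define C where "C u = cone (cut (length (v u)) (pt (v u \<frown> alt i)))" for u
  note Cp = weight_prefix[OF v(1), folded C_def]
  have "weight E \<equiv>\<^sub>w (\<Sum>u\<in>heads N B. weight (C u))"
  proof (rule weight_sum[OF finite_heads _ E])
    show "\<exists>N. determined N (C u)" if "u \<in> heads N B" for u using Cp(1)[OF that] by blast
    fix w' assume w': "w' \<in> slice"
    show "pt w' \<in> E \<longleftrightarrow> (\<exists>u\<in>heads N B. pt w' \<in> C u)"
    proof
      assume "pt w' \<in> E"
      then obtain w where w: "w \<in> slice" "pt w \<in> B" "h (pt w) = pt w'" using bwd w' by blast
      note sp = slice_split[OF w(1), of N]
      have u: "prefix N w \<in> heads N B" using heads_iff[OF N(2) sp(1,2)] sp(3) w(2) by simp
      have "w' = v (prefix N w) \<frown> suffix N w" using v(3)[OF u sp(2)] sp(3) w(3) pt_inj by simp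
      then show "\<exists>u\<in>heads N B. pt w' \<in> C u" using u Cp(3)[OF u w'] sp(2) by blast
    next
      assume "\<exists>u\<in>heads N B. pt w' \<in> C u"
      then obtain u w where u: "u \<in> heads N B" "w \<in> slice" "w' = v u \<frown> w" using Cp(3) w' by blast
      then obtain w'' where "pt w'' \<in> E" "h (pt (u \<frown> w)) = pt w''" using fwd inB by blast
      then show "pt w' \<in> E" using v(3)[OF u(1,2)] u(3) by simp
    qed
    fix u u' assume u: "u \<in> heads N B" "u' \<in> heads N B" "pt w' \<in> C u" "pt w' \<in> C u'"
    then obtain w w2 where w: "w \<in> slice" "w' = v u \<frown> w" "w2 \<in> slice" "w' = v u' \<frown> w2"
      using Cp(3) w' by blast
    then have "h (pt (u \<frown> w)) = h (pt (u' \<frown> w2))" using v(3) u by simp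
    then have "pt (u \<frown> w) = pt (u' \<frown> w2)"
      using Pref_inj[OF h] pt_points inB(2)[OF u(1) w(1)] inB(2)[OF u(2) w(3)] by blast
    then have eq: "u \<frown> w = u' \<frown> w2" by (rule pt_inj)
    have "length u = N" "length u' = N" using U u by (auto simp: blocks_def)
    then show "u = u'" using eq by (metis conc_fst nth_equalityI)
  qed
  also have "(\<Sum>u\<in>heads N B. weight (C u)) \<equiv>\<^sub>w (\<Sum>u\<in>heads N B. (-1) ^ N)"
  proof (rule cong_sum)
    fix u assume u: "u \<in> heads N B"
    have "(-1) ^ length (v u) = ((-1) ^ N :: int)" using v(2)[OF u] by (simp add: minus_one_power_iff)
    then show "weight (C u) \<equiv>\<^sub>w (-1) ^ N" using Cp(2)[OF u] by simp
  qed
  also have "(\<Sum>u\<in>heads N B. (-1) ^ N) = (-1) ^ N * int (card (heads N B))" by simp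
  finally have "weight E \<equiv>\<^sub>w (-1) ^ N * int (card (heads N B))" .
  with weight[OF N(2)] show ?thesis by (rule cong_trans[OF _ cong_sym])
qed

end

section \<open>Fixed points of prefix replacements\<close>

context word_space begin

text \<open>A fixed point of the replacement of \<open>e\<close> by \<open>q\<close> is determined in each coordinate in which the prefixes differ: their
  lengths differ there, and the fixed point equation expresses each letter of the tail by a letter of a prefix or by an
  earlier letter of the tail.\<close>

lemma isolated_fixed_point:
  assumes e: "e \<in> arrows" "depth N e" and q: "q \<in> arrows"
    and ne: "\<And>j. j \<in> J \<Longrightarrow> snd q j \<noteq> snd e j"
    and w: "w \<in> streams" "q \<cdot> w = e \<cdot> w" and w': "w' \<in> streams" "q \<cdot> w' = e \<cdot> w'"
  shows "w = w'"
proof (rule streams_eqI[OF w(1) w'(1)])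
  fix j t assume j: "j \<in> J"
  have len_e: "len e j = N" using e(2) j by (simp add: depth_def)
  define b where "b = len q j"
  have eq: "(if t < b then snd q j ! t else v j (t - b)) = (if t < N then snd e j ! t else v j (t - N))"
    if "q \<cdot> v = e \<cdot> v" for v t
    using arg_cong[OF that, of "\<lambda>x. snd x j t"] j len_e by (simp add: app_nth b_def cong: if_cong)
  have "b \<noteq> N"
  proof
    assume b: "b = N"
    have "snd q j = snd e j"
    proof (rule nth_equalityI)
      fix t assume "t < len q j"
      then show "snd q j ! t = snd e j ! t" using eq[OF w(2), of t] b by (simp add: b_def)
    qed (use b len_e in \<open>simp add: b_def\<close>)
    then show False using ne[OF j] by simp
  qed
  then consider "b < N" | "N < b" by linarith
  then show "w j t = w' j t"
  proof cases
    case 1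
    show ?thesis
    proof (induction t rule: less_induct)
      case (less t)
      have *: "v j t = (if t + b < N then snd e j ! (t + b) else v j (t + b - N))" if "q \<cdot> v = e \<cdot> v" for v
        using eq[OF that, of "t + b"] by simp
      show ?case
      proof (cases "t + b < N")
        case False
        then show ?thesis using *[OF w(2)] *[OF w'(2)] less[of "t + b - N"] 1 by simp
      qed (use *[OF w(2)] *[OF w'(2)] in simp)
    qed
  next
    case 2
    show ?thesis
    proof (induction t rule: less_induct)
      case (less t)
      have *: "v j t = (if t + N < b then snd q j ! (t + N) else v j (t + N - b))" if "q \<cdot> v = e \<cdot> v" for v
        using eq[OF that, of "t + N"] by simp
      show ?case
      proof (cases "t + N < b")
        case False
        then show ?thesis using *[OF w(2)] *[OF w'(2)] less[of "t + N - b"] 2 by simp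
      qed (use *[OF w(2)] *[OF w'(2)] in simp)
    qed
  qed
qed

end

lemma bit_double: "(x :: bit) + x = 0" by (cases x) simp_all

context odd_word_space begin

text \<open>In every coordinate but \<open>i\<close>, the element \<open>g\<close> replaces the first period of \<open>alt\<close> by two periods. A fixed point is then
  periodic in these coordinates and arbitrary in coordinate \<open>i\<close>.\<close>

lemma slice_as_fixed_set:
  obtains g a where "g \<in> Pref" "a \<in> arrows"
    "\<And>x. x \<in> points \<Longrightarrow> x \<in> cone a \<and> g x = x \<longleftrightarrow> (\<exists>w\<in>slice. x = pt w)"
proof -
  define a where "a = (0 :: bit, \<lambda>j\<in>J. if j = i then [] else [base j, flip (base j)])"
  define b where "b = (0 :: bit, \<lambda>j\<in>J. if j = i then [] else [base j, flip (base j), base j, flip (base j)])"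
  \<comment> \<open>an auxiliary cone that differs from the other two in the first letter of coordinate \<open>i'\<close>\<close>
  define q where "q = (0 :: bit, \<lambda>j\<in>J. if j = i' then [flip (base j), base j] else [])"
  have arr: "a \<in> arrows" "b \<in> arrows" "q \<in> arrows"
    by (auto simp: a_def b_def q_def arrows_def words_def zero_V base flip_closed)
  have "target a = 0" "target b = 0" "target q = 0"
    by (auto simp: target_def labs_def a_def b_def q_def lab_flip bit_double add.assoc[symmetric] intro!: sum.neutral)
  then have t: "target a = target q" "target b = target q" by simp_all
  have "cone a \<inter> cone q = {}" "cone b \<inter> cone q = {}"
  proof -
    have "snd x i' 0 = flip (base i')" if "x \<in> cone q" for x
      using that i' cone_iff[OF arr(3), of x] by (auto simp: q_def)
    moreover have "snd x i' 0 = base i'" if "x \<in> cone a \<or> x \<in> cone b" for x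
      using that i' cone_iff[OF arr(1), of x] cone_iff[OF arr(2), of x] by (auto simp: a_def b_def)
    ultimately show "cone a \<inter> cone q = {}" "cone b \<inter> cone q = {}"
      using flip_neq[of "base i'"] by (metis disjoint_iff)+
  qed
  from Pref_shift[OF arr t this] obtain g where g: "g \<in> Pref" "\<And>w. w \<in> streams \<Longrightarrow> g (a \<cdot> w) = b \<cdot> w" by blast
  have len: "len a j = 2" "len b j = 4" if "j \<in> J" "j \<noteq> i" for j using that by (simp_all add: a_def b_def)
  have len_i: "len a i = 0" "len b i = 0" using i by (simp_all add: a_def b_def)
  have nth_a: "snd a j ! t = alt j t" if "j \<in> J" "j \<noteq> i" "t < 2" for j t
    using that by (auto simp: a_def alt_def less_Suc_eq numeral_2_eq_2)
  have nth_b: "snd b j ! t = alt j t" if "j \<in> J" "j \<noteq> i" "t < 4" for j t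
  proof -
    have "t = 0 \<or> t = 1 \<or> t = 2 \<or> t = 3" using that(3) by auto
    then show ?thesis using that(1,2) by (auto simp: b_def alt_def)
  qed
  have "x \<in> cone a \<and> g x = x \<longleftrightarrow> (\<exists>w\<in>slice. x = pt w)" if x: "x \<in> points" for x
  proof
    assume asm: "x \<in> cone a \<and> g x = x"
    then obtain w where w: "w \<in> streams" "x = a \<cdot> w" by (auto simp: cone_def)
    then have xb: "x = b \<cdot> w" using g(2) asm by simp
    have xj: "snd x j t = alt j t" if j: "j \<in> J" "j \<noteq> i" for j t
    proof (induction t rule: less_induct)
      case (less t)
      show ?case
      proof (cases "t < 4")
        case True
        then show ?thesis using arg_cong[OF xb, of "\<lambda>x. snd x j t"] j len nth_b by (simp add: app_nth)
      next
        case False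
        then obtain s where s: "t = s + 4" by (metis add.commute le_Suc_ex not_less)
        have "snd x j (s + 4) = w j s"
          using arg_cong[OF xb, of "\<lambda>x. snd x j (s + 4)"] j len by (simp add: app_nth)
        moreover have "snd x j (s + 2) = w j s"
          using arg_cong[OF w(2), of "\<lambda>x. snd x j (s + 2)"] j len by (simp add: app_nth)
        moreover have "snd x j (s + 2) = alt j (s + 2)" using less[of "s + 2"] s by simp
        ultimately show ?thesis using s by (simp add: alt_def)
      qed
    qed
    have s: "snd x i \<in> slice" using x i by (auto simp: slice_def points_def dest: streamsD)
    have "snd x = snd (pt (snd x i))"
    proof (rule streams_eqI)
      show "snd x \<in> streams" "snd (pt (snd x i)) \<in> streams"
        using x pt_points[OF s] by (auto simp: points_def mem_Times_iff)
      show "snd x j t = snd (pt (snd x i)) j t" if "j \<in> J" for j t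
        using that xj by (auto simp: pt_def)
    qed
    moreover have "fst x = 0" using w(2) by (simp add: app_def a_def)
    ultimately have "x = pt (snd x i)" by (simp add: prod_eq_iff) (simp add: pt_def)
    then show "\<exists>w\<in>slice. x = pt w" using s by blast
  next
    assume "\<exists>w\<in>slice. x = pt w"
    then obtain u where u: "u \<in> slice" "x = pt u" by blast
    have xj: "snd x j t = alt j t" if "j \<in> J" "j \<noteq> i" for j t using that u by (simp add: pt_def)
    have "snd x j t = snd a j ! t" if "j \<in> J" "t < len a j" for j t
      using that xj nth_a len len_i by (cases "j = i") auto
    moreover have "fst x = fst a" using u by (simp add: pt_def a_def)
    ultimately have xa: "x \<in> cone a" using x by (simp add: cone_iff[OF arr(1)])
    then obtain w where w: "w \<in> streams" "x = a \<cdot> w" by (auto simp: cone_def)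
    have wi: "w i t = snd x i t" for t using w(2) i len_i by (simp add: app_nth)
    have wj: "w j t = alt j (t + 2)" if "j \<in> J" "j \<noteq> i" for j t
      using arg_cong[OF w(2), of "\<lambda>x. snd x j (t + 2)"] that len xj by (simp add: app_nth)
    have "snd (b \<cdot> w) = snd x"
    proof (rule streams_eqI)
      show "snd x \<in> streams" "snd (b \<cdot> w) \<in> streams"
        using x app_points[OF arr(2) w(1)] by (auto simp: points_def mem_Times_iff)
      fix j t assume j: "j \<in> J"
      show "snd (b \<cdot> w) j t = snd x j t"
      proof (cases "j = i")
        case True
        then show ?thesis using j wi len_i by (simp add: app_nth)
      next
        case False
        then show ?thesis using j wj nth_b len xj by (cases "t < 4") (auto simp: app_nth alt_def)
      qed
    qed
    moreover have "fst (b \<cdot> w) = fst x" using w(2) by (simp add: a_def b_def)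
    ultimately have "b \<cdot> w = x" by (simp add: prod_eq_iff)
    then show "x \<in> cone a \<and> g x = x" using xa g(2) w by simp
  qed
  then show ?thesis using that g(1) arr(1) by blast
qed

end

text \<open>The isomorphism goes from a group with an invariant weight to one with a single vertex and
  two letters in each alphabet.\<close>

locale odd_binary_iso = word_space_iso J A V lab flip J' A' V' lab' flip' f +
    O: odd_word_space J A V lab flip i i' m
  for J :: "nat set" and A :: "nat \<Rightarrow> 'a set" and V lab flip i i' m
    and J' :: "nat set" and A' :: "nat \<Rightarrow> 'b set" and V' lab' flip' f +
  assumes V': "V' = {0}" and lab': "lab' a = 0"
    and binary: "j \<in> J' \<Longrightarrow> a \<in> A' j \<Longrightarrow> b \<in> A' j \<Longrightarrow> b = a \<or> b = flip' a"
begin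

definition pull_support where
  "pull_support e = {x \<in> D.points. pull e x \<noteq> x}"

lemma pull_support: 
  assumes "e \<in> R.arrows"
  shows "\<exists>N. D.determined N (pull_support e)"
    and "x \<in> D.points \<Longrightarrow> x \<in> pull_support e \<longleftrightarrow> \<Phi> x \<in> R.cone e"
proof -
  note p = pull[OF assms]
  show "\<exists>N. D.determined N (pull_support e)"
    unfolding pull_support_def using D.determined_involution D.involutionD[OF p(1)] by blast
  show "x \<in> pull_support e \<longleftrightarrow> \<Phi> x \<in> R.cone e" if "x \<in> D.points"
    using moves_iff[OF p(1) that] p(2) R.twist_moves[OF assms \<Phi>(1)[OF that]] that
    by (simp add: pull_support_def)
qed

lemma target': "p \<in> R.arrows \<Longrightarrow> R.target p = 0"
  using R.target_V V' by blast

text \<open>Let \<open>q\<close> be the prefix by which the image of \<open>g\<close> replaces \<open>e\<close>. Some coordinate has equal words in \<open>q\<close> and \<open>e\<close>, since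
  otherwise the slice would have an isolated point. Inserting a letter after \<open>e\<close> in this coordinate preserves the fixed
  points, and it is achieved by an element of the group. So each half of the slice part over \<open>e\<close> has the weight of the
  whole part.\<close>

lemma weight_halving:
  assumes g: "g \<in> D.Pref" and a: "a \<in> D.arrows"
    and ga: "\<And>x. x \<in> D.points \<Longrightarrow> x \<in> D.cone a \<and> g x = x \<longleftrightarrow> (\<exists>w\<in>O.slice. x = O.pt w)"
    and N: "R.table (f g) N" "N > 0"
    and e: "e \<in> R.arrows" "R.depth N e"
    and sub: "\<And>y. y \<in> R.cone e \<Longrightarrow> f (D.twist a) y \<noteq> y"
    and w0: "w0 \<in> O.slice" "O.pt w0 \<in> pull_support e"
  shows "[O.weight (pull_support e) = 0] (mod (2 * int m + 1))"
proof -
  have fg: "f g \<in> R.Pref" using f_Pref g by blast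
  have slice_iff: "(\<exists>w\<in>O.slice. x = O.pt w) \<longleftrightarrow> f g (\<Phi> x) = \<Phi> x" if "x \<in> D.points" "\<Phi> x \<in> R.cone e" for x
  proof -
    have "f (D.twist a) (\<Phi> x) \<noteq> \<Phi> x" using sub that by blast
    then have "D.twist a x \<noteq> x" using moves_iff[OF D.involution_twist[OF a] that(1)] by simp
    then have "x \<in> D.cone a" using D.twist_moves[OF a that(1)] by blast
    moreover have "g x = x \<longleftrightarrow> f g (\<Phi> x) = \<Phi> x"
      using \<Phi>_equivariant[OF g that(1)] \<Phi>_inj[OF D.Pref_points[OF g that(1)] that(1)] by auto
    ultimately show ?thesis using ga[OF that(1)] by simp
  qed
  have ptD: "O.pt w \<in> D.points" if "w \<in> O.slice" for w using O.pt_points[OF that] .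
  have pt_fix: "f g (\<Phi> (O.pt w)) = \<Phi> (O.pt w)" if "w \<in> O.slice" "O.pt w \<in> pull_support e" for w
    using slice_iff[OF ptD[OF that(1)]] pull_support(2)[OF e(1) ptD[OF that(1)]] that by blast
  obtain q where q: "R.replaces (f g) e q" using N(1) e by (auto simp: R.table_def)
  then have qa: "q \<in> R.arrows" by (simp add: R.replaces_def)
  have fq: "f g (R.app e z) = R.app q z" if "z \<in> R.streams" for z using R.replacesD[OF q that] .
  have in_e: "\<exists>z\<in>R.streams. \<Phi> (O.pt w) = R.app e z \<and> R.app q z = R.app e z"
    if "w \<in> O.slice" "O.pt w \<in> pull_support e" for w
  proof -
    have "\<Phi> (O.pt w) \<in> R.cone e" using pull_support(2)[OF e(1) ptD[OF that(1)]] that by blast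
    then obtain z where "z \<in> R.streams" "\<Phi> (O.pt w) = R.app e z" by (auto simp: R.cone_def)
    then show ?thesis using pt_fix[OF that] fq by metis
  qed
  obtain j where j: "j \<in> J'" "snd q j = snd e j"
  proof (rule ccontr)
    assume "\<not> thesis"
    then have ne: "\<And>j. j \<in> J' \<Longrightarrow> snd q j \<noteq> snd e j" using that by blast
    obtain M where M: "D.determined M (pull_support e)" using pull_support(1)[OF e(1)] by blast
    define w1 where "w1 = w0(M := flip (w0 M))"
    have w1: "w1 \<in> O.slice" using w0(1) D.flip_closed[OF O.i] by (simp add: w1_def O.slice_def)
    have "D.cut M (O.pt w1) = D.cut M (O.pt w0)" unfolding O.cut_pt by (simp add: w1_def)
    then have w1e: "O.pt w1 \<in> pull_support e"
      using D.determinedD[OF M ptD[OF w0(1)] ptD[OF w1]] w0(2) by simp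
    have "\<Phi> (O.pt w0) = \<Phi> (O.pt w1)"
      using in_e[OF w0] in_e[OF w1 w1e] R.isolated_fixed_point[OF e qa ne] by metis
    then have "O.pt w0 = O.pt w1" using \<Phi>_inj ptD w0(1) w1 by blast
    then have "w0 = w1" by (rule O.pt_inj)
    then show False using D.flip_neq[of "w0 M"] by (simp add: w1_def fun_eq_iff) metis
  qed
  obtain c0 where c0: "c0 \<in> A' j" using R.A_nonempty[OF j(1)] by blast
  define r where "r c = (\<lambda>l\<in>J'. if l = j then [c] else [])" for c :: 'b
  define ec where "ec c = R.ext e (r c)" for c
  have r: "r c \<in> R.words" if "c \<in> A' j" for c using that by (auto simp: r_def R.words_def)
  have ec: "ec c \<in> R.arrows" if "c \<in> A' j" for c using R.ext_arrows e r that by (simp add: ec_def)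
  have ec_sub: "R.cone (ec c) \<subseteq> R.cone e" if "c \<in> A' j" for c
    unfolding ec_def by (rule R.cone_ext[OF e(1) r[OF that]])
  have ec_app: "R.app (ec c) z = R.app e (R.wconc (r c) z)" for c z by (simp add: ec_def R.ext_app)
  have fixed: "R.app q (R.wconc (r c) z) = R.app e (R.wconc (r c) z) \<longleftrightarrow> R.app q z = R.app e z" for c z
  proof -
    have "R.wconc (snd q) (R.wconc (r c) z) l = R.wconc (snd e) (R.wconc (r c) z) l \<longleftrightarrow>
        R.wconc (snd q) z l = R.wconc (snd e) z l" for l
      using j by (cases "l = j") (auto simp: R.wconc_def r_def)
    then show ?thesis by (simp add: R.app_def fun_eq_iff[of "R.wconc _ _"])
  qed
  have half: "[O.weight (pull_support e) = O.weight (pull_support (ec c))] (mod (2 * int m + 1))"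
    if c: "c \<in> A' j" for c
  proof -
    obtain z0 where z0: "z0 \<in> R.streams" by (rule R.streams_nonempty)
    define x1 where "x1 = R.flip_at 0 (R.app e z0)"
    have x1: "x1 \<in> R.points" using R.flip_at_points R.app_points[OF e(1) z0] by (simp add: x1_def)
    define d where "d = R.cut N x1"
    have d: "d \<in> R.arrows" "R.depth N d" using R.cut_arrows[OF x1] by (auto simp: d_def)
    have "R.cut N x1 \<noteq> R.cut N (R.app e z0)"
      using N(2) R.j0 R.flip_neq by (auto simp: R.cut_eq_iff x1_def R.flip_at_def)
    then have "d \<noteq> e" using R.cut_app[OF e(1) z0 e(2)] by (simp add: d_def)
    then have dis: "R.cone e \<inter> R.cone d = {}" using R.cone_disjoint_depth[OF e(1) d(1) e(2) d(2)] by blast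
    then have dis': "R.cone (ec c) \<inter> R.cone d = {}" using ec_sub[OF c] by blast
    obtain h' where h': "h' \<in> R.Pref" "\<And>z. z \<in> R.streams \<Longrightarrow> h' (R.app e z) = R.app (ec c) z"
      using R.Pref_shift[OF e(1) ec[OF c] d(1) _ _ dis dis'] target' e(1) ec[OF c] d(1) by auto
    obtain h where h: "h \<in> D.Pref" "f h = h'" using f_surj[OF h'(1)] by blast
    obtain N1 where N1: "D.determined N1 (pull_support e)" using pull_support(1)[OF e(1)] by blast
    obtain N2 where N2: "D.determined N2 (pull_support (ec c))" using pull_support(1)[OF ec[OF c]] by blast
    show ?thesis
    proof (rule O.weight_invariant[OF h(1) N1 N2])
      fix w assume w: "w \<in> O.slice" "O.pt w \<in> pull_support e"
      obtain z where z: "z \<in> R.streams" "\<Phi> (O.pt w) = R.app e z" "R.app q z = R.app e z"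
        using in_e[OF w] by blast
      define x where "x = h (O.pt w)"
      have x: "x \<in> D.points" using D.Pref_points[OF h(1) ptD[OF w(1)]] by (simp add: x_def)
      have \<Phi>x: "\<Phi> x = R.app (ec c) z"
        using \<Phi>_equivariant[OF h(1) ptD[OF w(1)]] h(2) h'(2)[OF z(1)] z(2) by (simp add: x_def)
      then have xc: "\<Phi> x \<in> R.cone (ec c)" using z(1) by (simp add: R.cone_def)
      have "f g (\<Phi> x) = \<Phi> x"
        using \<Phi>x fq[OF R.wconc_streams[OF r[OF c] z(1)]] fixed[of c z] z(3) by (simp add: ec_app)
      then obtain w' where w': "w' \<in> O.slice" "x = O.pt w'"
        using slice_iff[OF x] xc ec_sub[OF c] by blast
      then show "\<exists>w'\<in>O.slice. O.pt w' \<in> pull_support (ec c) \<and> h (O.pt w) = O.pt w'"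
        using pull_support(2)[OF ec[OF c] x] xc by (auto simp: x_def)
    next
      fix w' assume w': "w' \<in> O.slice" "O.pt w' \<in> pull_support (ec c)"
      have "\<Phi> (O.pt w') \<in> R.cone (ec c)" using pull_support(2)[OF ec[OF c] ptD[OF w'(1)]] w'(2) by blast
      then obtain z where z: "z \<in> R.streams" "\<Phi> (O.pt w') = R.app (ec c) z" by (auto simp: R.cone_def)
      have "\<Phi> (O.pt w') \<in> R.cone e" using z ec_sub[OF c] by (auto simp: R.cone_def)
      then have "f g (\<Phi> (O.pt w')) = \<Phi> (O.pt w')" using slice_iff[OF ptD[OF w'(1)]] w'(1) by blast
      then have qz: "R.app q z = R.app e z"
        using z fq[OF R.wconc_streams[OF r[OF c] z(1)]] fixed[of c z] by (simp add: ec_app)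
      obtain x where x: "x \<in> D.points" "h x = O.pt w'" using D.Pref_surj[OF h(1) ptD[OF w'(1)]] by blast
      have "h' (\<Phi> x) = h' (R.app e z)"
        using \<Phi>_equivariant[OF h(1) x(1)] x(2) z h(2) h'(2)[OF z(1)] by simp
      then have \<Phi>x: "\<Phi> x = R.app e z"
        using R.Pref_inj[OF h'(1) \<Phi>(1)[OF x(1)] R.app_points[OF e(1) z(1)]] by blast
      then have xe: "\<Phi> x \<in> R.cone e" using z(1) by (simp add: R.cone_def)
      have "f g (\<Phi> x) = \<Phi> x" using \<Phi>x fq[OF z(1)] qz by simp
      then obtain w where "w \<in> O.slice" "x = O.pt w" using slice_iff[OF x(1) xe] by blast
      then show "\<exists>w\<in>O.slice. O.pt w \<in> pull_support e \<and> h (O.pt w) = O.pt w'"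
        using pull_support(2)[OF e(1) x(1)] xe x(2) by auto
    qed
  qed
  obtain M where M: "D.determined M (pull_support e)" using pull_support(1)[OF e(1)] by blast
  define I where "I = {c0, flip' c0}"
  have I: "c \<in> A' j" if "c \<in> I" for c using that c0 R.flip_closed[OF j(1)] by (auto simp: I_def)
  have len_e: "R.len e l = N" if "l \<in> J'" for l using e(2) that by (simp add: R.depth_def)
  have coneI: "y \<in> R.cone (ec c) \<longleftrightarrow> y \<in> R.cone e \<and> snd y j N = c" if "c \<in> A' j" for y c
  proof -
    have "snd (ec c) l = snd e l @ (if l = j then [c] else [])" if "l \<in> J'" for l
      using that by (simp add: ec_def R.ext_def r_def)
    moreover have "fst (ec c) = fst e" by (simp add: ec_def)
    ultimately show ?thesis using j(1) len_e
      by (auto simp: R.cone_iff[OF e(1)] R.cone_iff[OF ec[OF \<open>c \<in> A' j\<close>]] nth_append less_Suc_eq split: if_splits)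
  qed
  have "[O.weight (pull_support e) = (\<Sum>c\<in>I. O.weight (pull_support (ec c)))] (mod (2 * int m + 1))"
  proof (rule O.weight_sum[OF _ _ M])
    show "finite I" by (simp add: I_def)
    show "\<exists>N. D.determined N (pull_support (ec c))" if "c \<in> I" for c using pull_support(1) ec I that by blast
    fix w assume w: "w \<in> O.slice"
    note ps = pull_support(2)[OF e(1) ptD[OF w]] pull_support(2)[OF ec ptD[OF w]]
    have "snd (\<Phi> (O.pt w)) j N \<in> A' j"
      using \<Phi>(1)[OF ptD[OF w]] j(1) R.streamsD by (auto simp: R.points_def mem_Times_iff)
    then have "snd (\<Phi> (O.pt w)) j N \<in> I" using binary[OF j(1) c0] by (auto simp: I_def)
    then show "O.pt w \<in> pull_support e \<longleftrightarrow> (\<exists>c\<in>I. O.pt w \<in> pull_support (ec c))"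
      using ps coneI I by auto
    show "c = c'" if "c \<in> I" "c' \<in> I" "O.pt w \<in> pull_support (ec c)" "O.pt w \<in> pull_support (ec c')" for c c'
      using that ps(2) coneI I by auto
  qed
  also have "[(\<Sum>c\<in>I. O.weight (pull_support (ec c))) = (\<Sum>c\<in>I. O.weight (pull_support e))] (mod (2 * int m + 1))"
    by (rule cong_sum) (rule cong_sym[OF half[OF I]])
  also have "(\<Sum>c\<in>I. O.weight (pull_support e)) = O.weight (pull_support e) + O.weight (pull_support e)"
    using R.flip_neq[of c0] by (simp add: I_def)
  finally have "[O.weight (pull_support e) + O.weight (pull_support e) = O.weight (pull_support e) + 0] (mod (2 * int m + 1))"
    by (simp add: cong_sym)
  then show ?thesis using cong_add_lcancel by blast
qed

text \<open>The depth \<open>N\<close> is large enough that a cone of depth \<open>N\<close> is either contained in the image of the support of \<open>twist a\<close> or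
  disjoint from it, and the slice is partitioned by the pulled back cones of the first kind.\<close>

theorem no_iso: False
proof -
  obtain g a where g: "g \<in> D.Pref" "a \<in> D.arrows"
    "\<And>x. x \<in> D.points \<Longrightarrow> x \<in> D.cone a \<and> g x = x \<longleftrightarrow> (\<exists>w\<in>O.slice. x = O.pt w)"
    using O.slice_as_fixed_set by blast
  have T: "R.involution (f (D.twist a))"
    using involution_f[OF D.twist_Pref[OF g(2)]] D.involution_twist[OF g(2)] by blast
  obtain N0 where N0: "R.table (f g) N0" using f_Pref[OF g(1)] by (auto simp: R.Pref_def)
  obtain N1 where N1: "R.determined N1 {y \<in> R.points. f (D.twist a) y \<noteq> y}"
    using R.determined_involution R.involutionD[OF T] by blast
  \<comment> \<open>positive, so that there is a cone disjoint from a given one of this depth\<close>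
  define N where "N = Suc (max N0 N1)"
  have N: "R.table (f g) N" "N > 0" using R.table_mono[OF N0] by (auto simp: N_def)
  have determined: "R.determined N {y \<in> R.points. f (D.twist a) y \<noteq> y}" by (rule R.determined_mono[OF N1]) (simp add: N_def)
  define I where "I = {e \<in> R.arrows. R.depth N e \<and> (\<forall>y\<in>R.cone e. f (D.twist a) y \<noteq> y)}"
  have "finite I" using R.finite_depth[of N] by (rule finite_subset[rotated]) (auto simp: I_def)
  have ptD: "O.pt w \<in> D.points" if "w \<in> O.slice" for w using O.pt_points[OF that] .
  have mod: "[O.weight (pull_support e) = 0] (mod (2 * int m + 1))" if e: "e \<in> I" for e
  proof (cases "\<exists>w\<in>O.slice. O.pt w \<in> pull_support e")
    case True
    then obtain w0 where w0: "w0 \<in> O.slice" "O.pt w0 \<in> pull_support e" by blast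
    show ?thesis by (rule weight_halving[OF g N _ _ _ w0]) (use e in \<open>auto simp: I_def\<close>)
  next
    case False
    obtain M where "D.determined M (pull_support e)" using pull_support(1) e I_def by blast
    from O.weight_sum[of "{}" "\<lambda>_. {}", OF _ _ this] False show ?thesis by auto
  qed
  have "D.determined 0 D.points" by (simp add: D.determined_def)
  then have "[O.weight D.points = (\<Sum>e\<in>I. O.weight (pull_support e))] (mod (2 * int m + 1))"
  proof (rule O.weight_sum[OF \<open>finite I\<close>, rotated])
    show "\<exists>N. D.determined N (pull_support e)" if "e \<in> I" for e using pull_support(1) that by (auto simp: I_def)
    fix w assume w: "w \<in> O.slice"
    note x = ptD[OF w]
    define c where "c = cell N (O.pt w)"
    note c = cell[OF x, of N, folded c_def]
    have "O.pt w \<in> D.cone a" using g(3)[OF x] w by blast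
    then have m: "f (D.twist a) (\<Phi> (O.pt w)) \<noteq> \<Phi> (O.pt w)"
      using moves_iff[OF D.involution_twist[OF g(2)] x] D.twist_moves[OF g(2) x] by simp
    have "f (D.twist a) y \<noteq> y" if "y \<in> R.cone c" for y
    proof -
      have "y \<in> R.points" "R.cut N y = c" using that R.cone_depth[OF c(1,2)] by auto
      then show ?thesis using R.determinedD[OF determined \<Phi>(1)[OF x], of y] \<Phi>(2)[OF x, of N] m \<Phi>(1)[OF x] by (simp add: c_def)
    qed
    then have "c \<in> I" using c by (simp add: I_def)
    then show "O.pt w \<in> D.points \<longleftrightarrow> (\<exists>e\<in>I. O.pt w \<in> pull_support e)"
      using c(3) x by (auto simp: pull_support_def)
    show "e = e'" if "e \<in> I" "e' \<in> I" "O.pt w \<in> pull_support e" "O.pt w \<in> pull_support e'" for e e'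
      using cell_unique[OF x, of e N] cell_unique[OF x, of e' N] that by (auto simp: I_def pull_support_def)
  qed
  also have "[(\<Sum>e\<in>I. O.weight (pull_support e)) = (\<Sum>e\<in>I. 0)] (mod (2 * int m + 1))"
    by (rule cong_sum) (rule mod)
  finally have "[1 = 0] (mod (2 * int m + 1))"
    using O.weight_points cong_sym cong_trans by (metis sum.neutral_const)
  then have "2 * int m + 1 dvd 1" by (simp add: cong_0_iff)
  then show False using O.m by (auto simp: zdvd1_eq)
qed

end

section \<open>Brin--Thompson groups as groups of prefix replacements\<close>

lemma word_space_bool: "0 < n \<Longrightarrow> word_space {..<n} (\<lambda>_. UNIV :: bool set) {0} (\<lambda>_. 0) Not"
  by unfold_locales auto

context
  fixes n :: nat
  assumes n: "0 < n"
begin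

interpretation N: word_space "{..<n}" "\<lambda>_. UNIV :: bool set" "{0}" "\<lambda>_. 0" Not
  by (rule word_space_bool[OF n])

lemma topspace_cantor: "topspace (cantor_power n) = N.streams"
  by (simp add: cantor_power_def N.streams_def topspace_product_topology)

lemma prepend_wconc: "prepend n = N.wconc"
  by (simp add: fun_eq_iff prepend_def N.wconc_def)

lemma N_app: "N.app p z = (fst p, prepend n (snd p) z)"
  by (simp add: N.app_def prepend_wconc)

lemma N_point_iff: "x \<in> N.points \<longleftrightarrow> fst x = 0 \<and> snd x \<in> N.streams"
  by (auto simp: N.points_def mem_Times_iff)

lemma N_target: "p \<in> N.arrows \<Longrightarrow> N.target p = 0"
  using N.target_V by blast

lemma N_fst: "p \<in> N.arrows \<Longrightarrow> fst p = 0"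
  by (auto simp: N.arrows_def)

definition lift_cantor where
  "lift_cantor h = (\<lambda>x\<in>N.points. (0 :: bit, h (snd x)))"

lemma lift_cantor_apply: "z \<in> N.streams \<Longrightarrow> lift_cantor h (0, z) = (0, h z)"
  by (simp add: lift_cantor_def N_point_iff)

lemma lift_cantor_Bij:
  assumes "h \<in> Bij N.streams"
  shows "lift_cantor h \<in> Bij N.points"
proof -
  have h: "inj_on h N.streams" "h ` N.streams = N.streams" using assms by (auto simp: Bij_def bij_betw_def)
  have "N.points = {0} \<times> N.streams" by (auto simp: N.points_def)
  moreover have "inj_on (lift_cantor h) ({0} \<times> N.streams)"
    using h(1) by (auto simp: inj_on_def lift_cantor_apply)
  moreover have "lift_cantor h ` ({0} \<times> N.streams) = {0} \<times> h ` N.streams"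
    by (force simp: lift_cantor_apply image_iff)
  ultimately show ?thesis using h(2) by (simp add: Bij_def bij_betw_def) (simp add: lift_cantor_def)
qed

text \<open>At a depth that exceeds the lengths of all words in the partition, each cone lies in one of its cones.\<close>

lemma lift_cantor_table:
  assumes u: "cone_partition n p u"
    and h: "\<And>k z. k < p \<Longrightarrow> z \<in> N.streams \<Longrightarrow> h (prepend n (u k) z) = prepend n (v k) z"
  shows "\<exists>N. N.table (lift_cantor h) N"
proof -
  define N where "N = Max (insert 0 ((\<lambda>(k, j). length (u k j)) ` ({..<p} \<times> {..<n})))"
  have N: "length (u k j) \<le> N" if "k < p" "j < n" for k j
    unfolding N_def using that by (intro Max_ge) force+
  define uu where "uu k = (0 :: bit, \<lambda>j\<in>{..<n}. u k j)" for k
  define vv where "vv k = (0 :: bit, \<lambda>j\<in>{..<n}. v k j)" for k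
  have arr: "uu k \<in> N.arrows" "vv k \<in> N.arrows" for k
    by (auto simp: uu_def vv_def N.arrows_def N.words_def)
  have app: "N.app (uu k) z = (0, prepend n (u k) z)" "N.app (vv k) z = (0, prepend n (v k) z)" for k z
    by (simp_all add: N_app uu_def vv_def prepend_def restrict_def fun_eq_iff)
  have "N.table (lift_cantor h) N"
    unfolding N.table_def
  proof (intro ballI impI)
    fix c assume c: "c \<in> N.arrows" "N.depth N c"
    obtain z where z: "z \<in> N.streams" by (rule N.streams_nonempty)
    have pt: "N.app c z \<in> N.points" using N.app_points c z by blast
    then have "snd (N.app c z) \<in> (\<Union>k<p. cone n (u k))"
      using u by (simp add: cone_partition_def topspace_cantor N_point_iff)
    then obtain k z' where k: "k < p" "z' \<in> N.streams" "snd (N.app c z) = prepend n (u k) z'"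
      by (auto simp: cone_def topspace_cantor)
    then have eq: "N.app c z = N.app (uu k) z'" using pt by (simp add: app prod_eq_iff N_point_iff)
    have "length (snd (uu k) j) \<le> length (snd c j)" if "j \<in> {..<n}" for j
      using N[OF k(1)] c(2) that by (simp add: uu_def N.depth_def)
    from N.app_split[OF c(1) arr(1) z k(2) eq this]
    obtain s where s: "s \<in> N.words" "c = N.ext (uu k) s" by blast
    have "N.replaces (lift_cantor h) (uu k) (vv k)"
      unfolding N.replaces_def
    proof (intro conjI ballI arr)
      show "N.target (vv k) = N.target (uu k)" using N_target arr by simp
      fix w assume w: "w \<in> N.streams"
      have "prepend n (u k) w \<in> N.streams" using N.app_points[OF arr(1) w, of k] by (simp add: app N_point_iff)
      then show "lift_cantor h (N.app (uu k) w) = N.app (vv k) w"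
        using h[OF k(1) w] by (simp add: app lift_cantor_apply)
    qed
    then have "N.replaces (lift_cantor h) c (N.ext (vv k) s)" using N.replaces_ext s by simp
    then show "\<exists>q. N.replaces (lift_cantor h) c q" ..
  qed
  then show ?thesis ..
qed

lemma openin_agree:
  assumes "z \<in> N.streams"
  shows "openin (cantor_power n) {z' \<in> N.streams. \<forall>j<n. \<forall>t<M. z' j t = z j t}"
proof -
  have "open {w :: bool word. \<forall>t<M. w t = c t}" for c
  proof -
    have "open ((\<lambda>w :: bool word. w t) -` {c t})" for t
      by (intro open_vimage open_discrete continuous_on_product_coordinates)
    then have "open (\<Inter>t\<in>{..<M}. (\<lambda>w :: bool word. w t) -` {c t})" by (intro open_INT) auto
    moreover have "(\<Inter>t\<in>{..<M}. (\<lambda>w :: bool word. w t) -` {c t}) = {w. \<forall>t<M. w t = c t}" by auto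
    ultimately show ?thesis by simp
  qed
  then have "openin (cantor_power n) (\<Pi>\<^sub>E j\<in>{..<n}. {w. \<forall>t<M. w t = z j t})"
    unfolding cantor_power_def by (subst openin_PiE) auto
  moreover have "(\<Pi>\<^sub>E j\<in>{..<n}. {w. \<forall>t<M. w t = z j t}) = {z' \<in> N.streams. \<forall>j<n. \<forall>t<M. z' j t = z j t}"
    by (auto simp: N.streams_def PiE_def Pi_def)
  ultimately show ?thesis by simp
qed

text \<open>A letter of the image depends on finitely many letters only.\<close>

lemma Pref_continuous:
  assumes H: "H \<in> N.Pref"
  shows "continuous_map (cantor_power n) (cantor_power n) (\<lambda>z. snd (H (0, z)))"
proof -
  have Hs: "snd (H (0, z)) \<in> N.streams" if "z \<in> N.streams" for z
    using N.Pref_points[OF H, of "(0, z)"] that by (simp add: N_point_iff)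
  have "continuous_map (cantor_power n) (euclidean :: bool topology) (\<lambda>z. snd (H (0, z)) j t)" if j: "j < n" for j t
    unfolding continuous_map_def topspace_cantor
  proof (intro conjI allI impI)
    fix U :: "bool set"
    show "openin (cantor_power n) {z \<in> N.streams. snd (H (0, z)) j t \<in> U}" (is "openin _ ?B")
    proof (subst openin_subopen, intro ballI)
      fix z assume z: "z \<in> ?B"
      obtain M where M: "\<And>x y. x \<in> N.points \<Longrightarrow> y \<in> N.points \<Longrightarrow> N.cut M x = N.cut M y \<Longrightarrow> N.cut (Suc t) (H x) = N.cut (Suc t) (H y)"
        using N.Pref_uniformly_continuous[OF H, of "Suc t"] by blast
      let ?O = "{z' \<in> N.streams. \<forall>j<n. \<forall>t<M. z' j t = z j t}"
      have "?O \<subseteq> ?B"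
      proof (rule subsetI)
        fix z' assume z': "z' \<in> ?O"
        have "N.cut (Suc t) (H (0, z')) = N.cut (Suc t) (H (0, z))"
          using M[of "(0, z')" "(0, z)"] z z' by (simp add: N_point_iff N.cut_eq_iff)
        then have "snd (H (0, z')) j t = snd (H (0, z)) j t" using j by (simp add: N.cut_eq_iff)
        then show "z' \<in> ?B" using z z' by simp
      qed
      moreover have "openin (cantor_power n) ?O" using openin_agree z by simp
      moreover have "z \<in> ?O" using z by simp
      ultimately show "\<exists>T. openin (cantor_power n) T \<and> z \<in> T \<and> T \<subseteq> ?B" by blast
    qed
  qed auto
  then have "continuous_map (cantor_power n) (euclidean :: bool word topology) (\<lambda>z. snd (H (0, z)) j)" if "j < n" for j
    using that unfolding euclidean_product_topology[symmetric] continuous_map_componentwise_UNIV by blast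
  moreover have "(\<lambda>z. snd (H (0, z))) ` N.streams \<subseteq> extensional {..<n}"
    using Hs by (auto simp: N.streams_def PiE_def)
  ultimately show ?thesis
    unfolding cantor_power_def[of n, THEN arg_cong[of _ _ "\<lambda>Y. continuous_map (cantor_power n) Y _"]]
      continuous_map_componentwise topspace_cantor
    by blast
qed

lemma cone_partition_depth:
  assumes e: "bij_betw e {..<p} {c \<in> N.arrows. N.depth M c}"
  shows "cone_partition n p (\<lambda>k. snd (e k))"
proof -
  have ek: "e k \<in> N.arrows" "N.depth M (e k)" if "k < p" for k
    using e that by (auto simp: bij_betw_def)
  have cone: "z \<in> cone n (snd (e k)) \<longleftrightarrow> z \<in> N.streams \<and> N.cut M (0, z) = e k" if k: "k < p" for k z
  proof -
    have "z \<in> cone n (snd (e k)) \<longleftrightarrow> (0, z) \<in> N.cone (e k)"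
      using N_fst[OF ek(1)[OF k]] by (auto simp: cone_def N.cone_def topspace_cantor N_app)
    then show ?thesis using N.cone_depth[OF ek[OF k]] by (simp add: N_point_iff)
  qed
  have "inj_on e {..<p}" using e by (simp add: bij_betw_def)
  then have "disjoint_family_on (\<lambda>k. cone n (snd (e k))) {..<p}"
    unfolding disjoint_family_on_def using cone by (auto dest: inj_onD)
  moreover have "(\<Union>k<p. cone n (snd (e k))) = N.streams"
  proof
    show "(\<Union>k<p. cone n (snd (e k))) \<subseteq> N.streams" using cone by auto
    show "N.streams \<subseteq> (\<Union>k<p. cone n (snd (e k)))"
    proof
      fix z assume z: "z \<in> N.streams"
      then have "N.cut M (0, z) \<in> {c \<in> N.arrows. N.depth M c}"
        using N.cut_arrows[of "(0, z)"] by (simp add: N_point_iff)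
      then have "N.cut M (0, z) \<in> e ` {..<p}" using e by (simp add: bij_betw_def)
      then obtain k where "k < p" "e k = N.cut M (0, z)" by auto
      then have "z \<in> cone n (snd (e k))" using cone[OF \<open>k < p\<close>, of z] z by simp
      then show "z \<in> (\<Union>k<p. cone n (snd (e k)))" using \<open>k < p\<close> by blast
    qed
  qed
  ultimately show ?thesis by (simp add: cone_partition_def topspace_cantor)
qed

text \<open>The cones of a fixed depth form a partition, and since \<open>H\<close> is bijective their images form one, too.\<close>

lemma Pref_brin_thompson:
  assumes H: "H \<in> N.Pref"
  shows "\<exists>h\<in>carrier (brin_thompson n). lift_cantor h = H"
proof -
  define h where "h = (\<lambda>z\<in>N.streams. snd (H (0, z)))"
  define H' where "H' = inv\<^bsub>N.G\<^esub> H"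
  have H': "H' \<in> N.Pref" using N.G_inv_closed[OF H] by (simp add: H'_def)
  have pt: "(0, z) \<in> N.points" if "z \<in> N.streams" for z using that by (simp add: N_point_iff)
  have Hz: "H (0, z) = (0, snd (H (0, z)))" "snd (H (0, z)) \<in> N.streams" if "z \<in> N.streams" for z
    using N.Pref_points[OF H pt[OF that]] by (auto simp: N_point_iff prod_eq_iff)
  have H'z: "H' (0, z) = (0, snd (H' (0, z)))" "snd (H' (0, z)) \<in> N.streams" if "z \<in> N.streams" for z
    using N.Pref_points[OF H' pt[OF that]] by (auto simp: N_point_iff prod_eq_iff)
  have inv: "snd (H' (0, h z)) = z" "h (snd (H' (0, z))) = z" if "z \<in> N.streams" for z
    using that Hz[OF that] H'z[OF that] N.G_inv_left[OF H pt[OF that]] N.G_inv_right[OF H pt[OF that]]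
    by (simp_all add: h_def H'_def)
  have "homeomorphic_maps (cantor_power n) (cantor_power n) h (\<lambda>z. snd (H' (0, z)))"
    unfolding homeomorphic_maps_def topspace_cantor
  proof (intro conjI ballI)
    show "continuous_map (cantor_power n) (cantor_power n) h"
      by (rule continuous_map_eq[OF Pref_continuous[OF H]]) (simp add: h_def topspace_cantor)
  qed (use inv Pref_continuous[OF H'] in auto)
  then have homeo: "homeomorphic_map (cantor_power n) (cantor_power n) h"
    using homeomorphic_map_maps by blast
  have "bij_betw h N.streams N.streams"
    by (rule bij_betw_byWitness[where f' = "\<lambda>z. snd (H' (0, z))"]) (use inv Hz H'z in \<open>auto simp: h_def\<close>)
  then have bij: "h \<in> Bij N.streams" by (simp add: Bij_def h_def)
  obtain M where M: "N.table H M" using H by (auto simp: N.Pref_def)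
  obtain e where e: "bij_betw e {..<card {c \<in> N.arrows. N.depth M c}} {c \<in> N.arrows. N.depth M c}"
    using ex_bij_betw_nat_finite[OF N.finite_depth[of M]] by (auto simp: atLeast0LessThan)
  define p where "p = card {c \<in> N.arrows. N.depth M c}"
  note e = e[folded p_def]
  have ek: "e k \<in> N.arrows" "N.depth M (e k)" if "k < p" for k
    using e that by (auto simp: bij_betw_def)
  have "\<forall>k<p. \<exists>q. N.replaces H (e k) q" using M ek by (simp add: N.table_def)
  then obtain q where q: "\<And>k. k < p \<Longrightarrow> N.replaces H (e k) (q k)" by metis
  define u where "u k = snd (e k)" for k
  define v where "v k = snd (q k)" for k
  have u: "cone_partition n p u" unfolding u_def by (rule cone_partition_depth[OF e])
  have huv: "h (prepend n (u k) z) = prepend n (v k) z" if k: "k < p" and z: "z \<in> N.streams" for k z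
  proof -
    have 1: "N.app (e k) z = (0, prepend n (u k) z)" using N_fst[OF ek(1)[OF k]] by (simp add: N_app u_def)
    moreover have "N.app (e k) z \<in> N.points" using N.app_points ek k z by blast
    moreover have "H (N.app (e k) z) = N.app (q k) z" using N.replacesD[OF q[OF k] z] .
    ultimately show ?thesis by (simp add: h_def N_point_iff v_def N_app)
  qed
  have cone_v: "cone n (v k) = h ` cone n (u k)" if k: "k < p" for k
    unfolding cone_def topspace_cantor image_image by (rule image_cong) (simp_all add: huv[OF k])
  have "cone_partition n p v"
    unfolding cone_partition_def
  proof
    have inj: "inj_on h N.streams" and img: "h ` N.streams = N.streams"
      using bij by (auto simp: Bij_def bij_betw_def)
    have sub: "cone n (u k) \<subseteq> N.streams" if "k < p" for k
      using u that by (auto simp: cone_partition_def topspace_cantor)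
    show "disjoint_family_on (\<lambda>i. cone n (v i)) {..<p}"
      unfolding disjoint_family_on_def
    proof (intro ballI impI)
      fix k l assume kl: "k \<in> {..<p}" "l \<in> {..<p}" "k \<noteq> l"
      then have "cone n (u k) \<inter> cone n (u l) = {}"
        using u by (auto simp: cone_partition_def disjoint_family_on_def)
      then show "cone n (v k) \<inter> cone n (v l) = {}"
        using kl cone_v inj_on_image_Int[OF inj sub sub, of k l] by auto
    qed
    have "(\<Union>k<p. cone n (v k)) = h ` (\<Union>k<p. cone n (u k))" using cone_v by auto
    then show "(\<Union>k<p. cone n (v k)) = topspace (cantor_power n)"
      using u img by (simp add: cone_partition_def topspace_cantor)
  qed
  then have "\<exists>p u v. cone_partition n p u \<and> cone_partition n p v \<and>
      (\<forall>i<p. \<forall>z\<in>N.streams. h (prepend n (u i) z) = prepend n (v i) z)"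
    using u huv by blast
  then have "h \<in> carrier (brin_thompson n)"
    using bij homeo by (simp add: brin_thompson_def topspace_cantor)
  moreover have "lift_cantor h = H"
  proof (rule extensionalityI[of _ N.points])
    show "H \<in> extensional N.points" using H by (auto simp: N.Pref_def Bij_def)
    fix x assume "x \<in> N.points"
    then show "lift_cantor h x = H x" using Hz[of "snd x"]
      by (cases x) (auto simp: lift_cantor_def N_point_iff h_def)
  qed (simp add: lift_cantor_def)
  ultimately show ?thesis by blast
qed

lemma brin_thompson_iso: "lift_cantor \<in> iso (brin_thompson n) N.G"
proof -
  have car: "h \<in> Bij N.streams" if "h \<in> carrier (brin_thompson n)" for h
    using that by (simp add: brin_thompson_def topspace_cantor)
  have Pref: "lift_cantor h \<in> N.Pref" if h: "h \<in> carrier (brin_thompson n)" for h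
  proof -
    obtain p u v where "cone_partition n p u" "\<forall>i<p. \<forall>z\<in>N.streams. h (prepend n (u i) z) = prepend n (v i) z"
      using h by (auto simp: brin_thompson_def topspace_cantor)
    then have "\<exists>N. N.table (lift_cantor h) N" using lift_cantor_table by blast
    then show ?thesis using lift_cantor_Bij[OF car[OF h]] by (simp add: N.Pref_def)
  qed
  have "lift_cantor (h \<otimes>\<^bsub>brin_thompson n\<^esub> g) = lift_cantor h \<otimes>\<^bsub>N.G\<^esub> lift_cantor g"
    if h: "h \<in> carrier (brin_thompson n)" and g: "g \<in> carrier (brin_thompson n)" for h g
  proof -
    have "h \<otimes>\<^bsub>brin_thompson n\<^esub> g = compose N.streams h g"
      using car[OF h] car[OF g] by (simp add: brin_thompson_def BijGroup_def topspace_cantor)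
    moreover have "g z \<in> N.streams" if "z \<in> N.streams" for z
      using Bij_imp_funcset[OF car[OF g]] that by blast
    ultimately show ?thesis
      unfolding N.G_mult[OF Pref[OF h] Pref[OF g]]
      by (auto simp: fun_eq_iff lift_cantor_def compose_def N_point_iff)
  qed
  then have "lift_cantor \<in> hom (brin_thompson n) N.G" using Pref by (auto simp: hom_def)
  moreover have "inj_on lift_cantor (carrier (brin_thompson n))"
  proof (rule inj_onI)
    fix h g assume h: "h \<in> carrier (brin_thompson n)" "g \<in> carrier (brin_thompson n)"
      and eq: "lift_cantor h = lift_cantor g"
    show "h = g"
    proof (rule extensionalityI[of _ N.streams])
      show "h \<in> extensional N.streams" "g \<in> extensional N.streams" using h car by (auto simp: Bij_def)
      fix z assume "z \<in> N.streams"
      then show "h z = g z" using fun_cong[OF eq, of "(0, z)"] by (simp add: lift_cantor_apply)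
    qed
  qed
  moreover have "lift_cantor ` carrier (brin_thompson n) = N.Pref"
    using Pref Pref_brin_thompson by blast
  ultimately show ?thesis by (simp add: iso_def bij_betw_def)
qed

end

section \<open>The group of a category of words\<close>

text \<open>A category whose arrows are, up to the bijection \<open>nf\<close>, a vertex and a tuple of words, composed by concatenation.\<close>

locale word_category = word_space J A V lab flip
  for J :: "nat set" and A :: "nat \<Rightarrow> 'a set" and V lab flip +
  fixes C :: "('c, 'z) cat_scheme" and nf :: "'c \<Rightarrow> bit \<times> (nat \<Rightarrow> 'a list)"
  assumes nf_bij: "bij_betw nf (Arr C) arrows"
    and Dom: "a \<in> Arr C \<Longrightarrow> Dom C a \<in> Arr C" "a \<in> Arr C \<Longrightarrow> nf (Dom C a) = (target (nf a), \<lambda>j\<in>J. [])"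
    and Cod: "a \<in> Arr C \<Longrightarrow> Cod C a \<in> Arr C" "a \<in> Arr C \<Longrightarrow> nf (Cod C a) = (fst (nf a), \<lambda>j\<in>J. [])"
    and Comp: "a \<in> Arr C \<Longrightarrow> b \<in> Arr C \<Longrightarrow> Dom C a = Cod C b \<Longrightarrow> Comp C a b \<in> Arr C"
      "a \<in> Arr C \<Longrightarrow> b \<in> Arr C \<Longrightarrow> Dom C a = Cod C b \<Longrightarrow> nf (Comp C a b) = nf a \<star> snd (nf b)"
begin

definition arr where "arr p = inv_into (Arr C) nf p"

lemma nf_arrows: "a \<in> Arr C \<Longrightarrow> nf a \<in> arrows"
  using nf_bij by (auto simp: bij_betw_def)

lemma nf_inj: "a \<in> Arr C \<Longrightarrow> b \<in> Arr C \<Longrightarrow> nf a = nf b \<Longrightarrow> a = b"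
  using nf_bij by (auto simp: bij_betw_def dest: inj_onD)

lemma arr: assumes "p \<in> arrows" shows "arr p \<in> Arr C" "nf (arr p) = p"
proof -
  have "p \<in> nf ` Arr C" using nf_bij assms by (simp add: bij_betw_def)
  then show "arr p \<in> Arr C" "nf (arr p) = p"
    unfolding arr_def by (simp_all add: inv_into_into f_inv_into_f)
qed

definition append :: "'c \<Rightarrow> (nat \<Rightarrow> 'a list) \<Rightarrow> 'c" where
  "append a r = arr (nf a \<star> r)"

lemma append: assumes "a \<in> Arr C" "r \<in> words"
  shows "append a r \<in> Arr C" "nf (append a r) = nf a \<star> r"
  using arr[OF ext_arrows[OF nf_arrows[OF assms(1)] assms(2)]] by (simp_all add: append_def)

lemma composable:
  assumes "a \<in> Arr C" "b \<in> Arr C"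
  shows "Dom C a = Cod C b \<longleftrightarrow> target (nf a) = fst (nf b)"
proof
  assume "Dom C a = Cod C b"
  then have "nf (Dom C a) = nf (Cod C b)" by simp
  then show "target (nf a) = fst (nf b)" using assms by (simp add: Dom Cod)
next
  assume "target (nf a) = fst (nf b)"
  then have "nf (Dom C a) = nf (Cod C b)" using assms by (simp add: Dom Cod)
  then show "Dom C a = Cod C b" using nf_inj Dom(1) Cod(1) assms by blast
qed

lemma Comp_append:
  assumes "a \<in> Arr C" "b \<in> Arr C" "Dom C a = Cod C b"
  shows "snd (nf b) \<in> words" "Comp C a b = append a (snd (nf b))"
proof -
  show r: "snd (nf b) \<in> words" using nf_arrows[OF assms(2)] by (auto simp: arrows_def)
  show "Comp C a b = append a (snd (nf b))"
    using nf_inj[OF Comp(1)[OF assms] append(1)[OF assms(1) r]] Comp(2)[OF assms] append(2)[OF assms(1) r] by simp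
qed

lemma append_Comp:
  assumes "a \<in> Arr C" "r \<in> words"
  obtains c where "c \<in> Arr C" "Dom C a = Cod C c" "append a r = Comp C a c" "snd (nf c) = r"
proof -
  have p: "(target (nf a), r) \<in> arrows" using target_V[OF nf_arrows[OF assms(1)]] assms(2) by (simp add: arrows_def)
  note c = arr[OF p]
  have d: "Dom C a = Cod C (arr (target (nf a), r))" using composable[OF assms(1) c(1)] c(2) by simp
  show ?thesis using that[OF c(1) d] Comp_append[OF assms(1) c(1) d] c(2) by simp
qed

lemma set_mult_Arr:
  assumes "X \<subseteq> Arr C"
  shows "set_mult C X (Arr C) = {append x r | x r. x \<in> X \<and> r \<in> words}"
proof
  show "set_mult C X (Arr C) \<subseteq> {append x r | x r. x \<in> X \<and> r \<in> words}"
    using Comp_append assms unfolding set_mult_def by blast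
  show "{append x r | x r. x \<in> X \<and> r \<in> words} \<subseteq> set_mult C X (Arr C)"
  proof clarify
    fix x r assume x: "x \<in> X" "r \<in> words"
    then have "x \<in> Arr C" using assms by blast
    from append_Comp[OF this x(2)] show "append x r \<in> set_mult C X (Arr C)"
      using x unfolding set_mult_def by blast
  qed
qed

lemma words_append: "r \<in> words \<Longrightarrow> s \<in> words \<Longrightarrow> p \<star> r \<star> s = p \<star> (\<lambda>j\<in>J. r j @ s j)"
  by (auto simp: ext_def fun_eq_iff)

lemma append_append:
  assumes "a \<in> Arr C" "r \<in> words" "s \<in> words"
  shows "append (append a r) s = append a (\<lambda>j\<in>J. r j @ s j)"
  using append[OF assms(1,2)] words_append[OF assms(2,3), of "nf a"] by (simp add: append_def)

lemma fg_right_ideal_iff: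
  "fg_right_ideal C R \<longleftrightarrow> (\<exists>X. finite X \<and> X \<subseteq> Arr C \<and> R = {append x r | x r. x \<in> X \<and> r \<in> words})"
proof
  assume "fg_right_ideal C R"
  then obtain X where X: "finite X" "X \<subseteq> Arr C" "R = set_mult C X (Arr C)"
    by (auto simp: fg_right_ideal_def)
  then show "\<exists>X. finite X \<and> X \<subseteq> Arr C \<and> R = {append x r | x r. x \<in> X \<and> r \<in> words}"
    using set_mult_Arr[OF X(2)] by (intro exI[of _ X]) simp
next
  assume "\<exists>X. finite X \<and> X \<subseteq> Arr C \<and> R = {append x r | x r. x \<in> X \<and> r \<in> words}"
  then obtain X where X: "finite X" "X \<subseteq> Arr C" "R = {append x r | x r. x \<in> X \<and> r \<in> words}" by blast
  have sub: "R \<subseteq> Arr C" using X append(1) by auto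
  have "set_mult C R (Arr C) \<subseteq> R"
    unfolding set_mult_Arr[OF sub]
  proof clarify
    fix a s assume a: "a \<in> R" "s \<in> words"
    then obtain x r where x: "x \<in> X" "r \<in> words" "a = append x r" using X by blast
    moreover have "x \<in> Arr C" using x X(2) by blast
    ultimately have "append a s = append x (\<lambda>j\<in>J. r j @ s j)" using append_append a(2) by simp
    moreover have "append x (\<lambda>j\<in>J. r j @ s j) \<in> R" unfolding X(3) using x(1) append_words[OF x(2) a(2)] by blast
    ultimately show "append a s \<in> R" by simp
  qed
  moreover have "R = set_mult C X (Arr C)" using X(3) set_mult_Arr[OF X(2)] by simp
  ultimately show "fg_right_ideal C R"
    unfolding fg_right_ideal_def right_ideal_def using X(1,2) sub by blast
qed

lemma fg_append: "fg_right_ideal C R \<Longrightarrow> a \<in> R \<Longrightarrow> r \<in> words \<Longrightarrow> append a r \<in> R"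
proof -
  assume R: "fg_right_ideal C R" and a: "a \<in> R" "r \<in> words"
  then have sub: "R \<subseteq> Arr C" "set_mult C R (Arr C) \<subseteq> R" by (simp_all add: fg_right_ideal_def right_ideal_def)
  have "append a r \<in> set_mult C R (Arr C)" unfolding set_mult_Arr[OF sub(1)] using a by blast
  then show ?thesis using sub(2) by blast
qed

lemma fg_Arr: "fg_right_ideal C R \<Longrightarrow> R \<subseteq> Arr C"
  by (simp add: fg_right_ideal_def right_ideal_def)

abbreviation "M \<equiv> R_monoid C"

definition equivariant where
  "equivariant \<theta> \<longleftrightarrow> (\<forall>a b. \<theta> a = Some b \<longrightarrow> a \<in> Arr C \<and> b \<in> Arr C \<and> target (nf b) = target (nf a) \<and>
     (\<forall>a'. \<theta> a' = Some b \<longrightarrow> a' = a) \<and> (\<forall>r\<in>words. \<theta> (append a r) = Some (append b r)))"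

lemma equivariantD:
  assumes "equivariant \<theta>" "\<theta> a = Some b"
  shows "a \<in> Arr C" "b \<in> Arr C" "target (nf b) = target (nf a)" "\<theta> a' = Some b \<Longrightarrow> a' = a"
    "r \<in> words \<Longrightarrow> \<theta> (append a r) = Some (append b r)"
  using assms unfolding equivariant_def by blast+

lemma carrier_M:
  "\<theta> \<in> carrier M \<longleftrightarrow> fg_right_ideal C (dom \<theta>) \<and> fg_right_ideal C (ran \<theta>) \<and> equivariant \<theta>"
proof
  assume "\<theta> \<in> carrier M"
  then obtain R1 R2 where R: "fg_right_ideal C R1" "fg_right_ideal C R2" and b: "bij_morphism C R1 R2 \<theta>"
    by (auto simp: R_monoid_def)
  have dom: "dom \<theta> = R1" and bij: "bij_betw (\<lambda>r. the (\<theta> r)) R1 R2" using b by (simp_all add: bij_morphism_def)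
  have "ran \<theta> = (\<lambda>r. the (\<theta> r)) ` R1" using dom by (force simp: ran_def dom_def image_iff)
  then have ran: "ran \<theta> = R2" using bij by (simp add: bij_betw_def)
  have "equivariant \<theta>"
    unfolding equivariant_def
  proof (intro allI impI conjI ballI)
    fix a b' assume ab: "\<theta> a = Some b'"
    then have a: "a \<in> R1" and b': "b' \<in> R2" using dom ran by (auto intro: ranI)
    show a1: "a \<in> Arr C" and b1: "b' \<in> Arr C" using a b' R fg_Arr by auto
    have "Dom C (the (\<theta> a)) = Dom C a" using b a unfolding bij_morphism_def by blast
    then have "Dom C b' = Dom C a" using ab by simp
    then show tg: "target (nf b') = target (nf a)" using Dom(2)[OF a1] Dom(2)[OF b1] by simp
    show "a' = a" if "\<theta> a' = Some b'" for a'
    proof -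
      have "a' \<in> R1" using that dom by auto
      moreover have "the (\<theta> a') = the (\<theta> a)" using that ab by simp
      ultimately show ?thesis using bij a by (auto simp: bij_betw_def dest: inj_onD)
    qed
    fix r assume r: "r \<in> words"
    obtain c where c: "c \<in> Arr C" "Dom C a = Cod C c" "append a r = Comp C a c" "snd (nf c) = r"
      using append_Comp[OF a1 r] by blast
    have "\<theta> (Comp C a c) = Some (Comp C b' c)" using b a c ab by (simp add: bij_morphism_def)
    moreover have "Comp C b' c = append b' r"
      using Comp_append(2)[OF b1 c(1)] c tg composable[OF a1 c(1)] composable[OF b1 c(1)] by simp
    ultimately show "\<theta> (append a r) = Some (append b' r)" using c(3) by simp
  qed
  then show "fg_right_ideal C (dom \<theta>) \<and> fg_right_ideal C (ran \<theta>) \<and> equivariant \<theta>" using R dom ran by simp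
next
  assume R: "fg_right_ideal C (dom \<theta>) \<and> fg_right_ideal C (ran \<theta>) \<and> equivariant \<theta>"
  then have e: "equivariant \<theta>" by blast
  have "bij_morphism C (dom \<theta>) (ran \<theta>) \<theta>"
    unfolding bij_morphism_def
  proof (intro conjI ballI impI)
    show "bij_betw (\<lambda>r. the (\<theta> r)) (dom \<theta>) (ran \<theta>)"
      unfolding bij_betw_def
    proof
      show "inj_on (\<lambda>r. the (\<theta> r)) (dom \<theta>)"
        using equivariantD(4)[OF e] by (auto simp: inj_on_def)
      show "(\<lambda>r. the (\<theta> r)) ` dom \<theta> = ran \<theta>" by (force simp: ran_def dom_def image_iff)
    qed
    fix a assume "a \<in> dom \<theta>"
    then obtain b where b: "\<theta> a = Some b" by blast
    note eD = equivariantD[OF e b]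
    have "nf (Dom C b) = nf (Dom C a)" using eD by (simp add: Dom)
    then have "Dom C b = Dom C a" by (rule nf_inj[OF Dom(1)[OF eD(2)] Dom(1)[OF eD(1)]])
    then show dd: "Dom C (the (\<theta> a)) = Dom C a" using b by simp
    fix c assume c: "c \<in> Arr C" "Dom C a = Cod C c"
    then show "\<theta> (Comp C a c) = Some (Comp C (the (\<theta> a)) c)"
      using eD(5) Comp_append[OF eD(1) c(1)] Comp_append[OF eD(2) c(1)] dd b by simp
  qed simp_all
  then show "\<theta> \<in> carrier M" using R by (auto simp: R_monoid_def)
qed

lemma M_mult [simp]: "\<theta> \<otimes>\<^bsub>M\<^esub> \<phi> = \<theta> \<circ>\<^sub>m \<phi>" by (simp add: R_monoid_def)

lemma M_zero [simp]: "mzero M = Map.empty" by (simp add: R_monoid_def)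

definition pinv :: "('c \<rightharpoonup> 'c) \<Rightarrow> ('c \<rightharpoonup> 'c)" where
  "pinv \<theta> b = (if b \<in> ran \<theta> then Some (SOME a. \<theta> a = Some b) else None)"

lemma pinv_iff:
  assumes "equivariant \<theta>"
  shows "pinv \<theta> b = Some a \<longleftrightarrow> \<theta> a = Some b"
proof
  assume "pinv \<theta> b = Some a"
  then have "b \<in> ran \<theta>" "a = (SOME a. \<theta> a = Some b)" by (auto simp: pinv_def split: if_splits)
  moreover from this obtain a' where "\<theta> a' = Some b" by (auto simp: ran_def)
  then have "\<theta> (SOME a. \<theta> a = Some b) = Some b" by (rule someI)
  ultimately show "\<theta> a = Some b" by simp
next
  assume a: "\<theta> a = Some b"
  have "(SOME a. \<theta> a = Some b) = a"
    by (rule some_equality[where P = "\<lambda>a. \<theta> a = Some b", OF a]) (rule equivariantD(4)[OF assms a])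
  then show "pinv \<theta> b = Some a" using a by (simp add: pinv_def ranI)
qed

lemma pinv_carrier:
  assumes "\<theta> \<in> carrier M"
  shows "pinv \<theta> \<in> carrier M" "dom (pinv \<theta>) = ran \<theta>" "ran (pinv \<theta>) = dom \<theta>"
proof -
  have e: "equivariant \<theta>" using assms carrier_M by blast
  show d: "dom (pinv \<theta>) = ran \<theta>" by (auto simp: pinv_def split: if_splits)
  show r: "ran (pinv \<theta>) = dom \<theta>" using pinv_iff[OF e] by (auto simp: ran_def dom_def)
  have "equivariant (pinv \<theta>)"
    unfolding equivariant_def pinv_iff[OF e]
  proof (intro allI impI conjI ballI)
    fix b a assume a: "\<theta> a = Some b"
    note eD = equivariantD[OF e a]
    show "b \<in> Arr C" "a \<in> Arr C" "target (nf a) = target (nf b)" using eD by simp_all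
    show "a' = b" if "\<theta> a = Some a'" for a' using a that by simp
    show "\<theta> (append a r) = Some (append b r)" if "r \<in> words" for r using eD(5)[OF that] .
  qed
  then show "pinv \<theta> \<in> carrier M" using assms d r by (simp add: carrier_M)
qed

definition id_map :: "'c set \<Rightarrow> ('c \<rightharpoonup> 'c)" where
  "id_map R = (\<lambda>a. if a \<in> R then Some a else None)"

lemma id_map_iff [simp]: "id_map R a = Some b \<longleftrightarrow> a \<in> R \<and> b = a"
  by (auto simp: id_map_def)

lemma id_map_carrier:
  assumes "fg_right_ideal C R"
  shows "id_map R \<in> carrier M"
proof -
  have "dom (id_map R) = R" "ran (id_map R) = R" by (auto simp: dom_def ran_def)
  moreover have "equivariant (id_map R)"
    unfolding equivariant_def using fg_Arr[OF assms] fg_append[OF assms] by auto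
  ultimately show ?thesis using assms by (simp add: carrier_M)
qed

lemma map_eqI:
  assumes "\<And>x y. f x = Some y \<longleftrightarrow> g x = Some y"
  shows "f = g"
proof
  fix x
  show "f x = g x"
  proof (cases "f x")
    case None
    then have "g x \<noteq> Some y" for y using assms[of x y] by simp
    then show ?thesis using None by (metis not_None_eq)
  next
    case (Some y)
    then show ?thesis using assms[of x y] by simp
  qed
qed

end

context word_category begin

text \<open>The defining equations of an inverse determine it, because the partial maps involved are injective.\<close>

lemma sinv_M:
  assumes "\<theta> \<in> carrier M"
  shows "sinv M \<theta> = pinv \<theta>"
proof -
  have e: "equivariant \<theta>" using assms carrier_M by blast
  note inj = equivariantD(4)[OF e]
  show ?thesis
    unfolding sinv_def M_mult
  proof (rule the_equality)
    show "pinv \<theta> \<in> carrier M \<and> \<theta> \<circ>\<^sub>m pinv \<theta> \<circ>\<^sub>m \<theta> = \<theta> \<and> pinv \<theta> \<circ>\<^sub>m \<theta> \<circ>\<^sub>m pinv \<theta> = pinv \<theta>"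
    proof (intro conjI pinv_carrier(1)[OF assms] map_eqI)
      show "(\<theta> \<circ>\<^sub>m pinv \<theta> \<circ>\<^sub>m \<theta>) x = Some y \<longleftrightarrow> \<theta> x = Some y" for x y
        using inj by (auto simp: map_comp_Some_iff pinv_iff[OF e])
      show "(pinv \<theta> \<circ>\<^sub>m \<theta> \<circ>\<^sub>m pinv \<theta>) x = Some y \<longleftrightarrow> pinv \<theta> x = Some y" for x y
        using inj by (auto simp: map_comp_Some_iff pinv_iff[OF e])
    qed
    fix \<phi> assume \<phi>: "\<phi> \<in> carrier M \<and> \<theta> \<circ>\<^sub>m \<phi> \<circ>\<^sub>m \<theta> = \<theta> \<and> \<phi> \<circ>\<^sub>m \<theta> \<circ>\<^sub>m \<phi> = \<phi>"
    then have e': "equivariant \<phi>" using carrier_M by blast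
    show "\<phi> = pinv \<theta>"
    proof (rule map_eqI)
      fix b a
      show "\<phi> b = Some a \<longleftrightarrow> pinv \<theta> b = Some a"
        unfolding pinv_iff[OF e]
      proof
        assume b: "\<phi> b = Some a"
        then have "(\<phi> \<circ>\<^sub>m \<theta> \<circ>\<^sub>m \<phi>) b = Some a" using \<phi> by simp
        then obtain c where "\<theta> a = Some c" "\<phi> c = Some a" using b by (auto simp: map_comp_Some_iff)
        then show "\<theta> a = Some b" using equivariantD(4)[OF e' b, of c] by simp
      next
        assume a: "\<theta> a = Some b"
        then have "(\<theta> \<circ>\<^sub>m \<phi> \<circ>\<^sub>m \<theta>) a = Some b" using \<phi> by simp
        then obtain c where "\<phi> b = Some c" "\<theta> c = Some b" using a by (auto simp: map_comp_Some_iff)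
        then show "\<phi> b = Some a" using inj[OF a, of c] by simp
      qed
    qed
  qed
qed

lemma idempotent_M:
  assumes "e \<in> carrier M" "e \<circ>\<^sub>m e = e"
  shows "e = id_map (dom e)"
proof (rule map_eqI)
  have eq: "equivariant e" using assms carrier_M by blast
  have diag: "b = a" if "e a = Some b" for a b
  proof -
    have "(e \<circ>\<^sub>m e) a = Some b" using assms(2) that by simp
    then have "e b = Some b" using that by (auto simp: map_comp_Some_iff)
    then show ?thesis using equivariantD(4)[OF eq that] by simp
  qed
  show "e a = Some b \<longleftrightarrow> id_map (dom e) a = Some b" for a b
    using diag[of a b] diag[of a] unfolding id_map_iff by (metis domD domI)
qed

text \<open>A right ideal is essential when it meets the principal right ideal of each arrow.\<close>

definition meets where
  "meets R \<longleftrightarrow> (\<forall>b\<in>Arr C. \<exists>r\<in>words. append b r \<in> R)"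

lemma Arr_nonempty: "Arr C \<noteq> {}"
proof -
  obtain v where "v \<in> V" using V_nonempty by blast
  then have "(v, \<lambda>j\<in>J. []) \<in> arrows" by (simp add: arrows_def words_def)
  then show ?thesis using arr(1) by blast
qed

lemma Nil_words: "(\<lambda>j\<in>J. []) \<in> words" by (simp add: words_def)

lemma ext_Nil: "p \<in> arrows \<Longrightarrow> p \<star> (\<lambda>j\<in>J. []) = p"
  by (auto simp: ext_def arrows_def words_def PiE_def extensional_def fun_eq_iff)

lemma append_Nil': "a \<in> Arr C \<Longrightarrow> append a (\<lambda>j\<in>J. []) = a"
  using append[OF _ Nil_words, of a] nf_inj ext_Nil nf_arrows by metis

lemma essential_id_map:
  assumes R: "fg_right_ideal C R"
  shows "essential M (id_map R) \<longleftrightarrow> meets R"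
proof
  assume ess: "essential M (id_map R)"
  show "meets R"
    unfolding meets_def
  proof
    fix b assume b: "b \<in> Arr C"
    define R' where "R' = {append x r | x r. x \<in> {b} \<and> r \<in> words}"
    have R': "fg_right_ideal C R'"
      unfolding fg_right_ideal_iff R'_def using b by (intro exI[of _ "{b}"]) simp
    have bR: "b \<in> R'" unfolding R'_def using append_Nil'[OF b] Nil_words by force
    have "id_map R' \<in> nonzero_idempotents M"
      unfolding nonzero_idempotents_def
    proof (intro CollectI conjI id_map_carrier[OF R'])
      show "id_map R' \<otimes>\<^bsub>M\<^esub> id_map R' = id_map R'" unfolding M_mult by (rule map_eqI) (auto simp: map_comp_Some_iff)
      show "id_map R' \<noteq> mzero M" using bR by (auto simp: id_map_def fun_eq_iff)
    qed
    then have "id_map R \<circ>\<^sub>m id_map R' \<noteq> Map.empty" using ess by (simp add: essential_def)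
    then obtain a where "a \<in> R" "a \<in> R'" by (auto simp: fun_eq_iff map_comp_def id_map_def split: if_splits)
    then show "\<exists>r\<in>words. append b r \<in> R" by (auto simp: R'_def)
  qed
next
  assume m: "meets R"
  have meet: "id_map R \<circ>\<^sub>m f \<noteq> Map.empty" if f: "f \<in> nonzero_idempotents M" for f
  proof -
    have fM: "f \<in> carrier M" "f \<circ>\<^sub>m f = f" "f \<noteq> Map.empty" using f by (auto simp: nonzero_idempotents_def)
    have fid: "f = id_map (dom f)" using idempotent_M fM by blast
    obtain b where b: "b \<in> dom f" using fM(3) by fastforce
    have fg: "fg_right_ideal C (dom f)" using fM(1) carrier_M by blast
    obtain r where r: "r \<in> words" "append b r \<in> R" using m b fg_Arr[OF fg] unfolding meets_def by blast
    have "f (append b r) = Some (append b r)" using fg_append[OF fg b r(1)] fid id_map_iff by metis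
    then have "(id_map R \<circ>\<^sub>m f) (append b r) = Some (append b r)" using r by (simp add: map_comp_Some_iff)
    then show ?thesis by force
  qed
  obtain b where "b \<in> Arr C" using Arr_nonempty by blast
  then obtain a where a: "a \<in> R" using m unfolding meets_def by blast
  have "id_map R \<in> nonzero_idempotents M"
    unfolding nonzero_idempotents_def
  proof (intro CollectI conjI id_map_carrier[OF R])
    show "id_map R \<otimes>\<^bsub>M\<^esub> id_map R = id_map R" unfolding M_mult by (rule map_eqI) (auto simp: map_comp_Some_iff)
    show "id_map R \<noteq> mzero M" using a by (auto simp: id_map_def fun_eq_iff)
  qed
  then show "essential M (id_map R)" using meet by (simp add: essential_def)
qed

lemma ess_part_iff:
  "\<theta> \<in> ess_part M \<longleftrightarrow> \<theta> \<in> carrier M \<and> meets (dom \<theta>) \<and> meets (ran \<theta>)"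
proof (cases "\<theta> \<in> carrier M")
  case True
  then have e: "equivariant \<theta>" and fg: "fg_right_ideal C (dom \<theta>)" "fg_right_ideal C (ran \<theta>)"
    using carrier_M by auto
  have "sinv M \<theta> \<otimes>\<^bsub>M\<^esub> \<theta> = id_map (dom \<theta>)"
    unfolding M_mult sinv_M[OF True] using equivariantD(4)[OF e]
    by (intro map_eqI) (auto simp: map_comp_Some_iff pinv_iff[OF e])
  moreover have "\<theta> \<otimes>\<^bsub>M\<^esub> sinv M \<theta> = id_map (ran \<theta>)"
    unfolding M_mult sinv_M[OF True]
    by (intro map_eqI) (auto simp: map_comp_Some_iff pinv_iff[OF e] ran_def)
  ultimately show ?thesis using True essential_id_map fg by (simp add: ess_part_def)
qed (simp add: ess_part_def)

lemma essD:
  assumes "\<theta> \<in> ess_part M"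
  shows "\<theta> \<in> carrier M" "fg_right_ideal C (dom \<theta>)" "fg_right_ideal C (ran \<theta>)" "equivariant \<theta>"
    "meets (dom \<theta>)" "meets (ran \<theta>)"
  using assms by (simp_all add: ess_part_iff carrier_M)

lemma nat_le_M:
  assumes "z \<in> carrier M"
  shows "nat_le M z s \<longleftrightarrow> (\<forall>a b. z a = Some b \<longrightarrow> s a = Some b)"
proof -
  have e: "equivariant z" using assms carrier_M by blast
  have iff: "(s \<circ>\<^sub>m pinv z \<circ>\<^sub>m z) a = Some b \<longleftrightarrow> a \<in> dom z \<and> s a = Some b" for a b
    using equivariantD(4)[OF e] by (auto simp: map_comp_Some_iff pinv_iff[OF e])
  show ?thesis
    unfolding nat_le_def M_mult sinv_M[OF assms]
  proof
    assume "z = s \<circ>\<^sub>m pinv z \<circ>\<^sub>m z"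
    then have "z a = Some b \<longleftrightarrow> a \<in> dom z \<and> s a = Some b" for a b using iff[of a b] by simp
    then show "\<forall>a b. z a = Some b \<longrightarrow> s a = Some b" by blast
  next
    assume *: "\<forall>a b. z a = Some b \<longrightarrow> s a = Some b"
    show "z = s \<circ>\<^sub>m pinv z \<circ>\<^sub>m z"
    proof (rule map_eqI)
      fix a b
      show "z a = Some b \<longleftrightarrow> (s \<circ>\<^sub>m pinv z \<circ>\<^sub>m z) a = Some b"
        unfolding iff using * by (metis domD domI option.inject)
    qed
  qed
qed

definition deep where
  "deep N = {a \<in> Arr C. \<forall>j\<in>J. N \<le> len (nf a) j}"

lemma deep_append: "a \<in> deep N \<Longrightarrow> r \<in> words \<Longrightarrow> append a r \<in> deep N"
  using append by (auto simp: deep_def)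

lemma deep_split:
  assumes "a \<in> deep N"
  obtains b r where "b \<in> Arr C" "depth N (nf b)" "r \<in> words" "a = append b r"
proof -
  have a: "a \<in> Arr C" "\<And>j. j \<in> J \<Longrightarrow> N \<le> len (nf a) j" using assms by (auto simp: deep_def)
  obtain q r where q: "q \<in> arrows" "depth N q" "r \<in> words" "nf a = q \<star> r"
    using arrows_split[OF nf_arrows[OF a(1)] a(2)] by blast
  have "a = append (arr q) r"
    using nf_inj[OF a(1) append(1)[OF arr(1)[OF q(1)] q(3)]] append(2)[OF arr(1)[OF q(1)] q(3)] arr(2)[OF q(1)] q(4)
    by simp
  then show ?thesis using that arr[OF q(1)] q by metis
qed

lemma finite_depth_Arr: "finite {a \<in> Arr C. depth N (nf a)}"
proof (rule finite_imageD)
  show "finite (nf ` {a \<in> Arr C. depth N (nf a)})"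
    by (rule finite_subset[OF _ finite_depth[of N]]) (auto simp: nf_arrows)
  show "inj_on nf {a \<in> Arr C. depth N (nf a)}" using nf_inj by (auto simp: inj_on_def)
qed

lemma fg_deep: "fg_right_ideal C (deep N)"
  unfolding fg_right_ideal_iff
proof (intro exI[of _ "{a \<in> Arr C. depth N (nf a)}"] conjI finite_depth_Arr)
  show "deep N = {append x r | x r. x \<in> {a \<in> Arr C. depth N (nf a)} \<and> r \<in> words}"
  proof
    show "deep N \<subseteq> {append x r | x r. x \<in> {a \<in> Arr C. depth N (nf a)} \<and> r \<in> words}"
      using deep_split by blast
    show "{append x r | x r. x \<in> {a \<in> Arr C. depth N (nf a)} \<and> r \<in> words} \<subseteq> deep N"
    proof clarify
      fix x r assume "x \<in> Arr C" "depth N (nf x)" "r \<in> words"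
      then show "append x r \<in> deep N" by (intro deep_append) (auto simp: deep_def depth_def)
    qed
  qed
qed auto

lemma meets_deep: "meets (deep N)"
  unfolding meets_def
proof
  fix b assume b: "b \<in> Arr C"
  obtain w where w: "w \<in> streams" by (rule streams_nonempty)
  define x where "x = nf b \<cdot> w"
  have len: "len (nf b) j \<le> max N (max_len (nf b))" if "j \<in> J" for j using len_le_max_len[OF that, of "nf b"] by simp
  obtain r where r: "r \<in> words" "cut (max N (max_len (nf b))) x = nf b \<star> r"
    using cut_extend[OF nf_arrows[OF b] w len] x_def by blast
  have "N \<le> len (nf b \<star> r) j" if "j \<in> J" for j
    using len_cut[OF that, of "max N (max_len (nf b))" x] r(2) by simp
  then have "append b r \<in> deep N" using append[OF b r(1)] by (simp add: deep_def)
  then show "\<exists>r\<in>words. append b r \<in> deep N" using r by blast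
qed

text \<open>Let \<open>a\<close> be at least as long as all generators. Some \<open>append a r\<close> extends a generator, and then already \<open>a\<close> does.\<close>

lemma essential_contains_deep:
  assumes R: "fg_right_ideal C R" and m: "meets R"
  obtains N where "deep N \<subseteq> R"
proof -
  obtain X where X: "finite X" "X \<subseteq> Arr C" "R = {append x r | x r. x \<in> X \<and> r \<in> words}"
    using R unfolding fg_right_ideal_iff by blast
  define N where "N = Max (insert 0 ((\<lambda>x. max_len (nf x)) ` X))"
  have N: "len (nf x) j \<le> N" if "x \<in> X" "j \<in> J" for x j
  proof -
    have "max_len (nf x) \<le> N" unfolding N_def using X(1) that(1) by (intro Max_ge) auto
    then show ?thesis using len_le_max_len[OF that(2), of "nf x"] by simp
  qed
  have "deep N \<subseteq> R"
  proof
    fix a assume a: "a \<in> deep N"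
    then have aA: "a \<in> Arr C" "\<And>j. j \<in> J \<Longrightarrow> N \<le> len (nf a) j" by (auto simp: deep_def)
    obtain r where r: "r \<in> words" "append a r \<in> R" using m aA by (auto simp: meets_def)
    then obtain x s where x: "x \<in> X" "s \<in> words" "append a r = append x s" using X(3) by blast
    have xA: "x \<in> Arr C" using x X by blast
    have eq: "nf a \<star> r = nf x \<star> s" using append(2)[OF aA(1) r(1)] append(2)[OF xA x(2)] x(3) by simp
    obtain w where w: "w \<in> streams" by (rule streams_nonempty)
    have app: "nf a \<cdot> wconc r w = nf x \<cdot> wconc s w" using eq ext_app by metis
    have "len (nf x) j \<le> len (nf a) j" if "j \<in> J" for j using N[OF x(1) that] aA(2)[OF that] by simp
    from app_split[OF nf_arrows[OF aA(1)] nf_arrows[OF xA] wconc_streams[OF r(1) w] wconc_streams[OF x(2) w] app this]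
    obtain t where t: "t \<in> words" "nf a = nf x \<star> t" by blast
    have "a = append x t" using nf_inj[OF aA(1) append(1)[OF xA t(1)]] append(2)[OF xA t(1)] t(2) by simp
    then show "a \<in> R" using X(3) x(1) t(1) by blast
  qed
  then show ?thesis by (rule that)
qed

text \<open>A morphism of essential ideals acts on a point by acting on any prefix of it in its domain; two prefixes have a
  common extension, so the choice does not matter.\<close>

definition act where
  "act \<theta> = (\<lambda>x\<in>points. THE y. \<exists>a b w. \<theta> a = Some b \<and> w \<in> streams \<and> x = nf a \<cdot> w \<and> y = nf b \<cdot> w)"

lemma act_unique:
  assumes e: "equivariant \<theta>" and ab: "\<theta> a = Some b" "\<theta> a' = Some b'"
    and w: "w \<in> streams" "w' \<in> streams" and eq: "nf a \<cdot> w = nf a' \<cdot> w'"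
  shows "nf b \<cdot> w = nf b' \<cdot> w'"
proof -
  note d = equivariantD[OF e ab(1)] and d' = equivariantD[OF e ab(2)]
  define N where "N = max (max_len (nf a)) (max_len (nf a'))"
  have le: "len (nf a) j \<le> N" "len (nf a') j \<le> N" if "j \<in> J" for j
    using len_le_max_len[OF that, of "nf a"] len_le_max_len[OF that, of "nf a'"] by (auto simp: N_def)
  define x where "x = nf a \<cdot> w"
  obtain r where r: "r \<in> words" "cut N x = nf a \<star> r" "w = wconc r (rest N x)"
    using cut_extend[OF nf_arrows[OF d(1)] w(1) le(1)] x_def by blast
  have x': "x = nf a' \<cdot> w'" using eq x_def by simp
  obtain r' where r': "r' \<in> words" "cut N x = nf a' \<star> r'" "w' = wconc r' (rest N x)"
    using cut_extend[OF nf_arrows[OF d'(1)] w(2) le(2)] x' by blast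
  have "append a r = append a' r'" using r(2) r'(2) by (simp add: append_def)
  then have "append b r = append b' r'" using d(5)[OF r(1)] d'(5)[OF r'(1)] by simp
  then have "nf b \<star> r = nf b' \<star> r'" using append(2)[OF d(2) r(1)] append(2)[OF d'(2) r'(1)] by simp
  then show ?thesis using r(3) r'(3) ext_app by metis
qed

lemma act_eq:
  assumes e: "equivariant \<theta>" and ab: "\<theta> a = Some b" and w: "w \<in> streams"
  shows "act \<theta> (nf a \<cdot> w) = nf b \<cdot> w"
proof -
  have "nf a \<cdot> w \<in> points" using app_points nf_arrows equivariantD(1)[OF e ab] w by blast
  moreover have "(THE y. \<exists>a' b' w'. \<theta> a' = Some b' \<and> w' \<in> streams \<and> nf a \<cdot> w = nf a' \<cdot> w' \<and> y = nf b' \<cdot> w') = nf b \<cdot> w"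
  proof (rule the_equality)
    show "\<exists>a' b' w'. \<theta> a' = Some b' \<and> w' \<in> streams \<and> nf a \<cdot> w = nf a' \<cdot> w' \<and> nf b \<cdot> w = nf b' \<cdot> w'"
      using ab w by blast
    fix y assume "\<exists>a' b' w'. \<theta> a' = Some b' \<and> w' \<in> streams \<and> nf a \<cdot> w = nf a' \<cdot> w' \<and> y = nf b' \<cdot> w'"
    then obtain a' b' w' where y: "\<theta> a' = Some b'" "w' \<in> streams" "nf a \<cdot> w = nf a' \<cdot> w'" "y = nf b' \<cdot> w'"
      by blast
    show "y = nf b \<cdot> w" using act_unique[OF e ab y(1) w y(2,3)] y(4) by simp
  qed
  ultimately show ?thesis by (simp add: act_def)
qed

lemma ess_prefix:
  assumes "\<theta> \<in> ess_part M" "x \<in> points"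
  obtains a b w where "\<theta> a = Some b" "w \<in> streams" "x = nf a \<cdot> w"
proof -
  obtain N where N: "deep N \<subseteq> dom \<theta>"
    using essential_contains_deep[OF essD(2,5)[OF assms(1)]] by blast
  note p = arr[OF cut_arrows[OF assms(2), of N]]
  have "arr (cut N x) \<in> deep N" using p by (simp add: deep_def)
  then obtain b where "\<theta> (arr (cut N x)) = Some b" using N by blast
  then show ?thesis using that[of _ b "rest N x"] rest_streams[OF assms(2)] cut_rest[OF assms(2), of N] p by simp
qed

lemma ess_replaces:
  assumes "\<theta> \<in> ess_part M" "\<theta> a = Some b"
  shows "replaces (act \<theta>) (nf a) (nf b)"
  using equivariantD[OF essD(4)[OF assms(1)] assms(2)] act_eq[OF essD(4)[OF assms(1)] assms(2)]
  by (simp add: replaces_def nf_arrows)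

lemma ess_table:
  assumes "\<theta> \<in> ess_part M" "deep N \<subseteq> dom \<theta>"
  shows "table (act \<theta>) N"
  unfolding table_def
proof (intro ballI impI)
  fix p assume p: "p \<in> arrows" "depth N p"
  then have "arr p \<in> deep N" using arr[OF p(1)] by (simp add: deep_def depth_def)
  then obtain b where "\<theta> (arr p) = Some b" using assms(2) by blast
  then have "replaces (act \<theta>) p (nf b)" using ess_replaces[OF assms(1)] arr(2)[OF p(1)] by metis
  then show "\<exists>q. replaces (act \<theta>) p q" ..
qed

lemma ess_deep:
  assumes "\<theta> \<in> ess_part M"
  obtains N where "deep N \<subseteq> dom \<theta>"
  using essential_contains_deep[OF essD(2,5)[OF assms]] .

lemma act_points:
  assumes "\<theta> \<in> ess_part M" "x \<in> points"
  shows "act \<theta> x \<in> points"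
proof -
  obtain a b w where a: "\<theta> a = Some b" "w \<in> streams" "x = nf a \<cdot> w" using ess_prefix[OF assms] by blast
  then show ?thesis using act_eq[OF essD(4)[OF assms(1)] a(1,2)] app_points[OF nf_arrows a(2)]
      equivariantD(2)[OF essD(4)[OF assms(1)] a(1)] by simp
qed

lemma pinv_ess: "\<theta> \<in> ess_part M \<Longrightarrow> pinv \<theta> \<in> ess_part M"
  using pinv_carrier essD unfolding ess_part_iff by simp

lemma act_pinv:
  assumes "\<theta> \<in> ess_part M" "x \<in> points"
  shows "act (pinv \<theta>) (act \<theta> x) = x" "act \<theta> (act (pinv \<theta>) x) = x"
proof -
  note e = essD(4)[OF assms(1)] and e' = essD(4)[OF pinv_ess[OF assms(1)]]
  obtain a b w where a: "\<theta> a = Some b" "w \<in> streams" "x = nf a \<cdot> w" using ess_prefix[OF assms] by blast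
  then have "pinv \<theta> b = Some a" using pinv_iff[OF e] by simp
  then show "act (pinv \<theta>) (act \<theta> x) = x" using act_eq[OF e a(1,2)] act_eq[OF e' _ a(2)] a(3) by simp
  obtain a b w where a: "pinv \<theta> a = Some b" "w \<in> streams" "x = nf a \<cdot> w"
    using ess_prefix[OF pinv_ess[OF assms(1)] assms(2)] by blast
  then have "\<theta> b = Some a" using pinv_iff[OF e] by simp
  then show "act \<theta> (act (pinv \<theta>) x) = x" using act_eq[OF e' a(1,2)] act_eq[OF e _ a(2)] a(3) by simp
qed

lemma act_Pref:
  assumes "\<theta> \<in> ess_part M"
  shows "act \<theta> \<in> Pref"
proof -
  have "bij_betw (act \<theta>) points points"
    by (rule bij_betw_byWitness[where f' = "act (pinv \<theta>)"])
      (use act_pinv[OF assms] act_points[OF assms] act_points[OF pinv_ess[OF assms]] in auto)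
  moreover have "act \<theta> \<in> extensional points" by (simp add: act_def)
  moreover have "\<exists>N. table (act \<theta>) N" using ess_deep[OF assms] ess_table[OF assms] by metis
  ultimately show ?thesis by (simp add: Pref_def Bij_def)
qed

text \<open>The morphism that realises \<open>h\<close> on the ideal of arrows of depth at least \<open>N\<close>.\<close>

definition table_map where
  "table_map h N a = (if a \<in> deep N then Some (arr (THE q. replaces h (nf a) q)) else None)"

lemma replaces_unique: "replaces h p q \<Longrightarrow> replaces h p q' \<Longrightarrow> q = q'"
  by (rule arrow_eqI) (auto simp: replaces_def)

lemma table_map_iff:
  assumes "table h N"
  shows "table_map h N a = Some b \<longleftrightarrow> a \<in> deep N \<and> b \<in> Arr C \<and> replaces h (nf a) (nf b)"
proof (cases "a \<in> deep N")
  case True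
  then have "nf a \<in> arrows" "\<And>j. j \<in> J \<Longrightarrow> N \<le> len (nf a) j" by (auto simp: deep_def nf_arrows)
  then obtain q where q: "replaces h (nf a) q" using table_long[OF assms] by blast
  then have the: "(THE q. replaces h (nf a) q) = q" using replaces_unique by blast
  have "q \<in> arrows" using q by (simp add: replaces_def)
  note aq = arr[OF this]
  show ?thesis
  proof
    assume "table_map h N a = Some b"
    then have "b = arr q" using True the by (simp add: table_map_def)
    then show "a \<in> deep N \<and> b \<in> Arr C \<and> replaces h (nf a) (nf b)" using True aq q by simp
  next
    assume b: "a \<in> deep N \<and> b \<in> Arr C \<and> replaces h (nf a) (nf b)"
    then have "nf b = q" using replaces_unique q by blast
    then have "b = arr q" using nf_inj aq b by simp
    then show "table_map h N a = Some b" using True the by (simp add: table_map_def)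
  qed
qed (simp add: table_map_def)

lemma table_map_total: "table h N \<Longrightarrow> a \<in> deep N \<Longrightarrow> \<exists>b. table_map h N a = Some b"
  by (simp add: table_map_def)

lemma table_map_ess:
  assumes h: "h \<in> Pref" and N: "table h N"
  shows "table_map h N \<in> ess_part M"
proof -
  note iff = table_map_iff[OF N]
  have dom: "dom (table_map h N) = deep N" by (auto simp: table_map_def split: if_splits)
  have e: "equivariant (table_map h N)"
    unfolding equivariant_def
  proof (intro allI impI conjI ballI)
    fix a b assume ab: "table_map h N a = Some b"
    then have a: "a \<in> deep N" "b \<in> Arr C" "replaces h (nf a) (nf b)" using iff by auto
    then show "b \<in> Arr C" "target (nf b) = target (nf a)" by (auto simp: replaces_def)
    show aA: "a \<in> Arr C" using a by (simp add: deep_def)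
    show "a' = a" if "table_map h N a' = Some b" for a'
    proof -
      have a': "a' \<in> Arr C" "replaces h (nf a') (nf b)" using that iff by (auto simp: deep_def)
      have "nf a' = nf a"
      proof (rule arrow_eqI[OF nf_arrows[OF a'(1)] nf_arrows[OF aA]])
        fix w assume w: "w \<in> streams"
        have "h (nf a' \<cdot> w) = h (nf a \<cdot> w)" using replacesD[OF a'(2) w] replacesD[OF a(3) w] by simp
        then show "nf a' \<cdot> w = nf a \<cdot> w"
          using Pref_inj[OF h] app_points nf_arrows aA a'(1) w by blast
      qed
      then show ?thesis using nf_inj aA a'(1) by blast
    qed
    fix r assume r: "r \<in> words"
    show "table_map h N (append a r) = Some (append b r)"
      using iff deep_append[OF a(1) r] append[OF a(2) r] append[OF aA r] replaces_ext[OF a(3) r] by simp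
  qed
  have "fg_right_ideal C (ran (table_map h N))"
    unfolding fg_right_ideal_iff
  proof (intro exI[of _ "(\<lambda>a. the (table_map h N a)) ` {a \<in> Arr C. depth N (nf a)}"] conjI)
    show "finite ((\<lambda>a. the (table_map h N a)) ` {a \<in> Arr C. depth N (nf a)})" using finite_depth_Arr by blast
    have sub: "a \<in> deep N" if "a \<in> Arr C" "depth N (nf a)" for a using that by (auto simp: deep_def depth_def)
    then have val: "\<exists>b. table_map h N a = Some b" if "a \<in> Arr C" "depth N (nf a)" for a
      using table_map_total[OF N] that by blast
    show "(\<lambda>a. the (table_map h N a)) ` {a \<in> Arr C. depth N (nf a)} \<subseteq> Arr C"
      using val iff by fastforce
    show "ran (table_map h N) = {append x r | x r. x \<in> (\<lambda>a. the (table_map h N a)) ` {a \<in> Arr C. depth N (nf a)} \<and> r \<in> words}"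
      (is "_ = ?S")
    proof
      show "ran (table_map h N) \<subseteq> ?S"
      proof
        fix b assume "b \<in> ran (table_map h N)"
        then obtain a where a: "table_map h N a = Some b" by (auto simp: ran_def)
        then have "a \<in> deep N" using iff by blast
        then obtain a0 r where a0: "a0 \<in> Arr C" "depth N (nf a0)" "r \<in> words" "a = append a0 r"
          using deep_split by blast
        obtain b0 where b0: "table_map h N a0 = Some b0" using val a0 by blast
        have "b = append b0 r" using equivariantD(5)[OF e b0 a0(3)] a a0(4) by simp
        moreover have "b0 \<in> (\<lambda>a. the (table_map h N a)) ` {a \<in> Arr C. depth N (nf a)}"
          using a0 b0 by force
        ultimately show "b \<in> ?S" using a0(3) by blast
      qed
      show "?S \<subseteq> ran (table_map h N)"
      proof clarify
        fix a r assume a: "a \<in> Arr C" "depth N (nf a)" "r \<in> words"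
        obtain b where b: "table_map h N a = Some b" using val a by blast
        then show "append (the (table_map h N a)) r \<in> ran (table_map h N)"
          using equivariantD(5)[OF e b a(3)] by (simp add: ranI)
      qed
    qed
  qed
  moreover have "meets (ran (table_map h N))"
    unfolding meets_def
  proof
    fix b assume b: "b \<in> Arr C"
    obtain w where w: "w \<in> streams" by (rule streams_nonempty)
    obtain y where y: "y \<in> points" "h y = nf b \<cdot> w"
      using Pref_surj[OF h app_points[OF nf_arrows[OF b] w]] by blast
    define K where "K = N + max_len (nf b)"
    have c: "cut K y \<in> arrows" using cut_arrows[OF y(1)] .
    have "N \<le> len (cut K y) j" if "j \<in> J" for j using that by (simp add: K_def)
    then obtain p r where p: "p \<in> arrows" "depth N p" "r \<in> words" "cut K y = p \<star> r"
      using arrows_split[OF c] by blast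
    obtain q where q: "replaces h p q" using N p by (auto simp: table_def)
    have rq: "replaces h (cut K y) (q \<star> r)" using replaces_ext[OF q p(3)] p(4) by simp
    have qa: "q \<star> r \<in> arrows" using rq by (simp add: replaces_def)
    have lenr: "length (r j) = max_len (nf b)" if "j \<in> J" for j
      using arg_cong[OF p(4), of "\<lambda>p. len p j"] p(2) that by (simp add: K_def depth_def)
    have le: "len (nf b) j \<le> len (q \<star> r) j" if "j \<in> J" for j
      using len_le_max_len[OF that, of "nf b"] lenr[OF that] that by simp
    have "(q \<star> r) \<cdot> rest K y = nf b \<cdot> w"
      using replacesD[OF rq rest_streams[OF y(1), of K]] cut_rest[OF y(1), of K] y(2) by simp
    from app_split[OF qa nf_arrows[OF b] rest_streams[OF y(1)] w this le]
    obtain s where s: "s \<in> words" "q \<star> r = nf b \<star> s" by blast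
    have "table_map h N (arr (cut K y)) = Some (append b s)"
      unfolding iff using arr[OF c] append[OF b s(1)] rq s(2) by (simp add: deep_def K_def)
    then show "\<exists>r\<in>words. append b r \<in> ran (table_map h N)" using s(1) by (auto intro: ranI)
  qed
  ultimately show ?thesis using e dom fg_deep meets_deep by (simp add: ess_part_iff carrier_M)
qed

lemma act_table_map:
  assumes h: "h \<in> Pref" and N: "table h N"
  shows "act (table_map h N) = h"
proof (rule Pref_eqI[OF act_Pref[OF table_map_ess[OF assms]] h])
  fix x assume x: "x \<in> points"
  note s = table_map_ess[OF assms]
  obtain a b w where a: "table_map h N a = Some b" "w \<in> streams" "x = nf a \<cdot> w" using ess_prefix[OF s x] by blast
  then have "replaces h (nf a) (nf b)" using table_map_iff[OF N] by blast
  then show "act (table_map h N) x = h x" using act_eq[OF essD(4)[OF s] a(1,2)] a replacesD by simp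
qed

lemma table_map_eq_restrict:
  assumes "\<theta> \<in> ess_part M" "deep N \<subseteq> dom \<theta>" "table_map (act \<theta>) N a = Some b"
  shows "\<theta> a = Some b"
proof -
  have ab: "a \<in> deep N" "b \<in> Arr C" "replaces (act \<theta>) (nf a) (nf b)"
    using table_map_iff[OF ess_table[OF assms(1,2)]] assms(3) by auto
  then obtain b' where b': "\<theta> a = Some b'" using assms(2) by blast
  have "nf b' = nf b" using replaces_unique[OF ess_replaces[OF assms(1) b'] ab(3)] .
  then show ?thesis using b' nf_inj ab(2) equivariantD(2)[OF essD(4)[OF assms(1)] b'] by simp
qed

text \<open>Morphisms with the same action agree on a deep ideal, because an arrow is determined by its action.\<close>

lemma sigma_iff:
  assumes s: "s \<in> ess_part M" and t: "t \<in> ess_part M"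
  shows "(s, t) \<in> sigma_ess M \<longleftrightarrow> act s = act t"
proof
  assume "(s, t) \<in> sigma_ess M"
  then obtain z where z: "z \<in> ess_part M" "nat_le M z s" "nat_le M z t" by (auto simp: sigma_ess_def)
  have zc: "z \<in> carrier M" using essD(1)[OF z(1)] .
  show "act s = act t"
  proof (rule Pref_eqI[OF act_Pref[OF s] act_Pref[OF t]])
    fix x assume "x \<in> points"
    then obtain a b w where a: "z a = Some b" "w \<in> streams" "x = nf a \<cdot> w" using ess_prefix[OF z(1)] by blast
    then have "s a = Some b" "t a = Some b" using z nat_le_M[OF zc] by auto
    then show "act s x = act t x"
      using act_eq[OF essD(4)[OF s] _ a(2)] act_eq[OF essD(4)[OF t] _ a(2)] a(3) by simp
  qed
next
  assume eq: "act s = act t"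
  obtain N1 where N1: "deep N1 \<subseteq> dom s" using ess_deep[OF s] by blast
  obtain N2 where N2: "deep N2 \<subseteq> dom t" using ess_deep[OF t] by blast
  define N where "N = max N1 N2"
  have "deep N \<subseteq> deep N1" "deep N \<subseteq> deep N2" by (auto simp: deep_def N_def)
  then have N: "deep N \<subseteq> dom s" "deep N \<subseteq> dom t" using N1 N2 by auto
  define z where "z = table_map (act s) N"
  have z: "z \<in> ess_part M" unfolding z_def by (rule table_map_ess[OF act_Pref[OF s] ess_table[OF s N(1)]])
  then have zc: "z \<in> carrier M" by (rule essD(1))
  have "nat_le M z s" "nat_le M z t"
    using nat_le_M[OF zc] table_map_eq_restrict[OF s N(1)] table_map_eq_restrict[OF t N(2)] eq by (auto simp: z_def)
  then show "(s, t) \<in> sigma_ess M" using s t z by (auto simp: sigma_ess_def)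
qed

text \<open>By the preceding lemma these sets are the elements of the quotient group.\<close>

definition germs where
  "germs h = {s \<in> ess_part M. act s = h}"

lemma sigma_class: "s \<in> ess_part M \<Longrightarrow> sigma_ess M `` {s} = germs (act s)"
  using sigma_iff by (auto simp: germs_def sigma_ess_def)

lemma germs_nonempty:
  assumes "h \<in> Pref" obtains s where "s \<in> ess_part M" "act s = h"
proof -
  obtain N where "table h N" using assms by (auto simp: Pref_def)
  then show ?thesis using that table_map_ess act_table_map assms by blast
qed

lemma act_comp:
  assumes s: "s \<in> ess_part M" and t: "t \<in> ess_part M" and st: "s \<circ>\<^sub>m t \<in> ess_part M"
  shows "act (s \<circ>\<^sub>m t) = act s \<otimes>\<^bsub>G\<^esub> act t"
proof (rule Pref_eqI[OF act_Pref[OF st] G_mult_closed[OF act_Pref[OF s] act_Pref[OF t]]])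
  fix x assume x: "x \<in> points"
  obtain a c w where a: "(s \<circ>\<^sub>m t) a = Some c" "w \<in> streams" "x = nf a \<cdot> w" using ess_prefix[OF st x] by blast
  then obtain b where b: "t a = Some b" "s b = Some c" by (auto simp: map_comp_Some_iff)
  show "act (s \<circ>\<^sub>m t) x = (act s \<otimes>\<^bsub>G\<^esub> act t) x"
    using G_mult_apply[OF act_Pref[OF s] act_Pref[OF t] x] act_eq[OF essD(4)[OF st] a(1,2)]
      act_eq[OF essD(4)[OF t] b(1) a(2)] act_eq[OF essD(4)[OF s] b(2) a(2)] a(3) by simp
qed

text \<open>If the second factor starts deep enough, its values lie in the domain of the first one. The composite is then again
  given by a table, so its domain is visibly a finitely generated ideal.\<close>

lemma table_map_comp:
  assumes h: "h \<in> Pref" "table h N0" and g: "g \<in> Pref" "table g K"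
  shows "table_map h N0 \<circ>\<^sub>m table_map g (K + N0) = table_map (h \<otimes>\<^bsub>G\<^esub> g) (K + N0)"
proof (rule map_eqI)
  have gt: "table g (K + N0)" using table_mono[OF g(2)] by simp
  have hg: "table (h \<otimes>\<^bsub>G\<^esub> g) (K + N0)" using table_comp[OF h(2) g(2)] G_mult[OF h(1) g(1)] by simp
  have comp: "replaces (h \<otimes>\<^bsub>G\<^esub> g) p q'" if "p \<in> arrows" "replaces g p q" "replaces h q q'" for p q q'
    using that G_mult_apply[OF h(1) g(1) app_points[OF that(1)]] by (simp add: replaces_def)
  have long: "b \<in> deep N0" if "table_map g (K + N0) a = Some b" for a b
  proof -
    have ab: "a \<in> deep (K + N0)" "b \<in> Arr C" "replaces g (nf a) (nf b)" using table_map_iff[OF gt] that by auto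
    have aA: "a \<in> Arr C" using ab(1) by (simp add: deep_def)
    have "K \<le> len (nf a) j" if "j \<in> J" for j using ab(1) that by (force simp: deep_def)
    from arrows_split[OF nf_arrows[OF aA] this]
    obtain p r where p: "p \<in> arrows" "depth K p" "r \<in> words" "nf a = p \<star> r" by blast
    obtain q where q: "replaces g p q" using g(2) p by (auto simp: table_def)
    have "nf b = q \<star> r" using replaces_unique[OF ab(3)] replaces_ext[OF q p(3)] p(4) by simp
    moreover have "N0 \<le> length (r j)" if "j \<in> J" for j
    proof -
      have "K + N0 \<le> len (nf a) j" using ab(1) that by (simp add: deep_def)
      then show ?thesis using p(2,4) that by (simp add: depth_def)
    qed
    ultimately show ?thesis using ab(2) by (auto simp: deep_def intro: trans_le_add2)
  qed
  fix a c
  show "(table_map h N0 \<circ>\<^sub>m table_map g (K + N0)) a = Some c \<longleftrightarrow> table_map (h \<otimes>\<^bsub>G\<^esub> g) (K + N0) a = Some c"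
  proof
    assume "(table_map h N0 \<circ>\<^sub>m table_map g (K + N0)) a = Some c"
    then obtain b where b: "table_map g (K + N0) a = Some b" "table_map h N0 b = Some c" by (auto simp: map_comp_Some_iff)
    then have "a \<in> deep (K + N0)" "replaces g (nf a) (nf b)" "replaces h (nf b) (nf c)" "c \<in> Arr C"
      using table_map_iff[OF gt] table_map_iff[OF h(2)] by auto
    then show "table_map (h \<otimes>\<^bsub>G\<^esub> g) (K + N0) a = Some c"
      using table_map_iff[OF hg] comp[of "nf a"] nf_arrows by (auto simp: deep_def)
  next
    assume ac: "table_map (h \<otimes>\<^bsub>G\<^esub> g) (K + N0) a = Some c"
    then have a: "a \<in> deep (K + N0)" "replaces (h \<otimes>\<^bsub>G\<^esub> g) (nf a) (nf c)" "c \<in> Arr C" using table_map_iff[OF hg] by auto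
    obtain b where b: "table_map g (K + N0) a = Some b" using table_map_total[OF gt a(1)] by blast
    obtain c' where c': "table_map h N0 b = Some c'" using table_map_total[OF h(2) long[OF b]] by blast
    have "replaces (h \<otimes>\<^bsub>G\<^esub> g) (nf a) (nf c')"
      using comp[of "nf a" "nf b" "nf c'"] b c' a(1) nf_arrows table_map_iff[OF gt] table_map_iff[OF h(2)]
      by (auto simp: deep_def)
    then have "nf c' = nf c" using replaces_unique a(2) by blast
    then have "c' = c" using nf_inj a(3) c' table_map_iff[OF h(2)] by blast
    then show "(table_map h N0 \<circ>\<^sub>m table_map g (K + N0)) a = Some c" using b c' by (simp add: map_comp_Some_iff)
  qed
qed

theorem germs_iso: "germs \<in> iso G (G_group C)"
proof -
  have car: "carrier (G_group C) = germs ` Pref"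
  proof -
    have "carrier (G_group C) = (\<lambda>s. sigma_ess M `` {s}) ` ess_part M"
      by (auto simp: G_group_def ess_quotient_def quotient_def)
    also have "\<dots> = (\<lambda>s. germs (act s)) ` ess_part M" by (rule image_cong) (auto simp: sigma_class)
    also have "\<dots> = germs ` Pref"
    proof
      show "(\<lambda>s. germs (act s)) ` ess_part M \<subseteq> germs ` Pref" using act_Pref by blast
      show "germs ` Pref \<subseteq> (\<lambda>s. germs (act s)) ` ess_part M" using germs_nonempty by blast
    qed
    finally show ?thesis .
  qed
  have inj: "inj_on germs Pref"
  proof (rule inj_onI)
    fix h h' assume h: "h \<in> Pref" "h' \<in> Pref" "germs h = germs h'"
    obtain s where "s \<in> ess_part M" "act s = h" using germs_nonempty[OF h(1)] by blast
    then show "h = h'" using h(3) by (auto simp: germs_def)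
  qed
  have mult: "germs (h \<otimes>\<^bsub>G\<^esub> g) = germs h \<otimes>\<^bsub>G_group C\<^esub> germs g" if h: "h \<in> Pref" and g: "g \<in> Pref" for h g
  proof -
    have "germs h \<otimes>\<^bsub>G_group C\<^esub> germs g = (\<Union>a\<in>germs h. \<Union>b\<in>germs g. sigma_ess M `` {a \<circ>\<^sub>m b})"
      by (simp add: G_group_def ess_quotient_def)
    also have "\<dots> = germs (h \<otimes>\<^bsub>G\<^esub> g)"
    proof
      show "(\<Union>a\<in>germs h. \<Union>b\<in>germs g. sigma_ess M `` {a \<circ>\<^sub>m b}) \<subseteq> germs (h \<otimes>\<^bsub>G\<^esub> g)"
      proof clarify
        fix a b s assume a: "a \<in> germs h" and b: "b \<in> germs g" and s: "(a \<circ>\<^sub>m b, s) \<in> sigma_ess M"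
        then have ess: "a \<circ>\<^sub>m b \<in> ess_part M" "s \<in> ess_part M" by (auto simp: sigma_ess_def)
        have "act s = act (a \<circ>\<^sub>m b)" using sigma_iff[OF ess] s by simp
        also have "\<dots> = h \<otimes>\<^bsub>G\<^esub> g" using act_comp[of a b] ess a b by (simp add: germs_def)
        finally show "s \<in> germs (h \<otimes>\<^bsub>G\<^esub> g)" using ess by (simp add: germs_def)
      qed
      obtain N0 where N0: "table h N0" using h by (auto simp: Pref_def)
      obtain K where K: "table g K" using g by (auto simp: Pref_def)
      have gt: "table g (K + N0)" using table_mono[OF K] by simp
      have hg: "table (h \<otimes>\<^bsub>G\<^esub> g) (K + N0)" using table_comp[OF N0 K] G_mult[OF h g] by simp
      note hgP = G_mult_closed[OF h g]
      \<comment> \<open>The product of classes is a union over all representatives, so one well chosen pair suffices.\<close>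
      have 1: "table_map h N0 \<in> germs h" "table_map g (K + N0) \<in> germs g"
        using table_map_ess[OF h N0] act_table_map[OF h N0] table_map_ess[OF g gt] act_table_map[OF g gt] by (auto simp: germs_def)
      have "sigma_ess M `` {table_map h N0 \<circ>\<^sub>m table_map g (K + N0)} = germs (h \<otimes>\<^bsub>G\<^esub> g)"
        unfolding table_map_comp[OF h N0 g K] using sigma_class[OF table_map_ess[OF hgP hg]] act_table_map[OF hgP hg] by simp
      then show "germs (h \<otimes>\<^bsub>G\<^esub> g) \<subseteq> (\<Union>a\<in>germs h. \<Union>b\<in>germs g. sigma_ess M `` {a \<circ>\<^sub>m b})"
        using 1 by blast
    qed
    finally show ?thesis by simp
  qed
  show ?thesis
    unfolding iso_def hom_def using car inj mult by (auto simp: bij_betw_def)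
qed

end

section \<open>The k-graphs of a labelling\<close>

fun bar_flip :: "'x letter \<Rightarrow> 'x letter" where
  "bar_flip (Pos x) = Bar x"
| "bar_flip (Bar x) = Pos x"

lemma bar_flip: "letter_base (bar_flip y) = letter_base y" "bar_flip y \<noteq> y" "bar_flip (bar_flip y) = y"
  by (cases y; simp)+

text \<open>Keeps the interval of colours in the form \<open>{1..k}\<close>.\<close>

declare One_nat_def [simp del]

locale labelled_alphabets =
  fixes k :: nat and X :: "nat \<Rightarrow> 'x set" and l :: "'x \<Rightarrow> bit"
  assumes k: "2 \<le> k" and X: "i \<in> {1..k} \<Longrightarrow> finite (X i)" "i \<in> {1..k} \<Longrightarrow> X i \<noteq> {}"
    and disj: "disjoint_family_on X {1..k}"
begin

definition alphabet :: "nat \<Rightarrow> 'x letter set" where "alphabet j = {y. letter_base y \<in> X j}"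

definition shift :: "'x letter \<Rightarrow> bit" where "shift y = l (letter_base y)"

lemma alphabet_eq: "alphabet j = Pos ` X j \<union> Bar ` X j"
proof (intro equalityI subsetI)
  fix y assume "y \<in> alphabet j"
  then show "y \<in> Pos ` X j \<union> Bar ` X j" by (cases y) (auto simp: alphabet_def)
qed (auto simp: alphabet_def)

sublocale word_space "{1..k}" alphabet UNIV shift bar_flip
proof
  fix j assume j: "j \<in> {1..k}"
  show "finite (alphabet j)" "alphabet j \<noteq> {}" using X[OF j] by (auto simp: alphabet_eq)
  show "bar_flip a \<in> alphabet j" if "a \<in> alphabet j" for a using that by (simp add: alphabet_def bar_flip)
qed (use k in \<open>auto simp: bar_flip shift_def\<close>)

abbreviation "E \<equiv> label_graph k X l"
abbreviation "F \<equiv> free_cat E"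
abbreviation "Q \<equiv> cat_congruence F (label_rel k X l)"
abbreviation "letters \<equiv> \<Union>j\<in>{1..k}. alphabet j"

text \<open>The only edge with a given letter and a given range.\<close>

fun edge :: "bit \<Rightarrow> 'x letter \<Rightarrow> 'x edge" where
  "edge v (Pos x) = (Pos x, v)"
| "edge v (Bar x) = (Bar x, v + l x)"

fun path_of :: "bit \<Rightarrow> 'x letter list \<Rightarrow> 'x edge list" where
  "path_of v [] = []"
| "path_of v (y # ys) = edge v y # path_of (v + shift y) ys"

lemma fst_edge [simp]: "fst (edge v y) = y" by (cases y) auto

lemma bit_cancel: "(a :: bit) + b + b = a" by (simp add: add.assoc bit_double)

lemma edge_rng_edge: "edge_rng l (edge v y) = v"
  by (cases y) (auto simp: bit_cancel)

lemma edge_src_edge: "edge_src l (edge v y) = v + shift y"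
  by (cases y) (auto simp: shift_def)

lemma edge_of_rng: "edge (edge_rng l e) (fst e) = e"
proof (cases e)
  case (Pair y t)
  then show ?thesis by (cases y) (auto simp: bit_cancel)
qed

lemma edges_E: "e \<in> edges E \<longleftrightarrow> fst e \<in> letters"
  by (auto simp: label_graph_def edges_of_colour_def alphabet_def)

lemma graph_simps: "verts E = UNIV" "rng E = edge_rng l" "src E = edge_src l"
  by (simp_all add: label_graph_def)

lemma map_fst_path_of [simp]: "map fst (path_of v ys) = ys"
  by (induction ys arbitrary: v) auto

lemma is_path_iff: "is_path E v es \<longleftrightarrow> fst ` set es \<subseteq> letters \<and> es = path_of v (map fst es)"
proof (induction es arbitrary: v)
  case (Cons e es)
  have "e = edge v (fst e) \<longleftrightarrow> edge_rng l e = v" using edge_of_rng[of e] edge_rng_edge[of v "fst e"] by metis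
  moreover have "edge_src l e = v + shift (fst e)" if "e = edge v (fst e)" using edge_src_edge[of v "fst e"] that by simp
  ultimately show ?case using Cons by (auto simp: graph_simps edges_E)
qed (simp add: graph_simps)

lemma path_src_path_of: "path_src E v (path_of v ys) = v + sum_list (map shift ys)"
  by (induction ys arbitrary: v) (auto simp: graph_simps edge_src_edge add.assoc)

lemma path_of_append: "path_of v (ys @ zs) = path_of v ys @ path_of (v + sum_list (map shift ys)) zs"
  by (induction ys arbitrary: v) (auto simp: add.assoc)

lemma Arr_F: "p \<in> Arr F \<longleftrightarrow> (\<exists>v ys. p = (v, path_of v ys) \<and> set ys \<subseteq> letters)"
proof
  assume "p \<in> Arr F"
  then obtain v es where "p = (v, es)" "is_path E v es" by (auto simp: free_cat_def)
  then show "\<exists>v ys. p = (v, path_of v ys) \<and> set ys \<subseteq> letters"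
    using is_path_iff[of v es] by (intro exI[of _ v] exI[of _ "map fst es"]) auto
next
  assume "\<exists>v ys. p = (v, path_of v ys) \<and> set ys \<subseteq> letters"
  then obtain v ys where p: "p = (v, path_of v ys)" "set ys \<subseteq> letters" by blast
  have "fst ` set (path_of v ys) = set ys" using map_fst_path_of[of v ys] by (metis list.set_map)
  then have "is_path E v (path_of v ys)" using p(2) by (simp add: is_path_iff)
  then show "p \<in> Arr F" using p(1) by (simp add: free_cat_def)
qed

text \<open>With the range, this is a normal form of a path: congruent paths are those that agree in both.\<close>

definition sort_letters :: "'x letter list \<Rightarrow> nat \<Rightarrow> 'x letter list" where
  "sort_letters ys = (\<lambda>j\<in>{1..k}. filter (\<lambda>y. y \<in> alphabet j) ys)"

definition nf_path :: "'x path \<Rightarrow> bit \<times> (nat \<Rightarrow> 'x letter list)" where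
  "nf_path p = (fst p, sort_letters (map fst (snd p)))"

lemma nf_path_of: "nf_path (v, path_of v ys) = (v, sort_letters ys)"
  by (simp add: nf_path_def)

lemma sort_letters_words: "sort_letters ys \<in> words"
  by (auto simp: sort_letters_def words_def)

lemma one_colour: "y \<in> alphabet i \<Longrightarrow> y \<in> alphabet j \<Longrightarrow> i \<in> {1..k} \<Longrightarrow> j \<in> {1..k} \<Longrightarrow> i = j"
proof (rule ccontr)
  assume y: "y \<in> alphabet i" "y \<in> alphabet j" and ij: "i \<in> {1..k}" "j \<in> {1..k}" "i \<noteq> j"
  have "X i \<inter> X j = {}" using disj ij by (simp add: disjoint_family_on_def)
  then show False using y by (auto simp: alphabet_def)
qed

lemma labs_sort: "set ys \<subseteq> letters \<Longrightarrow> labs (sort_letters ys) = sum_list (map shift ys)"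
proof (induction ys)
  case (Cons y ys)
  then obtain i where i: "i \<in> {1..k}" "y \<in> alphabet i" by auto
  have "labs (sort_letters (y # ys)) = (\<Sum>j\<in>{1..k}. (if j = i then shift y else 0) + sum_list (map shift (sort_letters ys j)))"
    unfolding labs_def
  proof (rule sum.cong)
    fix j assume j: "j \<in> {1..k}"
    then have "y \<in> alphabet j \<longleftrightarrow> j = i" using one_colour i by blast
    then show "sum_list (map shift (sort_letters (y # ys) j)) = (if j = i then shift y else 0) + sum_list (map shift (sort_letters ys j))"
      using j by (simp add: sort_letters_def)
  qed simp
  also have "\<dots> = shift y + labs (sort_letters ys)" using i by (simp add: sum.distrib labs_def sum.delta)
  finally show ?case using Cons by simp
qed (simp add: sort_letters_def labs_def)

lemma target_nf: "set ys \<subseteq> letters \<Longrightarrow> target (nf_path (v, path_of v ys)) = v + sum_list (map shift ys)"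
  by (simp add: nf_path_of target_def labs_sort)

lemma Dom_F: "Dom F (v, path_of v ys) = (v + sum_list (map shift ys), [])"
  by (simp add: free_cat_def path_src_path_of)

lemma Cod_F: "Cod F (v, es) = (v, [])" by (simp add: free_cat_def)

lemma Comp_F: "Comp F (v, path_of v ys) (v + sum_list (map shift ys), path_of (v + sum_list (map shift ys)) zs) = (v, path_of v (ys @ zs))"
  by (simp add: free_cat_def path_of_append)

lemma sort_append: "sort_letters (ys @ zs) = (\<lambda>j\<in>{1..k}. sort_letters ys j @ sort_letters zs j)"
  by (auto simp: sort_letters_def)

lemma Nil_Arr: "(v, []) \<in> Arr F"
  unfolding Arr_F by (intro exI[of _ v] exI[of _ "[]"]) simp

lemma F_structure:
  assumes p: "p \<in> Arr F"
  shows "Dom F p \<in> Arr F" "Cod F p \<in> Arr F" "nf_path (Dom F p) = (target (nf_path p), \<lambda>j\<in>{1..k}. [])"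
    "nf_path (Cod F p) = (fst (nf_path p), \<lambda>j\<in>{1..k}. [])" "nf_path p \<in> arrows"
proof -
  obtain v ys where p: "p = (v, path_of v ys)" "set ys \<subseteq> letters" using p Arr_F by blast
  show "Dom F p \<in> Arr F" "Cod F p \<in> Arr F" using p by (simp_all add: Dom_F Cod_F Nil_Arr)
  show "nf_path (Dom F p) = (target (nf_path p), \<lambda>j\<in>{1..k}. [])"
    using p by (simp add: Dom_F target_nf) (simp add: nf_path_def sort_letters_def)
  show "nf_path (Cod F p) = (fst (nf_path p), \<lambda>j\<in>{1..k}. [])"
    using p by (simp add: Cod_F nf_path_def sort_letters_def)
  show "nf_path p \<in> arrows" using p by (simp add: nf_path_of arrows_def sort_letters_words)
qed

lemma F_composable:
  assumes "p \<in> Arr F" "q \<in> Arr F"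
  shows "Dom F p = Cod F q \<longleftrightarrow> target (nf_path p) = fst (nf_path q)"
proof -
  obtain v ys where p: "p = (v, path_of v ys)" "set ys \<subseteq> letters" using assms(1) Arr_F by blast
  show ?thesis using p by (cases q) (simp add: Dom_F Cod_F target_nf, simp add: nf_path_def)
qed

lemma F_Comp:
  assumes "p \<in> Arr F" "q \<in> Arr F" "Dom F p = Cod F q"
  shows "Comp F p q \<in> Arr F" "nf_path (Comp F p q) = ext (nf_path p) (snd (nf_path q))"
proof -
  obtain v ys where p: "p = (v, path_of v ys)" "set ys \<subseteq> letters" using assms(1) Arr_F by blast
  obtain u zs where q: "q = (u, path_of u zs)" "set zs \<subseteq> letters" using assms(2) Arr_F by blast
  have u: "u = v + sum_list (map shift ys)" using assms(3) p q by (simp add: Dom_F Cod_F)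
  have c: "Comp F p q = (v, path_of v (ys @ zs))" using p q u Comp_F by simp
  then show "Comp F p q \<in> Arr F" unfolding Arr_F using p q by (intro exI[of _ v] exI[of _ "ys @ zs"]) simp
  show "nf_path (Comp F p q) = ext (nf_path p) (snd (nf_path q))"
    unfolding c using p q by (simp add: nf_path_of ext_def sort_append)
qed

text \<open>All four families of relations say that two neighbouring letters of different colours may be exchanged while the
  range of the path is kept.\<close>

lemma label_rel_iff:
  "(p, q) \<in> label_rel k X l \<Longrightarrow> \<exists>v y z i i'. i \<in> {1..k} \<and> i' \<in> {1..k} \<and> i \<noteq> i' \<and> y \<in> alphabet i \<and> z \<in> alphabet i' \<and>
     p = (v, path_of v [y, z]) \<and> q = (v, path_of v [z, y])"
proof (induction rule: label_rel.induct)
  case (pos_pos i i' a b t)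
  show ?case
    by (rule exI[of _ t], rule exI[of _ "Pos a"], rule exI[of _ "Pos b"], rule exI[of _ i], rule exI[of _ i'])
      (use pos_pos in \<open>simp add: alphabet_def path2_def shift_def\<close>)
next
  case (pos_bar i i' a b t)
  show ?case
    by (rule exI[of _ "t + l b"], rule exI[of _ "Pos a"], rule exI[of _ "Bar b"], rule exI[of _ i], rule exI[of _ i'])
      (use pos_bar in \<open>cases "l a"; cases "l b"; cases t; simp add: alphabet_def path2_def shift_def\<close>)
next
  case (bar_pos i i' a b t)
  show ?case
    by (rule exI[of _ "t + l a"], rule exI[of _ "Bar a"], rule exI[of _ "Pos b"], rule exI[of _ i], rule exI[of _ i'])
      (use bar_pos in \<open>cases "l a"; cases "l b"; cases t; simp add: alphabet_def path2_def shift_def\<close>)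
next
  case (bar_bar i i' a b t)
  show ?case
    by (rule exI[of _ "t + l a + l b"], rule exI[of _ "Bar b"], rule exI[of _ "Bar a"], rule exI[of _ i'], rule exI[of _ i])
      (use bar_bar in \<open>cases "l a"; cases "l b"; cases t; simp add: alphabet_def path2_def shift_def\<close>)
qed

lemma label_relI:
  assumes i: "i \<in> {1..k}" "i' \<in> {1..k}" "i \<noteq> i'" and y: "y \<in> alphabet i" and z: "z \<in> alphabet i'"
  shows "((v, path_of v [y, z]), (v, path_of v [z, y])) \<in> label_rel k X l \<or>
    ((v, path_of v [z, y]), (v, path_of v [y, z])) \<in> label_rel k X l"
proof (cases y; cases z)
  fix a b assume ab: "y = Pos a" "z = Pos b"
  then have "a \<in> X i" "b \<in> X i'" using y z by (auto simp: alphabet_def)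
  from label_rel.pos_pos[OF i this, of l v] show ?thesis using ab
    by (simp add: path2_def shift_def)
next
  fix a b assume ab: "y = Pos a" "z = Bar b"
  then have "a \<in> X i" "b \<in> X i'" using y z by (auto simp: alphabet_def)
  from label_rel.pos_bar[OF i this, of l "v + l b"] show ?thesis using ab
    by (cases "l a"; cases "l b"; cases v; simp add: path2_def shift_def)
next
  fix a b assume ab: "y = Bar a" "z = Pos b"
  then have "a \<in> X i" "b \<in> X i'" using y z by (auto simp: alphabet_def)
  from label_rel.bar_pos[OF i this, of l "v + l a"] show ?thesis using ab
    by (cases "l a"; cases "l b"; cases v; simp add: path2_def shift_def)
next
  fix a b assume ab: "y = Bar a" "z = Bar b"
  then have "a \<in> X i" "b \<in> X i'" using y z by (auto simp: alphabet_def)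
  from label_rel.bar_bar[OF i this, of l "v + l a + l b"] show ?thesis using ab
    by (cases "l a"; cases "l b"; cases v; simp add: path2_def shift_def)
qed

text \<open>Exchanging neighbours of different colours does not affect the word of any one colour.\<close>

lemma Q_sound: "(p, q) \<in> Q \<Longrightarrow> p \<in> Arr F \<and> q \<in> Arr F \<and> nf_path p = nf_path q"
proof (induction rule: cat_congruence.induct)
  case (base p q)
  then obtain v y z i i' where i: "i \<in> {1..k}" "i' \<in> {1..k}" "i \<noteq> i'" "y \<in> alphabet i" "z \<in> alphabet i'"
    and pq: "p = (v, path_of v [y, z])" "q = (v, path_of v [z, y])" using label_rel_iff by blast
  have "set [y, z] \<subseteq> letters" "set [z, y] \<subseteq> letters" using i by auto
  then have "p \<in> Arr F" "q \<in> Arr F" unfolding Arr_F using pq by blast+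
  moreover have "sort_letters [y, z] = sort_letters [z, y]"
    unfolding sort_letters_def
  proof (rule restrict_ext)
    fix j assume "j \<in> {1..k}"
    then have "\<not> (y \<in> alphabet j \<and> z \<in> alphabet j)" using one_colour i by metis
    then show "filter (\<lambda>y. y \<in> alphabet j) [y, z] = filter (\<lambda>y. y \<in> alphabet j) [z, y]" by auto
  qed
  ultimately show ?case unfolding pq nf_path_of by simp
next
  case (comp a b c d)
  then show ?case using F_Comp by simp
qed auto

definition related where
  "related v ys zs \<longleftrightarrow> ((v, path_of v ys), (v, path_of v zs)) \<in> Q"

lemma path_Arr: "set ys \<subseteq> letters \<Longrightarrow> (v, path_of v ys) \<in> Arr F"
  unfolding Arr_F by blast

lemma related_refl: "set ys \<subseteq> letters \<Longrightarrow> related v ys ys"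
  unfolding related_def by (intro cat_congruence.refl path_Arr)

lemma related_sym: "related v ys zs \<Longrightarrow> related v zs ys"
  unfolding related_def by (rule cat_congruence.sym)

lemma related_trans: "related v xs ys \<Longrightarrow> related v ys zs \<Longrightarrow> related v xs zs"
  unfolding related_def by (rule cat_congruence.trans)

lemma related_append:
  assumes "related v xs ys" "sum_list (map shift xs) = sum_list (map shift ys)"
    "related (v + sum_list (map shift xs)) xs' ys'"
  shows "related v (xs @ xs') (ys @ ys')"
proof -
  have "(Comp F (v, path_of v xs) (v + sum_list (map shift xs), path_of (v + sum_list (map shift xs)) xs'),
      Comp F (v, path_of v ys) (v + sum_list (map shift xs), path_of (v + sum_list (map shift xs)) ys')) \<in> Q"
    by (rule cat_congruence.comp[OF assms(1,3)[unfolded related_def]]) (simp_all add: Dom_F Cod_F assms(2))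
  then show ?thesis using Comp_F[of v xs xs'] Comp_F[of v ys ys'] assms(2) by (simp add: related_def)
qed

lemma related_Cons:
  assumes "y \<in> letters" "related (v + shift y) ys zs"
  shows "related v (y # ys) (y # zs)"
  using related_append[OF related_refl[of "[y]" v] _, of ys zs] assms by simp

lemma related_swap:
  assumes i: "i \<in> {1..k}" "i' \<in> {1..k}" "i \<noteq> i'" and y: "y \<in> alphabet i" and z: "z \<in> alphabet i'"
    and zs: "set zs \<subseteq> letters"
  shows "related v (y # z # zs) (z # y # zs)"
proof -
  have "related v [y, z] [z, y]"
    using label_relI[OF i y z, of v] cat_congruence.base cat_congruence.sym unfolding related_def by metis
  from related_append[OF this _ related_refl[OF zs]] show ?thesis by (simp add: add.commute)
qed

lemma related_move:
  assumes i: "i \<in> {1..k}" "y \<in> alphabet i"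
  shows "set xs \<subseteq> letters \<Longrightarrow> (\<And>x. x \<in> set xs \<Longrightarrow> x \<notin> alphabet i) \<Longrightarrow> set zs \<subseteq> letters \<Longrightarrow>
    related v (xs @ y # zs) (y # xs @ zs)"
proof (induction xs arbitrary: v)
  case Nil
  have "set (y # zs) \<subseteq> letters" using Nil i by auto
  then show ?case using related_refl by simp
next
  case (Cons x xs)
  then obtain j where j: "j \<in> {1..k}" "x \<in> alphabet j" by auto
  then have "j \<noteq> i" using Cons(3)[of x] by auto
  have "related v (x # xs @ y # zs) (x # y # xs @ zs)"
    using Cons by (intro related_Cons) auto
  moreover have "related v (x # y # xs @ zs) (y # x # xs @ zs)"
    using related_swap[OF j(1) i(1) \<open>j \<noteq> i\<close> j(2) i(2)] Cons by simp
  ultimately show ?case using related_trans by simp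
qed

text \<open>Move the first letter of one path to the front of the other, past letters of different colours, and cancel it.\<close>

lemma related_complete:
  "set ys \<subseteq> letters \<Longrightarrow> set zs \<subseteq> letters \<Longrightarrow> sort_letters ys = sort_letters zs \<Longrightarrow> related v ys zs"
proof (induction ys arbitrary: v zs)
  case Nil
  have "zs = []"
  proof (rule ccontr)
    assume "zs \<noteq> []"
    then obtain z zs' where z: "zs = z # zs'" by (cases zs) auto
    then obtain i where i: "i \<in> {1..k}" "z \<in> alphabet i" using Nil by auto
    have "sort_letters [] i = sort_letters zs i" using Nil by simp
    then show False using i z by (simp add: sort_letters_def)
  qed
  then show ?case using related_refl by simp
next
  case (Cons y ys)
  then obtain i where i: "i \<in> {1..k}" "y \<in> alphabet i" by auto
  have eq: "filter (\<lambda>y. y \<in> alphabet j) (y # ys) = filter (\<lambda>y. y \<in> alphabet j) zs" if "j \<in> {1..k}" for j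
    using fun_cong[OF Cons(4), of j] that by (simp add: sort_letters_def)
  have "filter (\<lambda>y. y \<in> alphabet i) zs = y # filter (\<lambda>y. y \<in> alphabet i) ys" using eq[OF i(1)] i(2) by simp
  then obtain xs ws where zs: "zs = xs @ y # ws" "\<forall>x\<in>set xs. x \<notin> alphabet i"
    unfolding filter_eq_Cons_iff by blast
  have sub: "set xs \<subseteq> letters" "set ws \<subseteq> letters" "set (xs @ ws) \<subseteq> letters" using Cons(3) zs by auto
  have "related v zs (y # xs @ ws)"
    unfolding zs(1) by (rule related_move[OF i]) (use sub zs(2) in auto)
  moreover have "filter (\<lambda>y. y \<in> alphabet j) ys = filter (\<lambda>y. y \<in> alphabet j) (xs @ ws)" if j: "j \<in> {1..k}" for j
  proof (cases "j = i")
    case True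
    then show ?thesis using eq[OF j] zs i by (simp add: filter_False)
  next
    case False
    then have "y \<notin> alphabet j" using one_colour i j by blast
    then show ?thesis using eq[OF j] zs by simp
  qed
  then have "sort_letters ys = sort_letters (xs @ ws)" unfolding sort_letters_def by (intro restrict_ext)
  then have "related (v + shift y) ys (xs @ ws)" using Cons sub(3) by simp
  then have "related v (y # ys) (y # xs @ ws)" using Cons by (intro related_Cons) auto
  ultimately show ?case using related_trans related_sym by blast
qed

lemma Q_iff: "(p, q) \<in> Q \<longleftrightarrow> p \<in> Arr F \<and> q \<in> Arr F \<and> nf_path p = nf_path q"
proof
  assume pq: "p \<in> Arr F \<and> q \<in> Arr F \<and> nf_path p = nf_path q"
  obtain v ys where p: "p = (v, path_of v ys)" "set ys \<subseteq> letters" using pq Arr_F by blast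
  obtain u zs where q: "q = (u, path_of u zs)" "set zs \<subseteq> letters" using pq Arr_F by blast
  have "u = v" "sort_letters ys = sort_letters zs" using pq p q by (simp_all add: nf_path_of)
  then show "(p, q) \<in> Q" using related_complete[OF p(2) q(2), of v] p q by (simp add: related_def)
qed (use Q_sound in blast)

abbreviation "C \<equiv> C_label k X l"

definition path_class where "path_class p = Q `` {p}"

lemma path_class_iff: "p \<in> Arr F \<Longrightarrow> q \<in> path_class p \<longleftrightarrow> q \<in> Arr F \<and> nf_path q = nf_path p"
  unfolding path_class_def by (auto simp: Q_iff)

lemma path_class_eq: "p \<in> Arr F \<Longrightarrow> q \<in> Arr F \<Longrightarrow> nf_path p = nf_path q \<Longrightarrow> path_class p = path_class q"
  by (auto simp: path_class_iff)

lemma C_simps: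
  "Arr C = path_class ` Arr F" "Dom C S = (\<Union>a\<in>S. path_class (Dom F a))" "Cod C S = (\<Union>a\<in>S. path_class (Cod F a))"
  "Comp C S T = (\<Union>a\<in>S. \<Union>b\<in>T. path_class (Comp F a b))"
  unfolding C_label_def Let_def cat.extend_def quotient_cat_def path_class_def by (auto simp: quotient_def)

lemma UN_path_class:
  assumes "p \<in> Arr F" "\<And>q. q \<in> Arr F \<Longrightarrow> nf_path q = nf_path p \<Longrightarrow> f q = c"
  shows "(\<Union>q\<in>path_class p. f q) = c"
proof -
  have "f q = c" if "q \<in> path_class p" for q using that assms path_class_iff by blast
  moreover have "p \<in> path_class p" using assms path_class_iff by blast
  ultimately show ?thesis by blast
qed

lemma Dom_C: assumes p: "p \<in> Arr F" shows "Dom C (path_class p) = path_class (Dom F p)"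
  unfolding C_simps by (rule UN_path_class[OF p]) (use F_structure p in \<open>simp add: path_class_eq\<close>)

lemma Cod_C: assumes p: "p \<in> Arr F" shows "Cod C (path_class p) = path_class (Cod F p)"
  unfolding C_simps by (rule UN_path_class[OF p]) (use F_structure p in \<open>simp add: path_class_eq\<close>)

lemma Comp_C:
  assumes p: "p \<in> Arr F" "q \<in> Arr F" "Dom F p = Cod F q"
  shows "Comp C (path_class p) (path_class q) = path_class (Comp F p q)"
  unfolding C_simps
proof (rule UN_path_class[OF p(1)], rule UN_path_class[OF p(2)])
  fix a b assume ab: "a \<in> Arr F" "nf_path a = nf_path p" "b \<in> Arr F" "nf_path b = nf_path q"
  then have "Dom F a = Cod F b" using F_composable p by simp
  then show "path_class (Comp F a b) = path_class (Comp F p q)"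
    using F_Comp[OF ab(1,3)] F_Comp[OF p] ab by (intro path_class_eq) simp_all
qed

definition nf where "nf S = the_elem (nf_path ` S)"

lemma nf_path_class: "p \<in> Arr F \<Longrightarrow> nf (path_class p) = nf_path p"
proof -
  assume p: "p \<in> Arr F"
  then have "p \<in> path_class p" using path_class_iff by blast
  moreover have "nf_path q = nf_path p" if "q \<in> path_class p" for q using that path_class_iff[OF p] by blast
  then have "nf_path ` path_class p = (\<lambda>_. nf_path p) ` path_class p" by (rule image_cong[OF HOL.refl])
  ultimately have "nf_path ` path_class p = {nf_path p}" using image_constant by metis
  then show ?thesis by (simp add: nf_def)
qed

lemma nf_surj:
  assumes "q \<in> arrows"
  shows "\<exists>p\<in>Arr F. nf_path p = q"
proof -
  have w: "snd q \<in> words" using assms by (simp add: arrows_def mem_Times_iff)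
  have sub: "set (snd q j) \<subseteq> alphabet j" if "j \<in> {1..k}" for j using wordsD[OF w that] .
  have "\<exists>ys. set ys \<subseteq> letters \<and> (\<forall>j\<in>{1..k}. filter (\<lambda>y. y \<in> alphabet j) ys = (if j \<le> n then snd q j else []))"
    if "n \<le> k" for n
    using that
  proof (induction n)
    case 0
    show ?case by (intro exI[of _ "[]"]) auto
  next
    case (Suc n)
    then obtain ys where ys: "set ys \<subseteq> letters"
      "\<forall>j\<in>{1..k}. filter (\<lambda>y. y \<in> alphabet j) ys = (if j \<le> n then snd q j else [])" by auto
    have n: "Suc n \<in> {1..k}" using Suc by simp
    have "filter (\<lambda>y. y \<in> alphabet j) (snd q (Suc n)) = (if j = Suc n then snd q (Suc n) else [])"
      if "j \<in> {1..k}" for j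
      using sub[OF n] one_colour[OF _ _ n that] by (auto simp: filter_id_conv filter_empty_conv)
    moreover have "set (snd q (Suc n)) \<subseteq> letters" using sub[OF n] n by blast
    ultimately show ?case using ys by (intro exI[of _ "ys @ snd q (Suc n)"]) auto
  qed
  from this[of k] obtain ys where ys: "set ys \<subseteq> letters"
    "\<forall>j\<in>{1..k}. filter (\<lambda>y. y \<in> alphabet j) ys = snd q j" by auto
  have "sort_letters ys = snd q"
    using ys w by (intro words_eqI[OF sort_letters_words]) (simp_all add: sort_letters_def)
  then have "nf_path (fst q, path_of (fst q) ys) = q" by (simp add: nf_path_of)
  then show ?thesis using path_Arr[OF ys(1)] by blast
qed

sublocale word_category "{1..k}" alphabet UNIV shift bar_flip C nf
proof
  show "bij_betw nf (Arr C) arrows"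
    unfolding bij_betw_def
  proof
    show "inj_on nf (Arr C)"
    proof (rule inj_onI)
      fix S T assume "S \<in> Arr C" "T \<in> Arr C" and eq: "nf S = nf T"
      then obtain p q where p: "p \<in> Arr F" "S = path_class p" and q: "q \<in> Arr F" "T = path_class q"
        unfolding C_simps by blast
      have "nf_path p = nf_path q" using eq p q nf_path_class by simp
      then show "S = T" using path_class_eq[OF p(1) q(1)] p q by simp
    qed
    show "nf ` Arr C = arrows"
      unfolding C_simps image_image using F_structure(5) nf_surj by (force simp: nf_path_class)
  qed
next
  fix a assume "a \<in> Arr C"
  then obtain p where p: "p \<in> Arr F" "a = path_class p" by (auto simp: C_simps)
  show "Dom C a \<in> Arr C" "nf (Dom C a) = (target (nf a), \<lambda>j\<in>{1..k}. [])"
    "Cod C a \<in> Arr C" "nf (Cod C a) = (fst (nf a), \<lambda>j\<in>{1..k}. [])"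
    unfolding p(2) Dom_C[OF p(1)] Cod_C[OF p(1)] using F_structure[OF p(1)] p(1) by (simp_all add: nf_path_class C_simps(1))
  fix b assume "b \<in> Arr C" and ab: "Dom C a = Cod C b"
  then obtain q where q: "q \<in> Arr F" "b = path_class q" by (auto simp: C_simps)
  have "nf (path_class (Dom F p)) = nf (path_class (Cod F q))"
    using ab p q Dom_C Cod_C by simp
  then have "target (nf_path p) = fst (nf_path q)"
    using F_structure[OF p(1)] F_structure[OF q(1)] by (simp add: nf_path_class)
  then have d: "Dom F p = Cod F q" using F_composable p q by simp
  show "Comp C a b \<in> Arr C" "nf (Comp C a b) = ext (nf a) (snd (nf b))"
    unfolding p(2) q(2) Comp_C[OF p(1) q(1) d] using F_Comp[OF p(1) q(1) d] p q by (simp_all add: nf_path_class C_simps(1))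
qed

theorem not_iso_brin_thompson:
  assumes odd: "\<And>x. x \<in> X 2 \<Longrightarrow> l x = 1" and n: "0 < n"
  shows "\<not> G_group C \<cong> brin_thompson n"
proof
  assume "G_group C \<cong> brin_thompson n"
  then obtain f0 where f0: "f0 \<in> iso (G_group C) (brin_thompson n)" by (auto simp: is_iso_def)
  have k2: "1 \<in> {1..k}" "2 \<in> {1..k}" using k by auto
  interpret N: word_space "{..<n}" "\<lambda>_. UNIV :: bool set" "{0}" "\<lambda>_. 0" Not
    by (rule word_space_bool[OF n])
  define f where "f = lift_cantor n \<circ> (f0 \<circ> germs)"
  have f: "f \<in> iso G N.G"
    unfolding f_def by (rule iso_set_trans[OF iso_set_trans[OF germs_iso f0] brin_thompson_iso[OF n]])
  have fin: "finite (X 2)" "X 2 \<noteq> {}" using X k2 by blast+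
  have "Pos ` X 2 \<inter> Bar ` X 2 = {}" by auto
  then have "card (alphabet 2) = card (Pos ` X 2) + card (Bar ` X 2)"
    unfolding alphabet_eq using fin by (intro card_Un_disjoint) auto
  then have card: "card (alphabet 2) = 2 * card (X 2)" "card (X 2) > 0"
    using fin by (simp_all add: card_image inj_on_def card_gt_0_iff)
  interpret odd_binary_iso "{1..k}" alphabet UNIV shift bar_flip 2 1 "card (X 2)"
    "{..<n}" "\<lambda>_. UNIV :: bool set" "{0}" "\<lambda>_. 0" Not f
    by unfold_locales (use f card k2 odd in \<open>auto simp: alphabet_def shift_def\<close>)
  show False by (rule no_iso)
qed

end

theorem mainTheorem4:
  fixes k :: nat and m :: "nat \<Rightarrow> nat" and X :: "nat \<Rightarrow> 'x set"
  assumes "k \<ge> 2"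
    and "\<And>i. i \<in> {1..k} \<Longrightarrow> m i > 0"
    and "\<And>i. i \<in> {1..k} \<Longrightarrow> finite (X i) \<and> card (X i) = m i"
    and "disjoint_family_on X {1..k}"
  shows "(\<forall>n\<ge>2. \<not> G_group (C_u k X) \<cong> brin_thompson n) \<and>
         (\<forall>n\<ge>2. \<not> G_group (C_m k X) \<cong> brin_thompson n)"
proof -
  have alph: "labelled_alphabets k X"
  proof
    fix i assume i: "i \<in> {1..k}"
    show "finite (X i)" using assms(3)[OF i] by blast
    show "X i \<noteq> {}" using assms(2,3)[OF i] by auto
  qed (use assms in auto)
  have "X 1 \<inter> X 2 = {}" using assms(1,4) by (auto simp: disjoint_family_on_def)
  then have "x \<notin> X 1" if "x \<in> X 2" for x using that by blast
  then show ?thesis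
    using labelled_alphabets.not_iso_brin_thompson[OF alph]
    by (simp add: C_u_def C_m_def)
qed

end
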